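(* Let $\mathcal{H}$ be a real Hilbert space, $T>0$, $I=[0,T]$, and $D:=\{(t,s)\in I\times I: s\le t\}$. Assume: (C) $C\colon I\times\mathcal{H}\rightrightarrows\mathcal{H}$ is a set-valued map with nonempty, closed and $\rho$-uniformly prox-regular values, for some $\rho>0$, such that: (i) there are an absolutely continuous function $v\colon I\to\mathbb{R}$ and $L\in[0,1[$ with $\operatorname{Haus}(C(t,x),C(s,y))\le|v(t)-v(s)|+L\|x-y\|$ for all $t,s\in I$ and $x,y\in\mathcal{H}$; (ii) for every $t\in I$, all bounded sets $A,B\subset\mathcal{H}$ and all $r>0$, the set $C(t,A)\cap B\cap r\mathbb{B}$ is relatively compact. (f) $f\colon I\times\mathcal{H}\to\mathcal{H}$ satisfies: (i) for each $x\in\mathcal{H}$ the map $t\mapsto f(t,x)$ is measurable; (ii) there are nonnegative integrable functions $\alpha,\beta\colon I\to\mathbb{R}$ with $\|f(t,x)\|\le \alpha(t)\|x\|+\beta(t)$ for all $(t,x)\in I\times\mathcal{H}$; (iii) for each $r>0$ there is a constant $\kappa_f^r\ge 0$ such that $\|f(t,x)-f(t,y)\|\le\kappa_f^r\|x-y\|$ for all $x,y\in r\mathbb{B}$ and $t\in I$. (g) $g\colon I\times I\times\mathcal{H}\to\mathcal{H}$ satisfies: (a) for each $x\in\mathcal{H}$ the map $(t,s)\mapsto g(t,s,x)$ is measurable; (b) for all $r>0$ there is an integrable function $\mu_r\colon I\to\mathbb{R}_+$ such that for all $(t,s)\in D$, $\|g(t,s,x)-g(t,s,y)\|\le\mu_r(t)\|x-y\|$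 for all $x,y\in r\mathbb{B}$; (c) there is a nonnegative integrable function $\sigma\colon D\to\mathbb{R}$ such that $\|g(t,s,x)\|\le\sigma(t,s)(1+\|x\|)$ for all $(t,s)\in D$ and $x\in\mathcal{H}$. Then for any $x_0\in\mathcal{H}$ with $x_0\in C(0,x_0)$ there exists at least one absolutely continuous solution $x\colon I\to\mathcal{H}$ of $$\dot{x}(t)\in -N_{C(t,x(t))}(x(t))+f(t,x(t))+\int_0^t g(t,s,x(s))\,ds\ \text{ for a.e. } t\in I,\qquad x(0)=x_0.$$
   Context: $\mathbb{B}$ is the closed unit ball of $\mathcal{H}$, and $C(t,A):=\bigcup_{a\in A}C(t,a)$. A function $x\colon[0,T]\to\mathcal{H}$ is absolutely continuous if there are $x_0\in\mathcal{H}$ and $h\in L^1([0,T];\mathcal{H})$ with $x(t)=x_0+\int_0^t h(s)\,ds$ for all $t\in[0,T]$ (then $\dot{x}=h$ a.e.). For a nonempty closed set $S\subset\mathcal{H}$, $d_S(x)=\inf_{y\in S}\|x-y\|$, and $\operatorname{Proj}_S(x)$ is the set of points of $S$ at which this infimum is attained. For closed sets $A,B$, $\operatorname{Haus}(A,B)=\max\{\sup_{x\in A}d_B(x),\sup_{x\in B}d_A(x)\}$. $N_S(x)$ denotes the proximal normal cone: for $x\in S$, $v\in N_S(x)$ iff there is $\sigma\ge 0$ such that $\langle v,y-x\rangle\le\sigma\|y-x\|^2$ for all $y\in S$; for $x\notin S$, $N_S(x)=\emptyset$. A closed set $S$ is $\rho$-uniformly prox-regular ($\rho\in\,]0,+\infty]$)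 if for all $x\in S$ and all $v\in N_S(x)\cap\mathbb{B}$ one has $x\in\operatorname{Proj}_S(x+tv)$ for every real $t$ with $0\le t\le\rho$. *)

theory Defs
  imports "HOL-Analysis.Analysis"
begin

text \<open>
  The measurability and integration theory for maps with values in a Banach space is set up here
  because the Bochner integral of \<^theory>\<open>HOL-Analysis.Bochner_Integration\<close> is restricted to second
  countable value spaces, which would force the Hilbert space to be separable.

  Strong (Bochner) measurability: an almost everywhere limit of simple functions. It is used with
  complete measures only, where for separable value spaces it is Borel measurability.
\<close>

definition strongly_measurable :: "'a measure \<Rightarrow> ('a \<Rightarrow> 'b::topological_space) \<Rightarrow> bool" where
  "strongly_measurable M f \<longleftrightarrow>
     (\<exists>s. (\<forall>i::nat. simple_function M (s i)) \<and> (AE x in M. (\<lambda>i. s i x) \<longlonglongrightarrow> f x))"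

lemma strongly_measurable_iff_borel_measurable:
  fixes f :: "'a \<Rightarrow> 'b::{metric_space, second_countable_topology}"
  assumes "complete_measure M"
  shows "strongly_measurable M f \<longleftrightarrow> f \<in> borel_measurable M"
proof
  assume "f \<in> borel_measurable M"
  from borel_measurable_implies_sequence_metric[OF this, of undefined] show "strongly_measurable M f"
    unfolding strongly_measurable_def by (auto intro: AE_I2)
next
  interpret complete_measure M by fact
  assume "strongly_measurable M f"
  then obtain s where s: "\<And>i::nat. simple_function M (s i)" and ae: "AE x in M. (\<lambda>i. s i x) \<longlonglongrightarrow> f x"
    unfolding strongly_measurable_def by auto
  from ae obtain N where N: "N \<in> null_sets M" and lim: "\<And>x. x \<in> space M - N \<Longrightarrow> (\<lambda>i. s i x) \<longlonglongrightarrow> f x"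
    by (rule AE_E3) blast
  define c :: 'b where "c = undefined"
  have [measurable]: "N \<in> sets M" "\<And>i. s i \<in> borel_measurable M"
    using N s by (auto intro: borel_measurable_simple_function)
  have g: "(\<lambda>x. if x \<in> N then c else f x) \<in> borel_measurable M"
    by (rule borel_measurable_LIMSEQ_metric[where f = "\<lambda>i x. if x \<in> N then c else s i x"])
       (use lim in auto)
  show "f \<in> borel_measurable M"
  proof (rule measurableI)
    fix A :: "'b set" assume A: "A \<in> sets borel"
    have "f -` A \<inter> space M \<inter> N \<in> sets M"
      using complete[of _ N] N by auto
    then have "((\<lambda>x. if x \<in> N then c else f x) -` A \<inter> space M - N) \<union> (f -` A \<inter> space M \<inter> N) \<in> sets M"
      using measurable_sets[OF g A] \<open>N \<in> sets M\<close> by (intro sets.Un sets.Diff)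
    also have "((\<lambda>x. if x \<in> N then c else f x) -` A \<inter> space M - N) \<union> (f -` A \<inter> space M \<inter> N)
        = f -` A \<inter> space M"
      by auto
    finally show "f -` A \<inter> space M \<in> sets M" .
  qed simp
qed

text \<open>The library's \<^const>\<open>has_bochner_integral\<close> without the restriction to second countable spaces.\<close>

definition has_bochner_integral_gen ::
    "'a measure \<Rightarrow> ('a \<Rightarrow> 'b::real_normed_vector) \<Rightarrow> 'b \<Rightarrow> bool" where
  "has_bochner_integral_gen M f I \<longleftrightarrow>
     f \<in> borel_measurable M \<and>
     (\<exists>s. (\<forall>i::nat. Bochner_Integration.simple_bochner_integrable M (s i)) \<and>
          (\<lambda>i. \<integral>\<^sup>+x. ennreal (norm (f x - s i x)) \<partial>M) \<longlonglongrightarrow> 0 \<and>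
          (\<lambda>i. Bochner_Integration.simple_bochner_integral M (s i)) \<longlonglongrightarrow> I)"

definition bochner_integrable :: "'a measure \<Rightarrow> ('a \<Rightarrow> 'b::real_normed_vector) \<Rightarrow> bool" where
  "bochner_integrable M f \<longleftrightarrow> (\<exists>I. has_bochner_integral_gen M f I)"

definition bochner_integral :: "'a measure \<Rightarrow> ('a \<Rightarrow> 'b::real_normed_vector) \<Rightarrow> 'b" where
  "bochner_integral M f =
     (if bochner_integrable M f then THE I. has_bochner_integral_gen M f I else 0)"

lemma has_bochner_integral_gen_iff: "has_bochner_integral_gen M f I \<longleftrightarrow> has_bochner_integral M f I"
  by (simp only: has_bochner_integral_gen_def has_bochner_integral.simps) metis

lemma bochner_integrable_iff: "bochner_integrable M f \<longleftrightarrow> integrable M f"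
  by (simp add: bochner_integrable_def has_bochner_integral_gen_iff integrable.simps)

lemma bochner_integral_eq: "bochner_integral M f = integral\<^sup>L M f"
  unfolding bochner_integral_def bochner_integrable_def has_bochner_integral_gen_iff
    lebesgue_integral_def by (rule refl)

definition abs_continuous_on_interval :: "real \<Rightarrow> (real \<Rightarrow> 'b::real_normed_vector) \<Rightarrow> bool" where
  "abs_continuous_on_interval T x \<longleftrightarrow>
     (\<exists>x\<^sub>0 h. bochner_integrable (lebesgue_on {0..T}) h \<and>
        (\<forall>t\<in>{0..T}. x t = x\<^sub>0 + bochner_integral (lebesgue_on {0..t}) h))"

text \<open>
  \<^term>\<open>infdist x S\<close> is the distance function of a nonempty set \<^term>\<open>S\<close>. Extended reals are needed
  since the Hausdorff distance of unbounded sets can be infinite. All sets it is applied to are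
  nonempty.
\<close>

definition Haus :: "'a::metric_space set \<Rightarrow> 'a set \<Rightarrow> ereal" where
  "Haus A B = max (SUP x\<in>A. ereal (infdist x B)) (SUP x\<in>B. ereal (infdist x A))"

definition Proj :: "'a::metric_space set \<Rightarrow> 'a \<Rightarrow> 'a set" where
  "Proj S x = {y \<in> S. dist x y = infdist x S}"

definition proximal_normal_cone :: "'a::real_inner set \<Rightarrow> 'a \<Rightarrow> 'a set" where
  "proximal_normal_cone S x =
     {v. x \<in> S \<and> (\<exists>\<sigma>\<ge>0. \<forall>y\<in>S. inner v (y - x) \<le> \<sigma> * (norm (y - x))\<^sup>2)}"

definition uniformly_prox_regular :: "ereal \<Rightarrow> 'a::real_inner set \<Rightarrow> bool" where
  "uniformly_prox_regular \<rho> S \<longleftrightarrow>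
     closed S \<and>
     (\<forall>x\<in>S. \<forall>v \<in> proximal_normal_cone S x \<inter> cball 0 1.
        \<forall>t::real. 0 \<le> t \<and> ereal t \<le> \<rho> \<longrightarrow> x \<in> Proj S (x + t *\<^sub>R v))"

text \<open>
  Solutions of the state-dependent sweeping process on \<open>[0,T]\<close>. The integral term is required to
  exist for almost every \<open>t\<close>, and the derivative is the actual one.
\<close>

definition sweeping_solution ::
    "real \<Rightarrow> (real \<Rightarrow> 'a::real_inner \<Rightarrow> 'a set) \<Rightarrow> (real \<Rightarrow> 'a \<Rightarrow> 'a) \<Rightarrow>
     (real \<Rightarrow> real \<Rightarrow> 'a \<Rightarrow> 'a) \<Rightarrow> 'a \<Rightarrow> (real \<Rightarrow> 'a) \<Rightarrow> bool" where
  "sweeping_solution T C f g x\<^sub>0 x \<longleftrightarrow>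
     abs_continuous_on_interval T x \<and> x 0 = x\<^sub>0 \<and>
     (AE t in lebesgue_on {0..T}.
        bochner_integrable (lebesgue_on {0..t}) (\<lambda>s. g t s (x s)) \<and>
        (\<exists>x'. (x has_vector_derivative x') (at t within {0..T}) \<and>
              x' \<in> {- n + f t (x t) + bochner_integral (lebesgue_on {0..t}) (\<lambda>s. g t s (x s)) | n.
                      n \<in> proximal_normal_cone (C t (x t)) (x t)}))"

end

theory Submission
  imports Defs "HOL-Library.Diagonal_Subsequence"
begin

text \<open>
  Let \<open>\<theta>(t) = \<integral>\<^sub>0\<^sup>t m\<close>, where \<open>m \<ge> 1\<close> dominates the density of \<open>v\<close> and all growth bounds, and take nodes that are
  equidistant for \<open>\<theta>\<close>. The catching-up scheme projects \<open>X\<^sub>i\<close> plus the increment of the integrated perturbation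
  onto \<open>C(t\<^sub>i\<^sub>+\<^sub>1, X\<^sub>i)\<close>; since \<open>L < 1\<close>, its steps are bounded by a multiple of the mesh. As the sets
  \<open>C(t, A)\<close> are ball-compact, a subsequence of the paths converges uniformly to a path \<open>x\<close> that is Lipschitz with
  respect to \<open>\<theta>\<close>. Prox-regularity bounds \<open>\<langle>n\<^sub>i, y - X\<^sub>i\<^sub>+\<^sub>1\<rangle>\<close> for each discrete normal \<open>n\<^sub>i\<close>; summing over the nodes in
  \<open>[s,t]\<close> and passing to the limit gives an integrated variational inequality for \<open>x\<close>, which yields the inclusion
  wherever \<open>x\<close>, \<open>\<theta>\<close> and the integrated perturbation are differentiable. No weak convergence of derivatives is needed.

  That \<open>x\<close> is the integral of a Bochner integrable density follows from the \<open>L\<^sup>2(m dt)\<close> convergence of the martingale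
  of its slopes over dyadic \<open>\<theta>\<close>-intervals, and almost everywhere differentiability from Henstock's lemma and the
  Vitali covering theorem.
\<close>

section \<open>Bochner integrals without separability\<close>

text \<open>The space need not be separable, and then sums of Borel maps may fail to be Borel.
  Measurability is therefore carried as Borel measurability plus an essentially separable range,
  which survives limits and continuous combinations, and vector identities are reduced to scalar
  ones by testing with inner products.

  Projecting onto \<open>C(t_{i+1}, X_i)\<close> keeps each step explicit: \<open>X_i\<close> lies
  in \<open>C(t_i, X_{i-1})\<close>, so its distance to the next set is at most the mesh plus
  \<open>L\<close> times the previous increment.

  The discrete normals have norm at most a constant times the mesh. As the prox-regularity error is
  linear in that norm, the errors add up to a multiple of \<theta>(t) - \<theta>(s). Dividing by t -
  s and letting t tend to s from the right leaves only the quadratic term of a proximal normal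
  inequality; this is why one-sided difference quotients at the fixed set \<open>C(s, x(s))\<close>
  are enough. The slope martingale takes the place of the Radon-Nikodym property of Hilbert space:
  it turns a curve that is Lipschitz in \<theta> into a primitive.\<close>

definition separably_measurable :: "'a measure \<Rightarrow> ('a \<Rightarrow> 'b::metric_space) \<Rightarrow> bool" where
  "separably_measurable M f \<longleftrightarrow>
     f \<in> borel_measurable M \<and> (\<exists>Q. countable Q \<and> (AE x in M. f x \<in> closure Q))"

lemma complete_measure_lebesgue_on:
  assumes "S \<in> sets lebesgue"
  shows "complete_measure (lebesgue_on S)"
proof
  fix A B assume "B \<subseteq> A" "A \<in> null_sets (lebesgue_on S)"
  then have "A \<subseteq> S" "A \<in> null_sets lebesgue"
    using assms by (simp_all add: null_sets_restrict_space)
  then have "B \<subseteq> S" "B \<in> sets lebesgue"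
    using \<open>B \<subseteq> A\<close> completion.complete by blast+
  then show "B \<in> sets (lebesgue_on S)"
    using assms by (simp add: sets_restrict_space_iff)
qed

text \<open>Overwriting everything by a constant on the exceptional null set gives an everywhere
  limit; completeness of the measure then absorbs the arbitrary values of \<open>f\<close> on that
  set.\<close>

lemma borel_measurable_AE_LIMSEQ_metric:
  fixes f :: "'a \<Rightarrow> 'b::metric_space"
  assumes "complete_measure M" and s: "\<And>i::nat. s i \<in> borel_measurable M"
    and ae: "AE x in M. (\<lambda>i. s i x) \<longlonglongrightarrow> f x"
  shows "f \<in> borel_measurable M"
proof -
  interpret complete_measure M by fact
  from ae obtain N where N: "N \<in> null_sets M" and lim: "\<And>x. x \<in> space M - N \<Longrightarrow> (\<lambda>i. s i x) \<longlonglongrightarrow> f x"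
    by (rule AE_E3) blast
  define c :: 'b where "c = undefined"
  have [measurable]: "N \<in> sets M" "\<And>i. s i \<in> borel_measurable M"
    using N s by auto
  have g: "(\<lambda>x. if x \<in> N then c else f x) \<in> borel_measurable M"
    by (rule borel_measurable_LIMSEQ_metric[where f = "\<lambda>i x. if x \<in> N then c else s i x"])
       (use lim in auto)
  show ?thesis
  proof (rule measurableI)
    fix A :: "'b set" assume A: "A \<in> sets borel"
    have "f -` A \<inter> space M \<inter> N \<in> sets M"
      using complete[of _ N] N by auto
    then have "((\<lambda>x. if x \<in> N then c else f x) -` A \<inter> space M - N) \<union> (f -` A \<inter> space M \<inter> N) \<in> sets M"
      using measurable_sets[OF g A] \<open>N \<in> sets M\<close> by (intro sets.Un sets.Diff)
    also have "((\<lambda>x. if x \<in> N then c else f x) -` A \<inter> space M - N) \<union> (f -` A \<inter> space M \<inter> N)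
        = f -` A \<inter> space M"
      by auto
    finally show "f -` A \<inter> space M \<in> sets M" .
  qed simp
qed

lemma separably_measurable_simple_function:
  fixes f :: "'a \<Rightarrow> 'b::metric_space"
  assumes "simple_function M f" shows "separably_measurable M f"
  unfolding separably_measurable_def
proof (intro conjI exI[of _ "f ` space M"] AE_I2)
  show "countable (f ` space M)"
    using assms by (simp add: simple_function_def countable_finite)
  show "f x \<in> closure (f ` space M)" if "x \<in> space M" for x
    using that closure_subset[of "f ` space M"] by auto
qed (use assms in \<open>rule borel_measurable_simple_function\<close>)

text \<open>The union of the countable sets of the approximants has a closed hull containing almost
  every limit.\<close>

lemma separably_measurable_AE_LIMSEQ:
  fixes f :: "'a \<Rightarrow> 'b::metric_space"
  assumes M: "complete_measure M" and s: "\<And>i::nat. separably_measurable M (s i)"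
    and ae: "AE x in M. (\<lambda>i. s i x) \<longlonglongrightarrow> f x"
  shows "separably_measurable M f"
proof -
  have "\<forall>i. \<exists>Q. countable Q \<and> (AE x in M. s i x \<in> closure Q)"
    using s by (auto simp: separably_measurable_def)
  then obtain Q where Q: "\<And>i. countable (Q i)" "\<And>i. AE x in M. s i x \<in> closure (Q i)"
    by metis
  have Q': "AE x in M. \<forall>i. s i x \<in> closure (Q i)"
    using Q(2) by (simp add: AE_all_countable)
  have "AE x in M. f x \<in> closure (\<Union>i. Q i)"
    using ae Q'
  proof eventually_elim
    case (elim x)
    then have "\<forall>i. s i x \<in> closure (\<Union>i. Q i)"
      by (meson UN_upper UNIV_I closure_mono subsetD)
    with elim show ?case
      by (meson closed_closure closed_sequentially)
  qed
  moreover have "f \<in> borel_measurable M"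
    using borel_measurable_AE_LIMSEQ_metric[OF M _ ae] s by (auto simp: separably_measurable_def)
  ultimately show ?thesis
    using Q(1) unfolding separably_measurable_def by (intro conjI exI[of _ "\<Union>i. Q i"]) auto
qed

text \<open>Approximation by the nearest among the first \<open>i\<close> points of a countable dense set containing \<open>z\<close>.\<close>

lemma separably_measurable_obtain_simple:
  fixes f :: "'a \<Rightarrow> 'b::metric_space" and z :: 'b
  assumes "separably_measurable M f"
  obtains s where "\<And>i::nat. simple_function M (s i)" "AE x in M. (\<lambda>i. s i x) \<longlonglongrightarrow> f x"
    "\<And>i x. dist (s i x) z \<le> 2 * dist (f x) z"
proof -
  obtain Q where f[measurable]: "f \<in> borel_measurable M" and Q: "countable Q" "AE x in M. f x \<in> closure Q"
    using assms by (auto simp: separably_measurable_def)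
  define c where "c = from_nat_into (insert z Q)"
  have c: "range c = insert z Q"
    using Q by (simp add: c_def)
  define s where "s i x = rec_nat z (\<lambda>j y. if dist (f x) (c j) < dist (f x) y then c j else y) i" for i x
  have s0: "s 0 x = z" and sS: "s (Suc i) x = (if dist (f x) (c i) < dist (f x) (s i x) then c i else s i x)" for i x
    by (simp_all add: s_def)
  have dS: "dist (f x) (s (Suc i) x) = min (dist (f x) (c i)) (dist (f x) (s i x))" for i x
    by (simp add: sS min_def)
  have [measurable]: "(\<lambda>x. dist (f x) y) \<in> borel_measurable M" for y
    by (rule measurable_compose[OF f]) (intro borel_measurable_continuous_onI continuous_intros)
  have dm[measurable]: "(\<lambda>x. dist (f x) (s i x)) \<in> borel_measurable M" for i
  proof (induction i)
    case 0 then show ?case by (simp add: s0)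
  next
    case (Suc i)
    then have [measurable]: "(\<lambda>x. dist (f x) (s i x)) \<in> borel_measurable M" .
    show ?case unfolding dS by measurable
  qed
  have simple: "simple_function M (s i)" for i
  proof (induction i)
    case 0 then show ?case by (simp add: s0)
  next
    case (Suc i)
    show ?case unfolding sS
      by (rule simple_function_If[OF _ Suc]) (auto, measurable)
  qed
  have mono: "dist (f x) (s (j + i) x) \<le> dist (f x) (s i x)" for i j x
    by (induction j) (auto simp: dS min_le_iff_disj)
  have le_c: "dist (f x) (s (Suc j + i) x) \<le> dist (f x) (c i)" for i j x
    using mono[of x j "Suc i"] by (simp add: dS)
  have "AE x in M. (\<lambda>i. s i x) \<longlonglongrightarrow> f x"
    using Q(2)
  proof eventually_elim
    case (elim x)
    show ?case
    proof (rule metric_LIMSEQ_I)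
      fix r :: real assume "0 < r"
      with elim obtain q where "q \<in> Q" "dist q (f x) < r"
        by (metis closure_approachable)
      then obtain i where i: "c i = q" using c by (metis UNIV_I image_iff insertI2)
      show "\<exists>no. \<forall>n\<ge>no. dist (s n x) (f x) < r"
      proof (intro exI allI impI)
        fix n assume "Suc i \<le> n"
        then obtain j where "n = Suc j + i" by (metis add.commute add_Suc_shift le_Suc_ex)
        with le_c[of x j i] i \<open>dist q (f x) < r\<close> show "dist (s n x) (f x) < r"
          by (simp add: dist_commute)
      qed
    qed
  qed
  moreover have "dist (s i x) z \<le> 2 * dist (f x) z" for i x
    using mono[of x i 0] dist_triangle[of "s i x" z "f x"] by (simp add: s0 dist_commute)
  ultimately show ?thesis using that simple by blast
qed

text \<open>Links the measurability assumed of \<open>f\<close> and \<open>g\<close> with the form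
  used below, from which approximants dominated by the function itself can be extracted.\<close>

lemma separably_measurable_iff_strongly_measurable:
  fixes f :: "'a \<Rightarrow> 'b::metric_space"
  assumes "complete_measure M"
  shows "separably_measurable M f \<longleftrightarrow> strongly_measurable M f"
proof
  assume f: "separably_measurable M f"
  obtain s where "\<And>i::nat. simple_function M (s i)" "AE x in M. (\<lambda>i. s i x) \<longlonglongrightarrow> f x"
    by (rule separably_measurable_obtain_simple[OF f, of undefined]) metis
  then show "strongly_measurable M f"
    by (auto simp: strongly_measurable_def)
next
  assume "strongly_measurable M f"
  then show "separably_measurable M f"
    unfolding strongly_measurable_def
    using separably_measurable_AE_LIMSEQ[OF assms] separably_measurable_simple_function by metis
qed

text \<open>The Borel sets of a nonseparable product can exceed the product of the Borel sets, so
  the pair is approximated by simple functions instead of being composed with \<open>h\<close>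
  directly.\<close>

lemma separably_measurable_compose2:
  fixes f :: "'a \<Rightarrow> 'b::metric_space" and g :: "'a \<Rightarrow> 'c::metric_space" and h :: "'b \<Rightarrow> 'c \<Rightarrow> 'd::metric_space"
  assumes M: "complete_measure M" and f: "separably_measurable M f" and g: "separably_measurable M g"
    and h: "continuous_on UNIV (\<lambda>p. h (fst p) (snd p))"
  shows "separably_measurable M (\<lambda>x. h (f x) (g x))"
proof -
  obtain s where s: "\<And>i::nat. simple_function M (s i)" "AE x in M. (\<lambda>i. s i x) \<longlonglongrightarrow> f x"
    by (rule separably_measurable_obtain_simple[OF f, of undefined]) metis
  obtain u where u: "\<And>i::nat. simple_function M (u i)" "AE x in M. (\<lambda>i. u i x) \<longlonglongrightarrow> g x"
    by (rule separably_measurable_obtain_simple[OF g, of undefined]) metis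
  show ?thesis
  proof (rule separably_measurable_AE_LIMSEQ[OF M, of "\<lambda>i x. h (s i x) (u i x)"])
    show "separably_measurable M (\<lambda>x. h (s i x) (u i x))" for i
      by (rule separably_measurable_simple_function) (rule simple_function_compose2[OF s(1) u(1)])
    show "AE x in M. (\<lambda>i. h (s i x) (u i x)) \<longlonglongrightarrow> h (f x) (g x)"
      using s(2) u(2)
    proof eventually_elim
      case (elim x)
      have "(\<lambda>i. (s i x, u i x)) \<longlonglongrightarrow> (f x, g x)"
        by (intro tendsto_Pair elim)
      with h have "((\<lambda>p. h (fst p) (snd p)) \<circ> (\<lambda>i. (s i x, u i x))) \<longlonglongrightarrow> h (fst (f x, g x)) (snd (f x, g x))"
        unfolding continuous_on_sequentially by blast
      then show ?case by (simp add: comp_def)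
    qed
  qed
qed

lemma separably_measurable_const [simp]: "separably_measurable M (\<lambda>x. c)"
  by (rule separably_measurable_simple_function) simp

lemma separably_measurable_second_countable:
  fixes f :: "'a \<Rightarrow> 'b::{metric_space, second_countable_topology}"
  shows "separably_measurable M f \<longleftrightarrow> f \<in> borel_measurable M"
proof -
  obtain D :: "'b set" where "countable D" "\<And>X. open X \<Longrightarrow> X \<noteq> {} \<Longrightarrow> \<exists>d\<in>D. d \<in> X"
    by (erule countable_dense_setE)
  then have "countable D" "closure D = UNIV"
    by (auto simp: closure_iff_nhds_not_empty) blast
  then show ?thesis unfolding separably_measurable_def by (metis AE_I2 UNIV_I)
qed

lemma separably_measurable_compose:
  fixes f :: "'a \<Rightarrow> 'b::metric_space" and h :: "'b \<Rightarrow> 'd::metric_space"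
  assumes "complete_measure M" "separably_measurable M f" "continuous_on UNIV h"
  shows "separably_measurable M (\<lambda>x. h (f x))"
proof (rule separably_measurable_compose2[OF assms(1,2,2), of "\<lambda>x _. h x"])
  show "continuous_on UNIV (\<lambda>p. h (fst p))"
    by (rule continuous_on_compose2[OF assms(3) continuous_on_fst[OF continuous_on_id]]) simp
qed

text \<open>With one map simple, the distance is glued from finitely many distances to fixed points;
  this avoids measurability of the pair.\<close>

lemma borel_measurable_dist_simple_function:
  fixes f s :: "'a \<Rightarrow> 'b::metric_space"
  assumes f: "f \<in> borel_measurable M" and s: "simple_function M s"
  shows "(\<lambda>x. dist (f x) (s x)) \<in> borel_measurable M"
proof (rule measurable_compose_countable'[of "s ` space M" "\<lambda>y x. dist (f x) y" M borel s])
  show "(\<lambda>x. dist (f x) y) \<in> borel_measurable M" for y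
    by (rule measurable_compose[OF f]) (intro borel_measurable_continuous_onI continuous_intros)
  show "s \<in> measurable M (count_space (s ` space M))"
    using s by (auto simp: measurable_count_space_eq2 simple_function_def)
  show "countable (s ` space M)"
    using s by (simp add: simple_function_def countable_finite)
qed

text \<open>The functional \<open>\<lambda>y. y \<bullet> e\<close> maps the approximating simple
  functions to admissible ones for the scalar integral, with the error multiplied by at most
  \<open>norm e\<close>.\<close>

lemma has_bochner_integral_gen_inner:
  fixes f :: "'a \<Rightarrow> 'b::real_inner"
  assumes "has_bochner_integral_gen M f x"
  shows "has_bochner_integral M (\<lambda>w. f w \<bullet> e) (x \<bullet> e)"
proof -
  obtain s where f[measurable]: "f \<in> borel_measurable M" and s: "\<And>i::nat. Bochner_Integration.simple_bochner_integrable M (s i)"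
    and lim: "(\<lambda>i. \<integral>\<^sup>+x. ennreal (norm (f x - s i x)) \<partial>M) \<longlonglongrightarrow> 0"
    and I: "(\<lambda>i. Bochner_Integration.simple_bochner_integral M (s i)) \<longlonglongrightarrow> x"
    using assms by (auto simp: has_bochner_integral_gen_def)
  let ?T = "\<lambda>y. y \<bullet> e"
  interpret T: bounded_linear ?T by (rule bounded_linear_inner_left)
  show ?thesis
  proof (rule has_bochner_integral.intros)
    show "(\<lambda>w. f w \<bullet> e) \<in> borel_measurable M"
      by (rule measurable_compose[OF f]) (intro borel_measurable_continuous_onI continuous_intros)
    show "Bochner_Integration.simple_bochner_integrable M (\<lambda>w. s i w \<bullet> e)" for i
      using simple_bochner_integrable_compose2[of "\<lambda>x y. x \<bullet> e" M "s i" "s i"] s by simp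
    show "(\<lambda>i. Bochner_Integration.simple_bochner_integral M (\<lambda>w. s i w \<bullet> e)) \<longlonglongrightarrow> x \<bullet> e"
      using T.tendsto[OF I] by (simp add: simple_bochner_integral_linear[OF T.linear_axioms s])
    show "(\<lambda>i. \<integral>\<^sup>+ w. ennreal (norm (f w \<bullet> e - s i w \<bullet> e)) \<partial>M) \<longlonglongrightarrow> 0"
    proof (rule tendsto_sandwich[OF _ _ tendsto_const])
      show "\<forall>\<^sub>F i in sequentially. (\<integral>\<^sup>+ w. ennreal (norm (f w \<bullet> e - s i w \<bullet> e)) \<partial>M)
          \<le> norm e * (\<integral>\<^sup>+x. ennreal (norm (f x - s i x)) \<partial>M)"
      proof (intro always_eventually allI)
        fix i
        have [measurable]: "(\<lambda>x. norm (f x - s i x)) \<in> borel_measurable M"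
          using s borel_measurable_dist_simple_function[OF f, of "s i"]
          by (auto simp: dist_norm simple_bochner_integrable.simps)
        have "(\<integral>\<^sup>+ w. ennreal (norm (f w \<bullet> e - s i w \<bullet> e)) \<partial>M) \<le> (\<integral>\<^sup>+ w. ennreal (norm e) * ennreal (norm (f w - s i w)) \<partial>M)"
          by (intro nn_integral_mono)
             (metis Cauchy_Schwarz_ineq2 ennreal_leI ennreal_mult inner_diff_left mult.commute norm_ge_zero real_norm_def)
        also have "\<dots> = norm e * (\<integral>\<^sup>+x. ennreal (norm (f x - s i x)) \<partial>M)"
          by (rule nn_integral_cmult) measurable
        finally show "(\<integral>\<^sup>+ w. ennreal (norm (f w \<bullet> e - s i w \<bullet> e)) \<partial>M)
          \<le> norm e * (\<integral>\<^sup>+x. ennreal (norm (f x - s i x)) \<partial>M)" .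
      qed
      show "(\<lambda>i. norm e * (\<integral>\<^sup>+x. ennreal (norm (f x - s i x)) \<partial>M)) \<longlonglongrightarrow> 0"
        using ennreal_tendsto_cmult[OF _ lim, of "norm e"] by simp
    qed auto
  qed
qed

lemma bochner_integral_inner:
  fixes f :: "'a \<Rightarrow> 'b::real_inner"
  assumes "bochner_integrable M f"
  shows "integrable M (\<lambda>w. f w \<bullet> e)" "bochner_integral M f \<bullet> e = (\<integral>w. f w \<bullet> e \<partial>M)"
proof -
  obtain I where I: "has_bochner_integral_gen M f I"
    using assms by (auto simp: bochner_integrable_def)
  \<comment> \<open>Inner products separate points, so the value is unique and the definite
    description in \<open>bochner_integral\<close> denotes it.\<close>
  have J: "J = I" if "has_bochner_integral_gen M f J" for J
  proof -
    have "J \<bullet> e = I \<bullet> e" for e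
      using has_bochner_integral_gen_inner[OF I] has_bochner_integral_gen_inner[OF that] has_bochner_integral_eq by blast
    then show ?thesis by (metis inner_commute vector_eq_rdot)
  qed
  have "(THE I. has_bochner_integral_gen M f I) = I"
    using I J by (rule the_equality)
  with assms have "bochner_integral M f = I"
    by (simp only: bochner_integral_def if_True)
  then show "integrable M (\<lambda>w. f w \<bullet> e)" "bochner_integral M f \<bullet> e = (\<integral>w. f w \<bullet> e \<partial>M)"
    using has_bochner_integral_gen_inner[OF I, of e] by (auto simp: has_bochner_integral_iff)
qed

text \<open>Testing the integral with itself bounds its squared norm by its norm times the integral
  of \<open>w\<close>.\<close>

lemma bochner_integral_norm_bound:
  fixes f :: "'a \<Rightarrow> 'b::real_inner"
  assumes f: "bochner_integrable M f" and w: "integrable M w" and le: "AE x in M. norm (f x) \<le> w x"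
  shows "norm (bochner_integral M f) \<le> (\<integral>x. w x \<partial>M)"
proof -
  let ?I = "bochner_integral M f"
  have "norm ?I * norm ?I = (\<integral>x. f x \<bullet> ?I \<partial>M)"
    using bochner_integral_inner(2)[OF f, of ?I] by (simp add: power2_norm_eq_inner flip: power2_eq_square)
  also have "\<dots> \<le> (\<integral>x. w x * norm ?I \<partial>M)"
  proof (rule integral_mono_AE)
    show "AE x in M. f x \<bullet> ?I \<le> w x * norm ?I"
      using le
    proof eventually_elim
      case (elim x)
      then show ?case
        using norm_cauchy_schwarz[of "f x" ?I] mult_right_mono[OF elim, of "norm ?I"] by simp
    qed
  qed (use bochner_integral_inner(1)[OF f] w in auto)
  also have "\<dots> = (\<integral>x. w x \<partial>M) * norm ?I"
    by simp
  finally have *: "norm ?I * norm ?I \<le> (\<integral>x. w x \<partial>M) * norm ?I" .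
  have "0 \<le> (\<integral>x. w x \<partial>M)"
  proof (rule integral_nonneg_AE)
    show "AE x in M. 0 \<le> w x" using le by eventually_elim (use norm_ge_zero order_trans in blast)
  qed
  with * show ?thesis
    by (cases "?I = 0") auto
qed

text \<open>The approximants satisfy \<open>norm (s i x) \<le> 2 * norm (f x)\<close>, so they
  converge in mean by domination; their integrals are then Cauchy, and completeness of the space
  supplies the value.\<close>

lemma bochner_integrableI_bounded:
  fixes f :: "'a \<Rightarrow> 'b::banach"
  assumes M: "complete_measure M" and f: "separably_measurable M f"
    and fin: "(\<integral>\<^sup>+x. ennreal (norm (f x)) \<partial>M) < \<infinity>"
  shows "bochner_integrable M f"
proof -
  obtain s where s: "\<And>i::nat. simple_function M (s i)" "AE x in M. (\<lambda>i. s i x) \<longlonglongrightarrow> f x"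
    and bnd: "\<And>i x. norm (s i x) \<le> 2 * norm (f x)"
    using separably_measurable_obtain_simple[OF f, of 0] unfolding dist_0_norm dist_commute[of _ 0] by blast
  have fm[measurable]: "f \<in> borel_measurable M"
    using f by (simp add: separably_measurable_def)
  have dm[measurable]: "(\<lambda>x. norm (f x - s i x)) \<in> borel_measurable M" for i
    using borel_measurable_dist_simple_function[OF fm s(1)] by (simp add: dist_norm)
  have nm[measurable]: "(\<lambda>x. norm (f x)) \<in> borel_measurable M"
    by (rule measurable_compose[OF fm]) (intro borel_measurable_continuous_onI continuous_intros)
  have si: "Bochner_Integration.simple_bochner_integrable M (s i)" for i
  proof (rule simple_bochner_integrableI_bounded[OF s(1)])
    have "(\<integral>\<^sup>+x. ennreal (norm (s i x)) \<partial>M) \<le> (\<integral>\<^sup>+x. 2 * ennreal (norm (f x)) \<partial>M)"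
      using bnd[of i] by (intro nn_integral_mono) (metis ennreal_leI ennreal_mult ennreal_numeral norm_ge_zero zero_le_numeral)
    also have "\<dots> = 2 * (\<integral>\<^sup>+x. ennreal (norm (f x)) \<partial>M)"
      by (rule nn_integral_cmult) measurable
    also have "\<dots> < \<infinity>"
      using fin by (simp add: ennreal_mult_less_top)
    finally show "(\<integral>\<^sup>+x. ennreal (norm (s i x)) \<partial>M) < \<infinity>" .
  qed
  have lim: "(\<lambda>i. \<integral>\<^sup>+x. ennreal (norm (f x - s i x)) \<partial>M) \<longlonglongrightarrow> 0"
  proof -
    \<comment> \<open>Dominated convergence is applied to the scalar errors
      \<open>norm (f x - s i x)\<close> with limit 0, so the value space may be
      nonseparable.\<close>
    have "(\<lambda>i. \<integral>\<^sup>+x. ennreal (norm (0 - norm (f x - s i x))) \<partial>M) \<longlonglongrightarrow> 0"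
    proof (rule nn_integral_dominated_convergence_norm[where w="\<lambda>x. 3 * norm (f x)"])
      show "AE x in M. norm (norm (f x - s j x)) \<le> 3 * norm (f x)" for j
      proof (rule AE_I2)
        fix x
        show "norm (norm (f x - s j x)) \<le> 3 * norm (f x)"
          using norm_triangle_ineq4[of "f x" "s j x"] bnd[of j x] by simp
      qed
      have "(\<integral>\<^sup>+x. ennreal (3 * norm (f x)) \<partial>M) = 3 * (\<integral>\<^sup>+x. ennreal (norm (f x)) \<partial>M)"
        by (subst nn_integral_cmult[symmetric]) (auto simp: ennreal_mult)
      then show "(\<integral>\<^sup>+x. ennreal (3 * norm (f x)) \<partial>M) < \<infinity>"
        using fin by (simp add: ennreal_mult_less_top)
      show "AE x in M. (\<lambda>i. norm (f x - s i x)) \<longlonglongrightarrow> 0"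
        using s(2)
      proof eventually_elim
        case (elim x)
        then have "(\<lambda>i. f x - s i x) \<longlonglongrightarrow> f x - f x" by (intro tendsto_intros)
        then show ?case by (simp add: tendsto_norm_zero)
      qed
    qed auto
    then show ?thesis by simp
  qed
  let ?S = "\<lambda>i. Bochner_Integration.simple_bochner_integral M (s i)"
  have diff: "ennreal (norm (?S i - ?S j)) \<le> (\<integral>\<^sup>+x. ennreal (norm (f x - s i x)) \<partial>M) + (\<integral>\<^sup>+x. ennreal (norm (f x - s j x)) \<partial>M)" for i j
  proof -
    have "norm (?S i - ?S j) = norm (Bochner_Integration.simple_bochner_integral M (\<lambda>x. s i x - s j x))"
      by (simp add: simple_bochner_integral_diff si)
    also have "\<dots> \<le> Bochner_Integration.simple_bochner_integral M (\<lambda>x. norm (s i x - s j x))"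
      using simple_bochner_integrable_compose2[of "(-)" M "s i" "s j"] si
      by (intro simple_bochner_integral_norm_bound) simp
    finally have "ennreal (norm (?S i - ?S j)) \<le> ennreal (Bochner_Integration.simple_bochner_integral M (\<lambda>x. norm (s i x - s j x)))"
      by (rule ennreal_leI)
    also have "\<dots> = (\<integral>\<^sup>+x. ennreal (norm (s i x - s j x)) \<partial>M)"
      using simple_bochner_integrable_compose2[of "\<lambda>x y. norm (x - y)" M "s i" "s j"] si
      by (intro simple_bochner_integral_eq_nn_integral) auto
    also have "\<dots> \<le> (\<integral>\<^sup>+x. ennreal (norm (f x - s i x)) + ennreal (norm (f x - s j x)) \<partial>M)"
    proof (rule nn_integral_mono)
      fix x
      have "norm (s i x - s j x) \<le> norm (f x - s i x) + norm (f x - s j x)"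
        by (metis dual_order.refl norm_diff_triangle_le norm_minus_commute)
      then show "ennreal (norm (s i x - s j x)) \<le> ennreal (norm (f x - s i x)) + ennreal (norm (f x - s j x))"
        by (metis ennreal_leI ennreal_plus norm_ge_zero)
    qed
    also have "\<dots> = (\<integral>\<^sup>+x. ennreal (norm (f x - s i x)) \<partial>M) + (\<integral>\<^sup>+x. ennreal (norm (f x - s j x)) \<partial>M)"
      by (rule nn_integral_add) auto
    finally show ?thesis .
  qed
  have "Cauchy ?S"
  proof (rule metric_CauchyI)
    fix e :: real assume "0 < e"
    then have "\<forall>\<^sub>F i in sequentially. (\<integral>\<^sup>+x. ennreal (norm (f x - s i x)) \<partial>M) < ennreal (e/2)"
      by (intro order_tendstoD(2)[OF lim]) simp
    then obtain N where N: "\<And>i. N \<le> i \<Longrightarrow> (\<integral>\<^sup>+x. ennreal (norm (f x - s i x)) \<partial>M) < ennreal (e/2)"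
      by (auto simp: eventually_sequentially)
    show "\<exists>N. \<forall>m\<ge>N. \<forall>n\<ge>N. dist (?S m) (?S n) < e"
    proof (intro exI allI impI)
      fix m n assume "N \<le> m" "N \<le> n"
      have "ennreal (norm (?S m - ?S n)) < ennreal (e/2) + ennreal (e/2)"
        using diff[of m n] add_strict_mono[OF N[OF \<open>N \<le> m\<close>] N[OF \<open>N \<le> n\<close>]] by (rule le_less_trans)
      also have "\<dots> = ennreal e"
        using \<open>0 < e\<close> by (simp flip: ennreal_plus)
      finally show "dist (?S m) (?S n) < e"
        using \<open>0 < e\<close> by (simp add: dist_norm ennreal_less_iff)
    qed
  qed
  then obtain I where "?S \<longlonglongrightarrow> I"
    using Cauchy_convergent_iff convergent_def by blast
  then have "has_bochner_integral_gen M f I"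
    unfolding has_bochner_integral_gen_def using fm si lim by blast
  then show ?thesis
    by (auto simp: bochner_integrable_def)
qed

section \<open>Lebesgue differentiation\<close>

text \<open>The intervals violating the \<epsilon>-estimate form a Vitali cover of the exceptional
  set. A finite disjoint selection of them is a fine partial division, so Henstock's lemma makes
  their total length small.\<close>

lemma negligible_henstock_exceptional_set:
  fixes w :: "real \<Rightarrow> real"
  assumes w: "w integrable_on {a..b}" and \<open>0 < \<epsilon>\<close>
  shows "negligible {t. \<forall>d>0. \<exists>u v. a \<le> u \<and> u \<le> t \<and> t \<le> v \<and> v \<le> b \<and> v - u < d \<and>
           \<epsilon> * (v - u) < \<bar>integral {u..v} w - (v - u) * w t\<bar>}" (is "negligible ?E")
  unfolding negligible_outer_le
proof (intro allI impI)
  fix \<eta> :: real assume "0 < \<eta>"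
  define Q where "Q t u v \<longleftrightarrow> a \<le> u \<and> u \<le> t \<and> t \<le> v \<and> v \<le> b \<and> \<epsilon> * (v - u) < \<bar>integral {u..v} w - (v - u) * w t\<bar>" for t u v
  have wc: "w integrable_on cbox a b" using w by simp
  \<comment> \<open>On the selected intervals the Henstock sum is at least \<epsilon> times the
    total length, so this bound yields total length at most \<eta>.\<close>
  have "0 < \<eta> * \<epsilon>" using \<open>0 < \<eta>\<close> \<open>0 < \<epsilon>\<close> by simp
  from Henstock_lemma[OF wc this] obtain \<gamma> where \<gamma>: "gauge \<gamma>"
    and hen: "\<And>p. \<lbrakk>p tagged_partial_division_of (cbox a b); \<gamma> fine p\<rbrakk> \<Longrightarrow>
             sum (\<lambda>(x,k). norm (measure lborel k *\<^sub>R w x - integral k w)) p < \<eta> * \<epsilon>"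
    by (metis (no_types))
  \<comment> \<open>Each interval \<open>{u..v}\<close> with tag \<open>t\<close> is recast as the
    closed ball with centre \<open>m\<close> and radius \<open>r\<close>, the shape needed for the
    covering theorem.\<close>
  define K where "K = {(t, u, v). Q t u v \<and> {u..v} \<subseteq> \<gamma> t}"
  define m where "m = (\<lambda>(t::real, u, v). (u + v) / 2 :: real)"
  define r where "r = (\<lambda>(t::real, u, v). (v - u) / 2 :: real)"
  \<comment> \<open>A degenerate interval cannot violate the estimate, because both sides vanish; so
    all radii are positive.\<close>
  have pos: "u < v" if "Q t u v" for t u v
  proof (rule ccontr)
    assume "\<not> u < v"
    with that have "u = v" by (simp add: Q_def)
    with that show False by (simp add: Q_def)
  qed
  have cb: "cball (m (t, u, v)) (r (t, u, v)) = {u..v}" if "u \<le> v" for t u v :: real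
    using that by (auto simp: m_def r_def dist_real_def abs_if field_simps split: if_splits)
  obtain D where D: "countable D" "D \<subseteq> K"
    and disj: "pairwise (\<lambda>i j. disjnt (cball (m i) (r i)) (cball (m j) (r j))) D"
    and neg: "negligible (?E - (\<Union>i\<in>D. cball (m i) (r i)))"
  proof (rule Vitali_covering_theorem_cballs[of K r ?E m])
    show "0 < r i" if "i \<in> K" for i
      using that pos by (auto simp: K_def r_def)
    show "\<exists>i. i \<in> K \<and> x \<in> cball (m i) (r i) \<and> r i < d" if x: "x \<in> ?E" and "0 < d" for x d
    proof -
      obtain d' where d': "0 < d'" "ball x d' \<subseteq> \<gamma> x"
        using \<gamma> by (metis gauge_def openE)
      obtain u v where uv: "Q x u v" "v - u < min d d'"
        using x \<open>0 < d\<close> \<open>0 < d'\<close> by (auto simp: Q_def dest!: spec[of _ "min d d'"])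
      then have "u \<le> x" "x \<le> v" by (auto simp: Q_def)
      with uv have "{u..v} \<subseteq> ball x d'"
        by (auto simp: dist_real_def abs_if)
      with uv d' have "(x, u, v) \<in> K" by (auto simp: K_def)
      moreover have "x \<in> cball (m (x, u, v)) (r (x, u, v))"
        using cb[of u v x] \<open>u \<le> x\<close> \<open>x \<le> v\<close> by auto
      moreover have "r (x, u, v) < d"
        using uv pos[OF uv(1)] by (auto simp: r_def)
      ultimately show ?thesis by blast
    qed
  qed blast
  let ?B = "\<lambda>i. cball (m i) (r i)"
  \<comment> \<open>Henstock's lemma concerns finite divisions; a bound uniform over finite
    subfamilies passes to the countable union.\<close>
  have bound: "measure lebesgue (\<Union>i\<in>F. ?B i) \<le> \<eta>" if F: "F \<subseteq> D" "finite F" for F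
  proof -
    define p where "p = (\<lambda>(t, u, v). (t, {u..v})) ` F"
    have FK: "Q t u v" "{u..v} \<subseteq> \<gamma> t" "u < v" if "(t, u, v) \<in> F" for t u v
      using that F D pos by (auto simp: K_def)
    have dj: "{u..v} \<inter> {u'..v'} = {}" if "(t, u, v) \<in> F" "(t', u', v') \<in> F" "(t, u, v) \<noteq> (t', u', v')" for t u v t' u' v'
      using pairwiseD[OF disj, of "(t,u,v)" "(t',u',v')"] that F FK(3)[OF that(1)] FK(3)[OF that(2)] cb[of u v t] cb[of u' v' t']
      by (auto simp: disjnt_def)
    have "p tagged_partial_division_of cbox a b"
      unfolding tagged_partial_division_of_def
    proof (intro conjI allI impI)
      show "finite p" using F by (simp add: p_def)
      show "x \<in> k" if "(x, k) \<in> p" for x k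
        using that FK(1) by (fastforce simp: p_def Q_def)
      show "k \<subseteq> cbox a b" if "(x, k) \<in> p" for x k
        using that FK(1) by (fastforce simp: p_def Q_def)
      show "\<exists>a b. k = cbox a b" if "(x, k) \<in> p" for x k
        using that by (auto simp: p_def)
      show "interior k1 \<inter> interior k2 = {}" if pq: "(x1, k1) \<in> p \<and> (x2, k2) \<in> p \<and> (x1, k1) \<noteq> (x2, k2)" for x1 k1 x2 k2
      proof -
        obtain u1 v1 u2 v2 where 1: "(x1, u1, v1) \<in> F" "k1 = {u1..v1}" "(x2, u2, v2) \<in> F" "k2 = {u2..v2}"
          using pq by (auto simp: p_def)
        with pq have "(x1, u1, v1) \<noteq> (x2, u2, v2)" by auto
        with 1 dj have "k1 \<inter> k2 = {}" by blast
        then show ?thesis using interior_subset[of k1] interior_subset[of k2] by blast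
      qed
    qed
    moreover have "\<gamma> fine p"
      using FK(2) by (auto simp: fine_def p_def)
    ultimately have less: "sum (\<lambda>(x,k). norm (measure lborel k *\<^sub>R w x - integral k w)) p < \<eta> * \<epsilon>"
      by (rule hen)
    have inj: "inj_on (\<lambda>(t, u, v). (t, {u..v})) F"
      using FK(3) by (force simp: inj_on_def Icc_eq_Icc)
    have "measure lebesgue (\<Union>i\<in>F. ?B i) \<le> (\<Sum>i\<in>F. measure lebesgue (?B i))"
      using F by (intro measure_UNION_le) auto
    also have "\<dots> = (\<Sum>(t,u,v)\<in>F. v - u)"
    proof (rule sum.cong[OF refl])
      fix i assume "i \<in> F"
      then show "measure lebesgue (?B i) = (case i of (t, u, v) \<Rightarrow> v - u)"
        using cb FK(3) by (cases i) (auto simp: less_imp_le)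
    qed
    finally have "\<epsilon> * measure lebesgue (\<Union>i\<in>F. ?B i) \<le> \<epsilon> * (\<Sum>(t,u,v)\<in>F. v - u)"
      using \<open>0 < \<epsilon>\<close> by (intro mult_left_mono) auto
    also have "\<dots> \<le> (\<Sum>(t,u,v)\<in>F. norm (measure lborel {u..v} *\<^sub>R w t - integral {u..v} w))"
      unfolding sum_distrib_left
    proof (rule sum_mono)
      fix i assume "i \<in> F"
      then show "\<epsilon> * (case i of (t, u, v) \<Rightarrow> v - u) \<le> (case i of (t, u, v) \<Rightarrow> norm (measure lborel {u..v} *\<^sub>R w t - integral {u..v} w))"
        using FK(1) FK(3) by (cases i) (auto simp: Q_def less_imp_le abs_minus_commute)
    qed
    also have "\<dots> = sum (\<lambda>(x,k). norm (measure lborel k *\<^sub>R w x - integral k w)) p"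
      unfolding p_def by (subst sum.reindex[OF inj]) (simp add: case_prod_unfold comp_def)
    also note less
    finally have "\<epsilon> * measure lebesgue (\<Union>i\<in>F. ?B i) < \<epsilon> * \<eta>"
      by (simp only: mult.commute[of \<eta>])
    then have "measure lebesgue (\<Union>i\<in>F. ?B i) < \<eta>"
      using \<open>0 < \<epsilon>\<close> by (simp only: mult_less_cancel_left_pos)
    then show ?thesis by simp
  qed
  have U: "(\<Union>i\<in>D. ?B i) \<in> lmeasurable" "measure lebesgue (\<Union>i\<in>D. ?B i) \<le> \<eta>"
    using fmeasurable_UN_bound[of D ?B lebesgue \<eta>] measure_UN_bound[of D ?B lebesgue \<eta>] D(1) bound by auto
  let ?N = "?E - (\<Union>i\<in>D. ?B i)"
  show "\<exists>T. ?E \<subseteq> T \<and> T \<in> lmeasurable \<and> measure lebesgue T \<le> \<eta>"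
  proof (intro exI conjI)
    show "?E \<subseteq> (\<Union>i\<in>D. ?B i) \<union> ?N" by auto
    have N: "?N \<in> lmeasurable" "measure lebesgue ?N = 0"
      using neg negligible_imp_measurable negligible_imp_measure0 by blast+
    show "(\<Union>i\<in>D. ?B i) \<union> ?N \<in> lmeasurable"
      using U N by (intro fmeasurable.Un)
    show "measure lebesgue ((\<Union>i\<in>D. ?B i) \<union> ?N) \<le> \<eta>"
      using measure_Un_le[of "\<Union>i\<in>D. ?B i" lebesgue ?N] U N by (simp add: fmeasurableD)
  qed
qed

text \<open>Only \<epsilon> = 1 / (n + 1) has to be excluded, which keeps the exceptional set a
  countable union. The intervals merely contain \<open>t\<close>, so one statement serves both
  one-sided quotients.\<close>

theorem lebesgue_differentiation_real:
  fixes w :: "real \<Rightarrow> real"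
  assumes w: "w integrable_on {a..b}"
  obtains N where "negligible N"
    "\<And>t \<epsilon>. \<lbrakk>t \<notin> N; 0 < \<epsilon>\<rbrakk> \<Longrightarrow> \<exists>d>0. \<forall>u v. a \<le> u \<longrightarrow> u \<le> t \<longrightarrow> t \<le> v \<longrightarrow> v \<le> b \<longrightarrow> v - u < d \<longrightarrow>
           \<bar>integral {u..v} w - (v - u) * w t\<bar> \<le> \<epsilon> * (v - u)"
proof -
  define E where "E \<epsilon> = {t. \<forall>d>0. \<exists>u v. a \<le> u \<and> u \<le> t \<and> t \<le> v \<and> v \<le> b \<and> v - u < d \<and>
           \<epsilon> * (v - u) < \<bar>integral {u..v} w - (v - u) * w t\<bar>}" for \<epsilon>
  show ?thesis
  proof
    show "negligible (\<Union>n. E (1 / real (Suc n)))"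
      unfolding E_def by (intro negligible_Union_nat negligible_henstock_exceptional_set w) auto
  next
    fix t \<epsilon> :: real assume t: "t \<notin> (\<Union>n. E (1 / real (Suc n)))" and "0 < \<epsilon>"
    then obtain n where n: "1 / real (Suc n) < \<epsilon>"
      by (metis nat_approx_posE)
    obtain d where d: "0 < d" "\<And>u v. \<lbrakk>a \<le> u; u \<le> t; t \<le> v; v \<le> b; v - u < d\<rbrakk> \<Longrightarrow>
           \<bar>integral {u..v} w - (v - u) * w t\<bar> \<le> 1 / real (Suc n) * (v - u)"
    proof -
      have "t \<notin> E (1 / real (Suc n))" using t by blast
      then show ?thesis using that unfolding E_def mem_Collect_eq by (metis not_less)
    qed
    show "\<exists>d>0. \<forall>u v. a \<le> u \<longrightarrow> u \<le> t \<longrightarrow> t \<le> v \<longrightarrow> v \<le> b \<longrightarrow> v - u < d \<longrightarrow>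
           \<bar>integral {u..v} w - (v - u) * w t\<bar> \<le> \<epsilon> * (v - u)"
    proof (intro exI[of _ d] conjI allI impI)
      fix u v assume uv: "a \<le> u" "u \<le> t" "t \<le> v" "v \<le> b" "v - u < d"
      then have "1 / real (Suc n) * (v - u) \<le> \<epsilon> * (v - u)"
        using n by (intro mult_right_mono) auto
      with d(2)[OF uv] show "\<bar>integral {u..v} w - (v - u) * w t\<bar> \<le> \<epsilon> * (v - u)" by linarith
    qed (rule d)
  qed
qed

section \<open>Almost everywhere statements and integrals on subsets\<close>

lemma AE_lebesgue_on_iff_negligible:
  assumes "S \<in> sets lebesgue"
  shows "(AE x in lebesgue_on S. P x) \<longleftrightarrow> negligible {x\<in>S. \<not> P x}"
  using assms by (simp add: AE_restrict_space_iff negligible_iff_null_sets completion.AE_iff_null_sets)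

lemma AE_lebesgue_on_subset:
  assumes "AE x in lebesgue_on A. P x" "B \<subseteq> A" "A \<in> sets lebesgue" "B \<in> sets lebesgue"
  shows "AE x in lebesgue_on B. P x"
proof -
  have "negligible {x\<in>A. \<not> P x}" using assms by (simp add: AE_lebesgue_on_iff_negligible)
  then have "negligible {x\<in>B. \<not> P x}"
    by (rule negligible_subset) (use assms in auto)
  then show ?thesis using assms by (simp add: AE_lebesgue_on_iff_negligible)
qed

lemma integral_le_AE:
  fixes f g :: "'a::euclidean_space \<Rightarrow> real"
  assumes "f integrable_on S" "g integrable_on S" "S \<in> sets lebesgue"
    and le: "AE x in lebesgue_on S. f x \<le> g x"
  shows "integral S f \<le> integral S g"
proof -
  let ?N = "{x\<in>S. \<not> f x \<le> g x}"
  let ?f = "\<lambda>x. if x \<in> ?N then g x else f x"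
  have N: "negligible ?N" using le assms by (simp add: AE_lebesgue_on_iff_negligible)
  have "integral S f = integral S ?f"
    by (rule integral_spike[OF N]) auto
  also have "\<dots> \<le> integral S g"
    by (rule integral_le[OF integrable_spike[OF assms(1) N] assms(2)]) auto
  finally show ?thesis .
qed

lemma separably_measurable_lebesgue_on_subset:
  assumes f: "separably_measurable (lebesgue_on A) f" and "B \<subseteq> A" "A \<in> sets lebesgue" "B \<in> sets lebesgue"
  shows "separably_measurable (lebesgue_on B) f"
proof -
  obtain Q where "countable Q" "AE x in lebesgue_on A. f x \<in> closure Q" "f \<in> borel_measurable (lebesgue_on A)"
    using f by (auto simp: separably_measurable_def)
  moreover from this have "f \<in> borel_measurable (lebesgue_on B)"
    using measurable_restrict_mono \<open>B \<subseteq> A\<close> by blast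
  moreover have "AE x in lebesgue_on B. f x \<in> closure Q"
    using calculation(2) assms(2-4) by (rule AE_lebesgue_on_subset)
  ultimately show ?thesis by (auto simp: separably_measurable_def)
qed

lemma integrable_lebesgue_on_iff:
  fixes w :: "'a::euclidean_space \<Rightarrow> 'b::euclidean_space"
  assumes "S \<in> sets lebesgue"
  shows "integrable (lebesgue_on S) w \<longleftrightarrow> w absolutely_integrable_on S"
  using assms by (simp add: integrable_restrict_space set_integrable_def)

lemma integrable_lebesgue_on_subset:
  fixes w :: "'a::euclidean_space \<Rightarrow> 'b::euclidean_space"
  assumes "integrable (lebesgue_on A) w" "B \<subseteq> A" "A \<in> sets lebesgue" "B \<in> sets lebesgue"
  shows "integrable (lebesgue_on B) w"
  using assms by (metis integrable_lebesgue_on_iff set_integrable_subset)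

lemma integral_diff_Icc:
  fixes w :: "real \<Rightarrow> real"
  assumes "w integrable_on {a..b}" "a \<le> s" "s \<le> t" "t \<le> b"
  shows "integral {a..t} w - integral {a..s} w = integral {s..t} w"
proof -
  have "w integrable_on {a..t}"
    using integrable_on_subinterval[OF assms(1)] assms by auto
  from Henstock_Kurzweil_Integration.integral_combine[OF assms(2,3) this] show ?thesis by simp
qed

text \<open>Testing with vectors \<open>e\<close> reduces facts about the indefinite Bochner integral to real
  Henstock-Kurzweil integrals.\<close>

locale bochner_dominated =
  fixes T :: real and h :: "real \<Rightarrow> 'a::{real_inner, banach}" and w :: "real \<Rightarrow> real"
  assumes T_pos: "0 < T"
    and h_meas: "separably_measurable (lebesgue_on {0..T}) h"
    and w_int: "integrable (lebesgue_on {0..T}) w"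
    and h_le: "AE t in lebesgue_on {0..T}. norm (h t) \<le> w t"
begin

abbreviation H :: "real \<Rightarrow> 'a" where
  "H t \<equiv> bochner_integral (lebesgue_on {0..t}) h"

lemma h_le_subset:
  assumes "t \<le> T" shows "AE s in lebesgue_on {0..t}. norm (h s) \<le> w s"
  using h_le by (rule AE_lebesgue_on_subset) (use assms in auto)

lemma bochner_integrable:
  assumes "t \<le> T" shows "bochner_integrable (lebesgue_on {0..t}) h"
proof (rule bochner_integrableI_bounded)
  show "complete_measure (lebesgue_on {0..t})"
    by (rule complete_measure_lebesgue_on) simp
  show "separably_measurable (lebesgue_on {0..t}) h"
    using h_meas by (rule separably_measurable_lebesgue_on_subset) (use assms in auto)
  have "integrable (lebesgue_on {0..t}) w"
    using w_int by (rule integrable_lebesgue_on_subset) (use assms in auto)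
  then have "(\<integral>\<^sup>+ s. ennreal (norm (w s)) \<partial>lebesgue_on {0..t}) < \<infinity>"
    by (simp add: integrable_iff_bounded)
  moreover have "(\<integral>\<^sup>+ s. ennreal (norm (h s)) \<partial>lebesgue_on {0..t}) \<le> (\<integral>\<^sup>+ s. ennreal (norm (w s)) \<partial>lebesgue_on {0..t})"
  proof (rule nn_integral_mono_AE)
    show "AE s in lebesgue_on {0..t}. ennreal (norm (h s)) \<le> ennreal (norm (w s))"
      using h_le_subset[OF assms] by eventually_elim (auto intro!: ennreal_leI)
  qed
  ultimately show "(\<integral>\<^sup>+ s. ennreal (norm (h s)) \<partial>lebesgue_on {0..t}) < \<infinity>"
    by (rule order.strict_trans1[rotated])
qed

lemma H_inner:
  assumes "t \<le> T" shows "H t \<bullet> e = integral {0..t} (\<lambda>r. h r \<bullet> e)"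
  using bochner_integral_inner[OF bochner_integrable[OF assms], of e] by (simp add: lebesgue_integral_eq_integral)

lemma inner_integrable:
  "0 \<le> s \<Longrightarrow> t \<le> T \<Longrightarrow> (\<lambda>r. h r \<bullet> e) integrable_on {s..t}"
  using integrable_on_lebesgue_on[OF bochner_integral_inner(1)[OF bochner_integrable[OF order_refl]], of e]
  by (auto intro: integrable_on_subinterval)

lemma w_integrable: "0 \<le> s \<Longrightarrow> t \<le> T \<Longrightarrow> w integrable_on {s..t}"
  using integrable_on_lebesgue_on[OF w_int] by (auto intro: integrable_on_subinterval)

lemma inner_diff:
  assumes "0 \<le> s" "s \<le> t" "t \<le> T"
  shows "(H t - H s) \<bullet> e = integral {s..t} (\<lambda>r. h r \<bullet> e)"
proof -
  show ?thesis
    using assms integral_diff_Icc[OF inner_integrable[of 0 T e], of s t] by (simp add: inner_diff_left H_inner)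
qed

text \<open>The error vector is tested with itself. The vector \<open>c\<close> is
  \<open>h t\<close> when the derivative is computed and 0 when plain growth is wanted.\<close>

lemma norm_diff_sub_le:
  assumes st: "0 \<le> s" "s \<le> t" "t \<le> T" and \<rho>: "\<rho> integrable_on {s..t}"
    and le: "AE r in lebesgue_on {s..t}. norm (h r - c) \<le> \<rho> r"
  shows "norm (H t - H s - (t - s) *\<^sub>R c) \<le> integral {s..t} \<rho>"
proof -
  let ?e = "H t - H s - (t - s) *\<^sub>R c"
  have "AE r in lebesgue_on {s..t}. (h r - c) \<bullet> ?e \<le> \<rho> r * norm ?e"
    using le
  proof eventually_elim
    case (elim r)
    then show ?case
      using norm_cauchy_schwarz[of "h r - c" ?e] mult_right_mono[of "norm (h r - c)" "\<rho> r" "norm ?e"] by auto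
  qed
  moreover have i1: "(\<lambda>r. (h r - c) \<bullet> ?e) integrable_on {s..t}"
    unfolding inner_diff_left using st by (intro integrable_diff inner_integrable) auto
  moreover have i2: "(\<lambda>r. \<rho> r * norm ?e) integrable_on {s..t}"
    using \<rho> by (rule integrable_on_mult_left)
  ultimately have le': "integral {s..t} (\<lambda>r. (h r - c) \<bullet> ?e) \<le> integral {s..t} (\<lambda>r. \<rho> r * norm ?e)"
    by (intro integral_le_AE) auto
  have "norm ?e * norm ?e = ?e \<bullet> ?e"
    by (simp add: power2_norm_eq_inner flip: power2_eq_square)
  also have "\<dots> = (H t - H s) \<bullet> ?e - (t - s) * (c \<bullet> ?e)"
    by (simp add: inner_diff_left)
  also have "\<dots> = integral {s..t} (\<lambda>r. (h r - c) \<bullet> ?e)"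
    using Henstock_Kurzweil_Integration.integral_diff[OF inner_integrable[OF st(1,3)] integrable_const_ivl, of ?e "c \<bullet> ?e"] st(2)
    by (simp only: inner_diff[OF st] inner_diff_left[of _ c]) simp
  also note le'
  also have "integral {s..t} (\<lambda>r. \<rho> r * norm ?e) = integral {s..t} \<rho> * norm ?e"
    by simp
  finally have *: "norm ?e * norm ?e \<le> integral {s..t} \<rho> * norm ?e" .
  have "0 \<le> integral {s..t} \<rho>"
  proof -
    have "integral {s..t} (\<lambda>r. 0) \<le> integral {s..t} \<rho>"
    proof (rule integral_le_AE)
      show "AE r in lebesgue_on {s..t}. 0 \<le> \<rho> r"
        using le by eventually_elim (use norm_ge_zero order_trans in blast)
    qed (use \<rho> in auto)
    then show ?thesis by simp
  qed
  with * show ?thesis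
    by (cases "?e = 0") auto
qed

text \<open>The scalar theorem is applied to \<open>norm (h r - q)\<close> for the countably many
  \<open>q\<close> in a set whose closure contains almost all values of \<open>h\<close>; replacing
  \<open>h t\<close> by a nearby \<open>q\<close> then gives Lebesgue points of the vector
  function.\<close>

theorem AE_has_vector_derivative:
  "AE t in lebesgue_on {0..T}. (H has_vector_derivative h t) (at t within {0..T})"
proof -
  obtain Q where Q: "countable Q" "AE t in lebesgue_on {0..T}. h t \<in> closure Q"
    using h_meas by (auto simp: separably_measurable_def)
  have int: "(\<lambda>r. norm (h r - q)) integrable_on {0..T}" for q
  proof -
    have "separably_measurable (lebesgue_on {0..T}) (\<lambda>r. norm (h r - q))"
      by (rule separably_measurable_compose[OF complete_measure_lebesgue_on h_meas])
         (auto intro!: continuous_intros)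
    then have "(\<lambda>r. norm (h r - q)) \<in> borel_measurable (lebesgue_on {0..T})"
      by (simp add: separably_measurable_def)
    moreover have "AE r in lebesgue_on {0..T}. norm (norm (h r - q)) \<le> norm (w r + norm q)"
      using h_le
    proof eventually_elim
      case (elim r)
      then show ?case using norm_triangle_ineq4[of "h r" q] by simp
    qed
    moreover have "integrable (lebesgue_on {0..T}) (\<lambda>r. w r + norm q)"
      using w_int finite_measure_lebesgue_on[of "{0..T}"]
      by (intro Bochner_Integration.integrable_add) (auto intro: finite_measure.integrable_const)
    ultimately have "integrable (lebesgue_on {0..T}) (\<lambda>r. norm (h r - q))"
      by (metis Bochner_Integration.integrable_bound)
    then show ?thesis by (rule integrable_on_lebesgue_on) simp
  qed
  \<comment> \<open>Every vector \<open>q\<close> has its own null set; only those with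
    \<open>q \<in> Q\<close> are joined below.\<close>
  have "\<forall>q. \<exists>N. negligible N \<and> (\<forall>t \<epsilon>. t \<notin> N \<longrightarrow> 0 < \<epsilon> \<longrightarrow> (\<exists>d>0. \<forall>u v. 0 \<le> u \<longrightarrow> u \<le> t \<longrightarrow> t \<le> v \<longrightarrow> v \<le> T \<longrightarrow> v - u < d \<longrightarrow>
           \<bar>integral {u..v} (\<lambda>r. norm (h r - q)) - (v - u) * norm (h t - q)\<bar> \<le> \<epsilon> * (v - u)))"
    using lebesgue_differentiation_real[OF int] by metis
  then obtain N where N: "\<And>q. negligible (N q)"
    and ld: "\<And>q t \<epsilon>. t \<notin> N q \<Longrightarrow> 0 < \<epsilon> \<Longrightarrow> \<exists>d>0. \<forall>u v. 0 \<le> u \<longrightarrow> u \<le> t \<longrightarrow> t \<le> v \<longrightarrow> v \<le> T \<longrightarrow> v - u < d \<longrightarrow>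
           \<bar>integral {u..v} (\<lambda>r. norm (h r - q)) - (v - u) * norm (h t - q)\<bar> \<le> \<epsilon> * (v - u)"
    by metis
  have "AE t in lebesgue_on {0..T}. \<forall>q\<in>Q. t \<notin> N q"
    unfolding AE_ball_countable[OF Q(1)]
  proof
    fix q
    show "AE t in lebesgue_on {0..T}. t \<notin> N q"
      using negligible_subset[OF N[of q], of "{x \<in> {0..T}. \<not> x \<notin> N q}"] by (subst AE_lebesgue_on_iff_negligible) auto
  qed
  then show ?thesis
    using Q(2) AE_space
  proof eventually_elim
    case (elim t)
    then have t: "0 \<le> t" "t \<le> T" by auto
    have key: "\<exists>d>0. \<forall>u v. 0 \<le> u \<longrightarrow> u \<le> t \<longrightarrow> t \<le> v \<longrightarrow> v \<le> T \<longrightarrow> v - u < d \<longrightarrow>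
           norm (H v - H u - (v - u) *\<^sub>R h t) \<le> e * (v - u)" if "0 < e" for e
    proof -
      \<comment> \<open>The final error is \<open>2 * norm (h t - q)\<close> plus the
        differentiation error, hence three shares of \<open>e / 3\<close>.\<close>
      obtain q where q: "q \<in> Q" "norm (h t - q) < e / 3"
        using elim(2) \<open>0 < e\<close> unfolding closure_approachable dist_norm by (metis divide_pos_pos norm_minus_commute zero_less_numeral)
      obtain d where d: "d > 0" "\<And>u v. 0 \<le> u \<Longrightarrow> u \<le> t \<Longrightarrow> t \<le> v \<Longrightarrow> v \<le> T \<Longrightarrow> v - u < d \<Longrightarrow>
           \<bar>integral {u..v} (\<lambda>r. norm (h r - q)) - (v - u) * norm (h t - q)\<bar> \<le> e/3 * (v - u)"
        using ld[of t q "e/3"] elim(1) q \<open>0 < e\<close> by auto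
      show ?thesis
      proof (intro exI[of _ d] conjI allI impI)
        fix u v assume uv: "0 \<le> u" "u \<le> t" "t \<le> v" "v \<le> T" "v - u < d"
        have i: "(\<lambda>r. norm (h r - q)) integrable_on {u..v}"
          using uv by (intro integrable_on_subinterval[OF int]) auto
        have "norm (H v - H u - (v - u) *\<^sub>R h t) \<le> integral {u..v} (\<lambda>r. norm (h r - q) + norm (h t - q))"
          using uv i norm_triangle_ineq4[of "h _ - q" "h t - q"]
          by (intro norm_diff_sub_le integrable_add AE_I2) auto
        also have "\<dots> = integral {u..v} (\<lambda>r. norm (h r - q)) + (v - u) * norm (h t - q)"
          using uv i by (subst Henstock_Kurzweil_Integration.integral_add) auto
        also have "\<dots> \<le> (2 * norm (h t - q) + e/3) * (v - u)"
        proof -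
          have "integral {u..v} (\<lambda>r. norm (h r - q)) \<le> (v - u) * norm (h t - q) + e/3 * (v - u)"
            using abs_le_D1[OF d(2)[OF uv]] by linarith
          moreover have "(2 * norm (h t - q) + e/3) * (v - u) = 2 * ((v - u) * norm (h t - q)) + e/3 * (v - u)"
            by (simp add: algebra_simps)
          ultimately show ?thesis by linarith
        qed
        also have "\<dots> \<le> e * (v - u)"
          using q uv by (intro mult_right_mono) auto
        finally show "norm (H v - H u - (v - u) *\<^sub>R h t) \<le> e * (v - u)" .
      qed (rule d)
    qed
    show ?case
      unfolding has_vector_derivative_def has_derivative_within_alt
    proof (intro conjI allI impI bounded_linear_scaleR_left)
      fix e :: real assume "0 < e"
      from key[OF this] obtain d where d: "0 < d" "\<And>u v. 0 \<le> u \<Longrightarrow> u \<le> t \<Longrightarrow> t \<le> v \<Longrightarrow> v \<le> T \<Longrightarrow> v - u < d \<Longrightarrow>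
           norm (H v - H u - (v - u) *\<^sub>R h t) \<le> e * (v - u)" by blast
      show "\<exists>d>0. \<forall>y\<in>{0..T}. norm (y - t) < d \<longrightarrow> norm (H y - H t - (y - t) *\<^sub>R h t) \<le> e * norm (y - t)"
      proof (intro exI[of _ d] conjI ballI impI)
        fix y assume y: "y \<in> {0..T}" "norm (y - t) < d"
        show "norm (H y - H t - (y - t) *\<^sub>R h t) \<le> e * norm (y - t)"
        proof (cases "t \<le> y")
          case True then show ?thesis using d(2)[of t y] y t by simp
        next
          case False
          then have "norm (H t - H y - (t - y) *\<^sub>R h t) \<le> e * (t - y)" using d(2)[of y t] y t by simp
          moreover have "H t - H y - (t - y) *\<^sub>R h t = - (H y - H t - (y - t) *\<^sub>R h t)"
            by (simp add: algebra_simps)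
          ultimately show ?thesis using False by (simp only: norm_minus_cancel) simp
        qed
      qed (rule d)
    qed
  qed
qed

end

section \<open>Projections and compactness of paths\<close>

lemma diagonal_convergent_subsequence:
  fixes F :: "nat \<Rightarrow> 'b \<Rightarrow> 'a::topological_space"
  assumes "countable D"
    and sub: "\<And>q s. q \<in> D \<Longrightarrow> strict_mono (s :: nat \<Rightarrow> nat) \<Longrightarrow> \<exists>r. strict_mono (r :: nat \<Rightarrow> nat) \<and> convergent (\<lambda>k. F (s (r k)) q)"
  obtains r :: "nat \<Rightarrow> nat" where "strict_mono r" "\<And>q. q \<in> D \<Longrightarrow> convergent (\<lambda>k. F (r k) q)"
proof (cases "D = {}")
  case True
  then show ?thesis using that[of id] by (auto simp: strict_mono_id)
next
  case False
  define P where "P n s \<longleftrightarrow> convergent (\<lambda>k. F (s k) (from_nat_into D n))" for n and s :: "nat \<Rightarrow> nat"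
  interpret subseqs P
  proof
    fix n and s :: "nat \<Rightarrow> nat" assume "strict_mono s"
    with sub[of "from_nat_into D n" s] False show "\<exists>r'. strict_mono r' \<and> P n (s \<circ> r')"
      by (simp add: P_def from_nat_into)
  qed
  show ?thesis
  proof (rule that[OF subseq_diagseq])
    fix q assume "q \<in> D"
    then obtain n where n: "q = from_nat_into D n"
      using assms(1) by (metis from_nat_into_surj)
    have "P n (diagseq \<circ> ((+) (Suc n)))"
    proof (rule diagseq_holds)
      show "P n (s \<circ> r)" if "strict_mono r" "P n s" for r s n
        using that convergent_subseq_convergent[of "\<lambda>k. F (s k) (from_nat_into D n)" r] by (simp add: P_def comp_def)
    qed
    then have "convergent (\<lambda>k. F (diagseq (k + Suc n)) q)"
      by (simp add: P_def n comp_def add.commute)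
    then show "convergent (\<lambda>k. F (diagseq k) q)"
      by (rule convergent_ignore_initial_segment[THEN iffD1])
  qed
qed

text \<open>An Arzela-Ascoli argument for discontinuous functions: the jumps allowed by
  \<open>a n\<close> vanish in the limit, so a finite net of points of \<open>D\<close> controls all
  times for large indices.\<close>

lemma asymptotically_equicontinuous_uniform_limit:
  fixes F :: "nat \<Rightarrow> real \<Rightarrow> 'a::banach" and \<theta> :: "real \<Rightarrow> real"
  assumes \<theta>: "continuous_on {0..T} \<theta>" and "0 \<le> K"
    and lip: "\<And>n s t. s \<in> {0..T} \<Longrightarrow> t \<in> {0..T} \<Longrightarrow> norm (F n t - F n s) \<le> K * (\<bar>\<theta> t - \<theta> s\<bar> + a n)"
    and a: "a \<longlonglongrightarrow> 0"
    and D: "D \<subseteq> {0..T}" "{0..T} \<subseteq> closure D" "\<And>q. q \<in> D \<Longrightarrow> convergent (\<lambda>n. F n q)"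
  obtains x where "uniform_limit {0..T} F x sequentially"
proof -
  have "uniformly_Cauchy_on {0..T} F"
  proof (rule uniformly_Cauchy_onI)
    fix e :: real assume "0 < e"
    \<comment> \<open>Moving from \<open>t\<close> to the net point costs \<open>2 * (e / 5)\<close>
      for each of the two functions, and their comparison there costs the fifth share. The summand 1
      avoids division by zero.\<close>
    define \<eta> where "\<eta> = e / (5 * (K + 1))"
    have \<eta>: "0 < \<eta>" "K * \<eta> \<le> e / 5"
      using \<open>0 < e\<close> \<open>0 \<le> K\<close> by (simp_all add: \<eta>_def field_simps)
    obtain \<delta> where \<delta>: "0 < \<delta>" "\<And>s t. s \<in> {0..T} \<Longrightarrow> t \<in> {0..T} \<Longrightarrow> dist s t < \<delta> \<Longrightarrow> dist (\<theta> s) (\<theta> t) < \<eta>"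
      using compact_uniformly_continuous[OF \<theta>] \<eta>(1) unfolding uniformly_continuous_on_def by (metis compact_Icc)
    have "{0..T} \<subseteq> (\<Union>q\<in>D. ball q \<delta>)"
    proof
      fix t assume "t \<in> {0..T}"
      then obtain q where "q \<in> D" "dist q t < \<delta>"
        using D(2) \<delta>(1) by (meson closure_approachable subsetD)
      then show "t \<in> (\<Union>q\<in>D. ball q \<delta>)" by auto
    qed
    then obtain D' where D': "D' \<subseteq> D" "finite D'" "{0..T} \<subseteq> (\<Union>q\<in>D'. ball q \<delta>)"
      by (rule compactE_image[OF compact_Icc, rotated]) auto
    have "\<forall>q\<in>D'. \<forall>\<^sub>F N in sequentially. \<forall>m\<ge>N. \<forall>n\<ge>N. dist (F m q) (F n q) < e / 5"
    proof
      fix q assume "q \<in> D'"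
      then have "Cauchy (\<lambda>n. F n q)" using D(3) D'(1) by (blast intro: convergent_Cauchy)
      then obtain M where M: "\<And>m n. m \<ge> M \<Longrightarrow> n \<ge> M \<Longrightarrow> dist (F m q) (F n q) < e / 5"
        using \<open>0 < e\<close> unfolding Cauchy_def by (metis divide_pos_pos zero_less_numeral)
      show "\<forall>\<^sub>F N in sequentially. \<forall>m\<ge>N. \<forall>n\<ge>N. dist (F m q) (F n q) < e / 5"
        using eventually_ge_at_top[of M] by eventually_elim (use M in auto)
    qed
    then have "\<forall>\<^sub>F N in sequentially. \<forall>q\<in>D'. \<forall>m\<ge>N. \<forall>n\<ge>N. dist (F m q) (F n q) < e / 5"
      using D'(2) by (simp add: eventually_ball_finite)
    then obtain N1 where N1: "\<And>q m n. q \<in> D' \<Longrightarrow> m \<ge> N1 \<Longrightarrow> n \<ge> N1 \<Longrightarrow> dist (F m q) (F n q) < e / 5"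
      unfolding eventually_sequentially by blast
    have "\<forall>\<^sub>F n in sequentially. a n < \<eta>"
      using order_tendstoD(2)[OF a \<eta>(1)] .
    then obtain N2 where N2: "\<And>n. n \<ge> N2 \<Longrightarrow> a n < \<eta>"
      by (auto simp: eventually_sequentially)
    show "\<exists>M. \<forall>t\<in>{0..T}. \<forall>m\<ge>M. \<forall>n\<ge>M. dist (F m t) (F n t) < e"
    proof (intro exI ballI allI impI)
      fix t m n assume t: "t \<in> {0..T}" and mn: "max N1 N2 \<le> m" "max N1 N2 \<le> n"
      then obtain q where q: "q \<in> D'" "dist q t < \<delta>" using D'(3) by auto
      then have qT: "q \<in> {0..T}" using D(1) D'(1) by auto
      have close: "dist (F k t) (F k q) \<le> 2 * (e / 5)" if "k \<ge> N2" for k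
      proof -
        have "\<bar>\<theta> t - \<theta> q\<bar> + a k \<le> 2 * \<eta>"
          using \<delta>(2)[OF qT t q(2)] N2[OF that] by (simp add: dist_real_def)
        then have "K * (\<bar>\<theta> t - \<theta> q\<bar> + a k) \<le> K * (2 * \<eta>)"
          using \<open>0 \<le> K\<close> by (rule mult_left_mono)
        with lip[OF qT t, of k] \<eta>(2) show ?thesis by (simp add: dist_norm)
      qed
      show "dist (F m t) (F n t) < e"
        using close[of m] close[of n] N1[OF q(1), of m n] mn
          dist_triangle[of "F m t" "F n t" "F m q"] dist_triangle[of "F m q" "F n t" "F n q"]
        by (simp add: dist_commute)
    qed
  qed
  then show ?thesis
    using that Cauchy_uniformly_convergent uniformly_convergent_on_def by metis
qed

section \<open>Nearest points and admissible paths\<close>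

definition proximal_point :: "'a::metric_space set \<Rightarrow> 'a \<Rightarrow> 'a" where
  "proximal_point S p = (SOME q. q \<in> S \<and> dist p q = infdist p S)"

text \<open>In infinite dimension closedness alone gives no minimizer; compactness of the bounded
  pieces replaces it.\<close>

lemma proximal_point:
  fixes S :: "'a::real_normed_vector set"
  assumes "S \<noteq> {}" "\<And>R. compact (S \<inter> cball 0 R)"
  shows "proximal_point S p \<in> S \<and> dist p (proximal_point S p) = infdist p S"
  unfolding proximal_point_def
proof (rule someI_ex)
  obtain s where s: "s \<in> S" using assms(1) by auto
  \<comment> \<open>This ball contains every point at most as far from \<open>p\<close> as the
    reference point \<open>s\<close>, so minimizing inside it is minimizing over
    \<open>S\<close>.\<close>
  let ?K = "S \<inter> cball 0 (norm p + dist p s)"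
  have le: "norm y \<le> norm p + dist p y" for y
    using norm_triangle_ineq2[of y p] by (simp add: dist_norm norm_minus_commute)
  have "?K \<noteq> {}"
    using s le[of s] by auto
  moreover have "continuous_on ?K (dist p)" by (intro continuous_intros)
  ultimately obtain q where q: "q \<in> ?K" "\<And>y. y \<in> ?K \<Longrightarrow> dist p q \<le> dist p y"
    using continuous_attains_inf[OF assms(2)] by metis
  have min: "dist p q \<le> dist p y" if "y \<in> S" for y
  proof (cases "dist p y \<le> dist p s")
    case True
    then show ?thesis using q(2)[of y] le[of y] that by auto
  next
    case False
    then show ?thesis using q(2)[of s] s le[of s] by auto
  qed
  have "infdist p S = dist p q"
    unfolding infdist_notempty[OF assms(1)]
    by (rule cInf_eq_minimum) (use q min in auto)
  then show "\<exists>q. q \<in> S \<and> dist p q = infdist p S" using q by auto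
qed

text \<open>Squaring \<open>norm (p - q) \<le> norm (p - y)\<close> and expanding around
  \<open>q\<close> gives the normal inequality with constant 1/2.\<close>

lemma proximal_normal_cone_projection:
  fixes S :: "'a::real_inner set"
  assumes "q \<in> S" "dist p q = infdist p S"
  shows "p - q \<in> proximal_normal_cone S q"
proof -
  have "inner (p - q) (y - q) \<le> 1 / 2 * (norm (y - q))\<^sup>2" if "y \<in> S" for y
  proof -
    have "norm (p - q) \<le> norm (p - y)"
      using infdist_le[OF that, of p] assms(2) by (simp add: dist_norm)
    then have "(norm (p - q))\<^sup>2 \<le> (norm ((p - q) - (y - q)))\<^sup>2"
      by (intro power_mono) auto
    then show ?thesis
      unfolding power2_norm_eq_inner by (simp add: inner_diff_left inner_diff_right inner_commute algebra_simps)
  qed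
  then show ?thesis
    using assms(1) unfolding proximal_normal_cone_def by (auto intro!: exI[of _ "1/2"])
qed

lemma infdist_less_obtain:
  assumes "S \<noteq> {}" "infdist p S < d"
  obtains q where "q \<in> S" "dist p q < d"
proof -
  have "(INF a\<in>S. dist p a) < d" using assms by (simp add: infdist_notempty)
  then show ?thesis using that assms(1) by (subst (asm) cINF_less_iff) auto
qed

text \<open>A class containing both the jumping paths of the scheme and their continuous limits.
  Borel measurability and a separable range are required everywhere on the line, so that composition
  with a coordinate of the plane stays measurable.\<close>

definition admissible_path :: "(real \<Rightarrow> 'a::real_normed_vector) \<Rightarrow> bool" where
  "admissible_path y \<longleftrightarrow> y \<in> borel_measurable borel \<and> (\<exists>Q. countable Q \<and> range y \<subseteq> closure Q) \<and> bounded (range y)"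

lemma admissible_path_const: "admissible_path (\<lambda>_. p)"
  unfolding admissible_path_def using closure_subset[of "{p}"] by (auto intro!: exI[of _ "{p}"])

lemma admissible_path_switch:
  assumes "admissible_path y"
  shows "admissible_path (\<lambda>t. if t < c then y t else p)"
proof -
  obtain Q where Q: "countable Q" "range y \<subseteq> closure Q" and [measurable]: "y \<in> borel_measurable borel" and b: "bounded (range y)"
    using assms by (auto simp: admissible_path_def)
  have "(\<lambda>t. if t < c then y t else p) \<in> borel_measurable borel" by measurable
  moreover have "range (\<lambda>t. if t < c then y t else p) \<subseteq> closure (insert p Q)"
    using Q(2) closure_mono[of Q "insert p Q"] closure_subset[of "insert p Q"] by auto
  moreover have "bounded (range (\<lambda>t. if t < c then y t else p))"
    by (rule bounded_subset[of "insert p (range y)"]) (use b in auto)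
  ultimately show ?thesis using Q(1) unfolding admissible_path_def by (metis countable_insert)
qed

text \<open>The image of the rationals is countable and dense in the range.\<close>

lemma admissible_path_continuous:
  fixes y :: "real \<Rightarrow> 'a::real_normed_vector"
  assumes y: "continuous_on UNIV y" and b: "bounded (range y)"
  shows "admissible_path y"
proof -
  have "y ` closure \<rat> \<subseteq> closure (y ` \<rat>)"
    by (rule image_closure_subset) (use y closure_subset[of "y ` \<rat>"] in \<open>auto intro: continuous_on_subset\<close>)
  then have "range y \<subseteq> closure (y ` \<rat>)"
    by (simp only: Rats_closure_real)
  moreover have "countable (y ` \<rat>)" using countable_rat by (rule countable_image)
  moreover have "y \<in> borel_measurable borel" using y by (rule borel_measurable_continuous_onI)
  ultimately show ?thesis using b unfolding admissible_path_def by blast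
qed

section \<open>The catching-up algorithm\<close>

text \<open>\<open>P\<close> stands for the integrated perturbation, which enters through causality,
  growth and Lipschitz dependence. Causality compares paths strictly before \<open>t\<close>:
  successive stages of the scheme can already differ at the node where the next value is
  set.\<close>

locale catching_up =
  fixes T L r :: real and C :: "real \<Rightarrow> 'a::{real_inner, banach} \<Rightarrow> 'a set" and \<theta> :: "real \<Rightarrow> real"
    and P :: "(real \<Rightarrow> 'a) \<Rightarrow> real \<Rightarrow> 'a" and x0 :: 'a
  assumes T: "0 < T" and L: "0 \<le> L" "L < 1" and r: "0 < r"
    and \<theta>_0: "\<theta> 0 = 0" and \<theta>_cont: "continuous_on {0..T} \<theta>"
    and \<theta>_less: "\<And>s t. 0 \<le> s \<Longrightarrow> s < t \<Longrightarrow> t \<le> T \<Longrightarrow> \<theta> s < \<theta> t"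
    and C_near: "\<And>s t x y z. s \<in> {0..T} \<Longrightarrow> t \<in> {0..T} \<Longrightarrow> z \<in> C s x \<Longrightarrow>
          infdist z (C t y) \<le> \<bar>\<theta> t - \<theta> s\<bar> + L * norm (x - y)"
    and C_closed: "\<And>t x. t \<in> {0..T} \<Longrightarrow> closed (C t x)"
    and C_nonempty: "\<And>t x. t \<in> {0..T} \<Longrightarrow> C t x \<noteq> {}"
    and C_normal: "\<And>t u x n y. t \<in> {0..T} \<Longrightarrow> n \<in> proximal_normal_cone (C t u) x \<Longrightarrow> y \<in> C t u \<Longrightarrow>
          inner n (y - x) \<le> norm n / (2 * r) * (norm (y - x))\<^sup>2"
    and C_compact: "\<And>t R. t \<in> {0..T} \<Longrightarrow> compact (closure ((\<Union>a\<in>cball 0 R. C t a) \<inter> cball 0 R))"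
    and P_causal: "\<And>y z t. admissible_path y \<Longrightarrow> admissible_path z \<Longrightarrow> t \<in> {0..T} \<Longrightarrow>
          (\<And>s. 0 \<le> s \<Longrightarrow> s < t \<Longrightarrow> y s = z s) \<Longrightarrow> P y t = P z t"
    and P_growth: "\<And>y s t B. admissible_path y \<Longrightarrow> 0 \<le> s \<Longrightarrow> s \<le> t \<Longrightarrow> t \<le> T \<Longrightarrow>
          (\<And>u. 0 \<le> u \<Longrightarrow> u < t \<Longrightarrow> norm (y u) \<le> B) \<Longrightarrow> norm (P y t - P y s) \<le> (1 + B) * (\<theta> t - \<theta> s)"
    and P_Lipschitz: "\<And>R. \<exists>\<kappa>\<ge>0. \<forall>y z \<epsilon>. admissible_path y \<longrightarrow> admissible_path z \<longrightarrow>
          (\<forall>s\<in>{0..T}. norm (y s) \<le> R \<and> norm (z s) \<le> R \<and> norm (y s - z s) \<le> \<epsilon>) \<longrightarrow>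
          (\<forall>t\<in>{0..T}. norm (P y t - P z t) \<le> \<kappa> * \<epsilon>)"
    and x0: "x0 \<in> C 0 x0"
begin

lemma \<theta>_le: "0 \<le> s \<Longrightarrow> s \<le> t \<Longrightarrow> t \<le> T \<Longrightarrow> \<theta> s \<le> \<theta> t"
  using \<theta>_less[of s t] by (cases "s = t") auto

lemma \<theta>_le_iff: "s \<in> {0..T} \<Longrightarrow> t \<in> {0..T} \<Longrightarrow> \<theta> s \<le> \<theta> t \<longleftrightarrow> s \<le> t"
  using \<theta>_less[of t s] \<theta>_le[of s t] by (cases "s \<le> t") auto

lemma \<theta>_less_iff: "s \<in> {0..T} \<Longrightarrow> t \<in> {0..T} \<Longrightarrow> \<theta> s < \<theta> t \<longleftrightarrow> s < t"
  using \<theta>_le_iff[of t s] by auto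

lemma \<theta>_T: "0 < \<theta> T"
  using \<theta>_less[of 0 T] T \<theta>_0 by simp

definition mesh :: "nat \<Rightarrow> real" where
  "mesh n = \<theta> T / real n"

definition node :: "nat \<Rightarrow> nat \<Rightarrow> real" where
  "node n i = (SOME t. t \<in> {0..T} \<and> \<theta> t = real i * mesh n)"

text \<open>Stage \<open>i\<close> lives on the whole line and is constant after node
  \<open>i\<close>, so \<open>P\<close> can be applied to it before the next value exists. The set
  is taken at the new time with the old state, which avoids an implicit equation for the new
  point.\<close>

primrec path :: "nat \<Rightarrow> nat \<Rightarrow> real \<Rightarrow> 'a" where
  "path n 0 = (\<lambda>_. x0)"
| "path n (Suc i) = (\<lambda>t. if t < node n (Suc i) then path n i t else
     proximal_point (C (node n (Suc i)) (path n i (node n i)))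
       (path n i (node n i) + (P (path n i) (node n (Suc i)) - P (path n i) (node n i))))"

abbreviation X :: "nat \<Rightarrow> nat \<Rightarrow> 'a" where
  "X n i \<equiv> path n i (node n i)"

text \<open>The point projected in step \<open>i\<close>; \<open>target n i - X n (Suc i)\<close> is
  the discrete normal.\<close>

definition target :: "nat \<Rightarrow> nat \<Rightarrow> 'a" where
  "target n i = X n i + (P (path n i) (node n (Suc i)) - P (path n i) (node n i))"

text \<open>\<open>q\<close> is the fixed point of \<open>q = 3 + L q\<close>: up to the factor \<open>mesh n\<close> times a bound of the path,
  each increment is at most \<open>3\<close> plus \<open>L\<close> times the preceding one.\<close>

definition q :: real where "q = 3 / (1 - L)"

text \<open>A discrete Gronwall bound: the \<open>n\<close> growth factors
  \<open>1 + q * mesh n\<close> multiply to at most \<open>exp (q * \<theta> T)\<close>, whatever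
  \<open>n\<close> is.\<close>

definition M :: real where "M = (1 + norm x0) * exp (q * \<theta> T)"

definition K :: real where "K = q * M"

lemma q: "3 \<le> q" "3 + L * q = q"
  using L by (simp_all add: q_def field_simps)

lemma M_ge: "1 + norm x0 \<le> M"
  using \<theta>_T q(1) mult_left_mono[of 1 "exp (q * \<theta> T)" "1 + norm x0"] by (simp add: M_def)

lemma M_ge_1: "1 \<le> M"
  using M_ge norm_ge_zero[of x0] by linarith

lemma K_pos: "0 < K"
  using q M_ge_1 by (simp add: K_def)

lemma admissible_path_path: "admissible_path (path n i)"
  by (induction i) (auto intro: admissible_path_const admissible_path_switch)

lemma path_values: "\<exists>j\<le>i. path n i t = X n j"
proof (induction i)
  case 0 then show ?case by simp
next
  case (Suc i)
  show ?case
  proof (cases "t < node n (Suc i)")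
    case True
    then show ?thesis using Suc le_Suc_eq by auto
  next
    case False
    then show ?thesis by (intro exI[of _ "Suc i"]) auto
  qed
qed

lemma proj:
  assumes "t \<in> {0..T}"
  shows "proximal_point (C t u) p \<in> C t u" "dist p (proximal_point (C t u) p) = infdist p (C t u)"
proof -
  have "compact (C t u \<inter> cball 0 R)" for R
  proof -
    \<comment> \<open>The radius also covers the state \<open>u\<close>, so that
      \<open>C t u\<close> is one of the sets in the union.\<close>
    let ?R = "max R (norm u)"
    have "C t u \<inter> cball 0 R = closure ((\<Union>a\<in>cball 0 ?R. C t a) \<inter> cball 0 ?R) \<inter> (C t u \<inter> cball 0 R)"
      using closure_subset[of "(\<Union>a\<in>cball 0 ?R. C t a) \<inter> cball 0 ?R"] by fastforce
    moreover have "compact \<dots>"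
      using assms by (intro compact_Int_closed C_compact closed_Int C_closed) auto
    ultimately show ?thesis by simp
  qed
  with C_nonempty[OF assms] show "proximal_point (C t u) p \<in> C t u" "dist p (proximal_point (C t u) p) = infdist p (C t u)"
    using proximal_point[of "C t u" p] by blast+
qed

section \<open>Discrete estimates on a fixed grid\<close>

context
  fixes n :: nat assumes n: "0 < n"
begin

lemma mesh_pos: "0 < mesh n"
  using n \<theta>_T by (simp add: mesh_def)

lemma node: 
  assumes "i \<le> n" shows "node n i \<in> {0..T}" "\<theta> (node n i) = real i * mesh n"
proof -
  have "real i * mesh n \<le> real n * mesh n"
    using assms mesh_pos by (intro mult_right_mono) auto
  also have "\<dots> = \<theta> T" using n by (simp add: mesh_def)
  finally have "\<exists>t. 0 \<le> t \<and> t \<le> T \<and> \<theta> t = real i * mesh n"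
    using mesh_pos T by (intro IVT') (auto simp: \<theta>_0 \<theta>_cont)
  then have "\<exists>t. t \<in> {0..T} \<and> \<theta> t = real i * mesh n" by auto
  from someI_ex[OF this] show "node n i \<in> {0..T}" "\<theta> (node n i) = real i * mesh n"
    by (auto simp: node_def)
qed

lemma node_0: "node n 0 = 0"
  using node[of 0] \<theta>_le_iff[of "node n 0" 0] T by (auto simp: \<theta>_0)

lemma node_le_iff: "i \<le> n \<Longrightarrow> j \<le> n \<Longrightarrow> node n i \<le> node n j \<longleftrightarrow> i \<le> j"
  using \<theta>_le_iff[of "node n i" "node n j"] node[of i] node[of j] mesh_pos by simp

lemma node_less_iff: "i \<le> n \<Longrightarrow> j \<le> n \<Longrightarrow> node n i < node n j \<longleftrightarrow> i < j"
  using node_le_iff[of j i] by auto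

text \<open>Later stages change the path only from node \<open>Suc i\<close> on. The guard
  \<open>i < n\<close> covers the last stage, beyond which the grid has no node.\<close>

lemma path_eq:
  assumes "i \<le> j" "j \<le> n" "i < n \<Longrightarrow> t < node n (Suc i)"
  shows "path n j t = path n i t"
  using assms(1,2)
proof (induction j rule: dec_induct)
  case (step m)
  then have "t < node n (Suc m)"
    using assms(3) node_le_iff[of "Suc i" "Suc m"] by auto
  with step show ?case by simp
qed simp

lemma path_ge: "node n i \<le> t \<Longrightarrow> path n i t = X n i"
  by (cases i) auto

lemma X_Suc: "X n (Suc i) = proximal_point (C (node n (Suc i)) (X n i)) (target n i)"
  by (simp add: target_def)

text \<open>For \<open>i = 0\<close> truncated subtraction makes the preceding state
  \<open>x0\<close> itself, and the claim is the compatibility of the initial datum.\<close>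

lemma X_in: "i \<le> n \<Longrightarrow> X n i \<in> C (node n i) (X n (i - 1))"
  using proj(1)[OF node(1), of i "X n (i - 1)" "target n (i - 1)"] x0 X_Suc[of "i - 1"]
  by (cases i) (auto simp: node_0 simp del: path.simps(2))

text \<open>\<open>X n i\<close> belongs to the previous set, so the Hausdorff condition places it
  within \<open>mesh n + L * d\<close> of the next one; the perturbation adds
  \<open>B * mesh n\<close>, once for the normal and twice for the increment.\<close>

lemma step_estimate:
  assumes i: "i < n" and B: "\<And>j. j \<le> i \<Longrightarrow> norm (X n j) + 1 \<le> B" and d: "norm (X n (i - 1) - X n i) \<le> d"
  shows "norm (target n i - X n (Suc i)) \<le> (B + 1) * mesh n + L * d"
    and "norm (X n (Suc i) - X n i) \<le> (2 * B + 1) * mesh n + L * d"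
proof -
  have nodes: "node n i \<in> {0..T}" "node n (Suc i) \<in> {0..T}" "node n i \<le> node n (Suc i)"
    using node(1) node_le_iff i by auto
  have th: "\<theta> (node n (Suc i)) - \<theta> (node n i) = mesh n"
    using node(2)[of i] node(2)[of "Suc i"] i by (simp add: algebra_simps)
  \<comment> \<open>\<open>B\<close> bounds the norms plus 1, so the growth factor
    \<open>1 + (B - 1)\<close> is exactly \<open>B\<close>.\<close>
  have "norm (path n i u) \<le> B - 1" for u
    using path_values[of i n u] B by fastforce
  then have "norm (target n i - X n i) \<le> (1 + (B - 1)) * (\<theta> (node n (Suc i)) - \<theta> (node n i))"
    unfolding target_def add_diff_cancel_left' using nodes by (intro P_growth admissible_path_path) auto
  then have 1: "norm (target n i - X n i) \<le> B * mesh n" by (simp add: th)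
  have "infdist (X n i) (C (node n (Suc i)) (X n i)) \<le> \<bar>\<theta> (node n (Suc i)) - \<theta> (node n i)\<bar> + L * norm (X n (i - 1) - X n i)"
    using i by (intro C_near nodes X_in) auto
  also have "\<dots> \<le> mesh n + L * d"
    using d L mesh_pos by (simp add: th mult_left_mono)
  finally have "infdist (target n i) (C (node n (Suc i)) (X n i)) \<le> mesh n + L * d + B * mesh n"
    using infdist_triangle[of "target n i" "C (node n (Suc i)) (X n i)" "X n i"] 1 by (simp add: dist_norm)
  moreover have "norm (target n i - X n (Suc i)) = infdist (target n i) (C (node n (Suc i)) (X n i))"
    using proj(2)[OF nodes(2)] by (simp only: X_Suc dist_norm)
  ultimately show 2: "norm (target n i - X n (Suc i)) \<le> (B + 1) * mesh n + L * d"
    by (simp add: algebra_simps)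
  have "norm (X n (Suc i) - X n i) \<le> norm (target n i - X n i) + norm (target n i - X n (Suc i))"
    using norm_triangle_ineq4[of "target n i - X n i" "target n i - X n (Suc i)"] by simp
  with 1 2 show "norm (X n (Suc i) - X n i) \<le> (2 * B + 1) * mesh n + L * d"
    by (simp add: algebra_simps)
qed

text \<open>Positions, increments and normals are bounded in one induction, because each step uses
  all earlier positions and the last increment. Passing from \<open>B i\<close> to
  \<open>B (Suc i)\<close> adds exactly one increment bound.\<close>

lemma bounds_aux:
  defines "B \<equiv> \<lambda>i. (1 + norm x0) * (1 + q * mesh n) ^ i"
  assumes "i \<le> n"
  shows "(\<forall>j\<le>i. norm (X n j) + 1 \<le> B i) \<and>
    (\<forall>j<i. norm (X n (Suc j) - X n j) \<le> q * mesh n * B i \<and> norm (target n j - X n (Suc j)) \<le> q * mesh n * B i)"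
  using assms(2)
proof (induction i)
  case 0 then show ?case by (simp add: B_def)
next
  case (Suc i)
  let ?s = "mesh n"
  have s: "0 < ?s" by (rule mesh_pos)
  have B1: "1 \<le> B i"
  proof -
    have "1 \<le> (1 + q * ?s) ^ i" using s q by (intro one_le_power) auto
    then show ?thesis unfolding B_def
      by (metis add_increasing2 mult_mono' mult_1 norm_ge_zero order_refl zero_le_one)
  qed
  have BS: "B (Suc i) = B i + q * ?s * B i" by (simp add: B_def algebra_simps)
  have qs: "0 \<le> q * ?s * B i" using s q B1 by simp
  have IH: "\<And>j. j \<le> i \<Longrightarrow> norm (X n j) + 1 \<le> B i" "\<And>j. j < i \<Longrightarrow> norm (X n (Suc j) - X n j) \<le> q * ?s * B i"
      "\<And>j. j < i \<Longrightarrow> norm (target n j - X n (Suc j)) \<le> q * ?s * B i"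
    using Suc by (auto simp del: path.simps(2))
  \<comment> \<open>At \<open>i = 0\<close> the preceding increment vanishes by truncated
    subtraction.\<close>
  have d: "norm (X n (i - 1) - X n i) \<le> q * ?s * B i"
    using IH(2)[of "i - 1"] qs by (cases i) (auto simp: norm_minus_commute simp del: path.simps(2))
  \<comment> \<open>Since \<open>1 \<le> B i\<close>, the constant is absorbed into
    \<open>3 * B i\<close>, and the fixed point equation \<open>3 + L * q = q\<close> closes the
    induction.\<close>
  have "(2 * B i + 1) * ?s + L * (q * ?s * B i) \<le> (3 * B i) * ?s + L * (q * ?s * B i)"
    using B1 s by (intro add_right_mono mult_right_mono) auto
  also have "\<dots> = (3 + L * q) * ?s * B i" by (simp add: algebra_simps)
  finally have le: "(2 * B i + 1) * ?s + L * (q * ?s * B i) \<le> q * ?s * B i" by (simp only: q(2))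
  have le2: "(B i + 1) * ?s \<le> (2 * B i + 1) * ?s" using B1 s by (intro mult_right_mono) auto
  have "i < n" using Suc by simp
  note se = step_estimate[OF this IH(1) d]
  have st: "norm (X n (Suc i) - X n i) \<le> q * ?s * B i" using se(2) le by linarith
  have tg: "norm (target n i - X n (Suc i)) \<le> q * ?s * B i" using se(1) le le2 by linarith
  have up: "q * ?s * B i \<le> q * ?s * B (Suc i)" using BS qs s q by (intro mult_left_mono) auto
  show ?case
  proof (intro conjI allI impI)
    fix j assume "j \<le> Suc i"
    then consider "j \<le> i" | "j = Suc i" by linarith
    then show "norm (X n j) + 1 \<le> B (Suc i)"
    proof cases
      case 1 then show ?thesis using IH(1)[of j] BS qs by linarith
    next
      case 2
      have "norm (X n (Suc i)) \<le> norm (X n i) + norm (X n (Suc i) - X n i)" by (rule norm_triangle_sub)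
      then show ?thesis unfolding 2 using st IH(1)[of i] BS by linarith
    qed
  next
    fix j assume "j < Suc i"
    then consider "j < i" | "j = i" by linarith
    then show "norm (X n (Suc j) - X n j) \<le> q * ?s * B (Suc i)"
      by cases (use IH(2)[of j] st up in \<open>auto simp del: path.simps(2)\<close>)
  next
    fix j assume "j < Suc i"
    then consider "j < i" | "j = i" by linarith
    then show "norm (target n j - X n (Suc j)) \<le> q * ?s * B (Suc i)"
      by cases (use IH(3)[of j] tg up in \<open>auto simp del: path.simps(2)\<close>)
  qed
qed

lemma bounds:
  shows X_bound: "i \<le> n \<Longrightarrow> norm (X n i) \<le> M"
    and X_diff_bound: "i < n \<Longrightarrow> norm (X n (Suc i) - X n i) \<le> K * mesh n"
    and normal_bound: "i < n \<Longrightarrow> norm (target n i - X n (Suc i)) \<le> K * mesh n"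
proof -
  have "(1 + q * mesh n) ^ n = (1 + (q * \<theta> T) / real n) ^ n" by (simp add: mesh_def)
  also have "\<dots> \<le> exp (q * \<theta> T)"
  proof (rule exp_ge_one_plus_x_over_n_power_n)
    have "0 \<le> q * \<theta> T" using q \<theta>_T by simp
    then show "- real n \<le> q * \<theta> T" using of_nat_0_le_iff[of n] by linarith
  qed (rule n)
  finally have le: "(1 + norm x0) * (1 + q * mesh n) ^ n \<le> M"
    unfolding M_def by (intro mult_left_mono) auto
  then have "q * mesh n * ((1 + norm x0) * (1 + q * mesh n) ^ n) \<le> K * mesh n"
    using q mesh_pos mult_left_mono[OF le, of "q * mesh n"] by (simp add: K_def mult_ac)
  with le bounds_aux[of n] show "i \<le> n \<Longrightarrow> norm (X n i) \<le> M"
    "i < n \<Longrightarrow> norm (X n (Suc i) - X n i) \<le> K * mesh n"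
    "i < n \<Longrightarrow> norm (target n i - X n (Suc i)) \<le> K * mesh n"
    by (force simp del: path.simps(2))+
qed

lemma X_diff_bound':
  assumes "i \<le> j" "j \<le> n" shows "norm (X n j - X n i) \<le> real (j - i) * (K * mesh n)"
  using assms
proof (induction j rule: dec_induct)
  case (step m)
  have "norm (X n (Suc m) - X n i) \<le> norm (X n (Suc m) - X n m) + norm (X n m - X n i)"
    using norm_triangle_ineq[of "X n (Suc m) - X n m" "X n m - X n i"] by simp
  also have "\<dots> \<le> K * mesh n + real (m - i) * (K * mesh n)"
    using step X_diff_bound[of m] by simp
  also have "\<dots> = real (Suc m - i) * (K * mesh n)"
    using step by (simp add: Suc_diff_le algebra_simps)
  finally show ?case .
qed simp

text \<open>The index is the integer part of \<open>\<theta> t / mesh n\<close>. At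
  \<open>t = T\<close> it equals \<open>n\<close>, for which no next node exists; hence the guard on
  the strict bound.\<close>

lemma index:
  assumes t: "t \<in> {0..T}"
  obtains j where "j \<le> n" "node n j \<le> t" "j < n \<Longrightarrow> t < node n (Suc j)" "path n n t = X n j"
    "\<theta> (node n j) \<le> \<theta> t" "\<theta> t - mesh n \<le> \<theta> (node n j)"
proof -
  define j where "j = nat \<lfloor>\<theta> t / mesh n\<rfloor>"
  have "0 \<le> \<theta> t" using \<theta>_le[of 0 t] t \<theta>_0 by simp
  then have "real j = of_int \<lfloor>\<theta> t / mesh n\<rfloor>" using mesh_pos by (simp add: j_def)
  then have "real j \<le> \<theta> t / mesh n" "\<theta> t / mesh n < real j + 1"
    using floor_correct[of "\<theta> t / mesh n"] by auto
  then have j: "real j * mesh n \<le> \<theta> t" "\<theta> t < (real j + 1) * mesh n"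
    using mesh_pos by (simp_all only: pos_le_divide_eq pos_divide_less_eq)
  have "\<theta> t \<le> \<theta> T" using \<theta>_le[of t T] t by simp
  also have "\<dots> = real n * mesh n" using n by (simp add: mesh_def)
  finally have "real j * mesh n \<le> real n * mesh n" using j(1) by linarith
  then have jn: "j \<le> n" using mesh_pos by simp
  have a: "node n j \<le> t" using \<theta>_le_iff[OF node(1)[OF jn] t] j(1) node(2)[OF jn] by simp
  have b: "t < node n (Suc j)" if "j < n"
    using \<theta>_less_iff[OF t node(1)[of "Suc j"]] j(2) node(2)[of "Suc j"] that by (simp add: algebra_simps)
  have c: "path n n t = X n j"
    using path_eq[of j n t] path_ge[OF a] b jn by simp
  show ?thesis
    by (rule that[OF jn a b c]) (use j node(2)[OF jn] in \<open>auto simp: algebra_simps\<close>)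
qed

lemma index_mono:
  assumes "i \<le> n" "j \<le> n" "node n i \<le> s" "s \<le> t" "j < n \<Longrightarrow> t < node n (Suc j)"
  shows "i \<le> j"
proof (rule ccontr)
  assume "\<not> i \<le> j"
  then have "node n (Suc j) \<le> node n i" "j < n" using assms(1) by (auto simp: node_le_iff)
  with assms show False by auto
qed

text \<open>The path jumps, so even close times may be one step apart: the number of cells between
  their nodes exceeds the \<theta>-distance divided by the mesh by at most one.\<close>

lemma path_Lipschitz:
  assumes "s \<in> {0..T}" "t \<in> {0..T}"
  shows "norm (path n n t - path n n s) \<le> K * (\<bar>\<theta> t - \<theta> s\<bar> + mesh n)"
  using assms
proof (induction s t rule: linorder_wlog)
  case (le s t)
  obtain i where i: "i \<le> n" "node n i \<le> s" "path n n s = X n i" "\<theta> s - mesh n \<le> \<theta> (node n i)"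
    using index[OF le(2)] by metis
  obtain j where j: "j \<le> n" "node n j \<le> t" "path n n t = X n j" "j < n \<Longrightarrow> t < node n (Suc j)" "\<theta> (node n j) \<le> \<theta> t"
    using index[OF le(3)] by metis
  have ij: "i \<le> j" using index_mono i j le(1) by blast
  have "norm (X n j - X n i) \<le> K * ((real j - real i) * mesh n)"
    using X_diff_bound'[OF ij j(1)] ij by (simp add: of_nat_diff mult_ac)
  also have "\<dots> \<le> K * (\<bar>\<theta> t - \<theta> s\<bar> + mesh n)"
    using K_pos i(4) j(5) node(2)[OF i(1)] node(2)[OF j(1)] by (intro mult_left_mono) (auto simp: algebra_simps)
  finally show ?case using i j by simp
qed (simp add: norm_minus_commute abs_minus_commute)

lemma path_bound: "norm (path n n t) \<le> M"
  using path_values[of n n t] X_bound by auto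

text \<open>By causality every step can be expressed with the final path alone, so the perturbation
  increments telescope.\<close>

lemma target_eq:
  assumes "i < n"
  shows "target n i = X n i + (P (path n n) (node n (Suc i)) - P (path n n) (node n i))"
proof -
  have "P (path n i) (node n k) = P (path n n) (node n k)" if "k = i \<or> k = Suc i" for k
  proof (rule P_causal)
    fix u assume "u < node n k"
    moreover have "node n k \<le> node n (Suc i)" using that assms node_le_iff[of i "Suc i"] by auto
    ultimately show "path n i u = path n n u" using path_eq[of i n u] assms by simp
  qed (use admissible_path_path node(1) that assms in auto)
  then show ?thesis by (simp add: target_def)
qed

text \<open>\<open>c\<close> is the state defining the test set, later the limit of
  \<open>path n n s\<close>, and \<delta> measures the discrepancy. For each step in between,
  \<open>y\<close> is moved to a nearby point of the set of that step, where prox-regularity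
  applies; the discrete normals are then summed. \<open>E\<close> bounds that displacement as well
  as the distance of the new state from \<open>c\<close>.\<close>

lemma discrete_variational_inequality:
  assumes s: "0 \<le> s" "s < t" "t \<le> T" and y: "y \<in> C s c" and \<delta>: "norm (path n n s - c) \<le> \<delta>"
  defines "W \<equiv> \<theta> t - \<theta> s + mesh n"
  defines "E \<equiv> (1 + K) * W + \<delta> + mesh n"
  shows "inner (path n n s - path n n t + (P (path n n) t - P (path n n) s)) (y - c)
    \<le> K * W * (2 * E + (norm (y - c) + 2 * E)\<^sup>2 / (2 * r)) + 2 * (1 + M) * mesh n * norm (y - c)"
proof -
  have sT: "s \<in> {0..T}" "t \<in> {0..T}" using s by auto
  obtain i0 where i0: "i0 \<le> n" "node n i0 \<le> s" "path n n s = X n i0" "i0 < n \<Longrightarrow> s < node n (Suc i0)"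
      "\<theta> s - mesh n \<le> \<theta> (node n i0)"
    using index[OF sT(1)] by metis
  obtain j0 where j0: "j0 \<le> n" "node n j0 \<le> t" "path n n t = X n j0" "j0 < n \<Longrightarrow> t < node n (Suc j0)"
      "\<theta> (node n j0) \<le> \<theta> t" "\<theta> t - mesh n \<le> \<theta> (node n j0)"
    using index[OF sT(2)] by metis
  have ij: "i0 \<le> j0" using index_mono i0 j0 s by (metis less_imp_le)
  have W: "(real j0 - real i0) * mesh n \<le> W"
    using i0(5) j0(5) node(2)[OF i0(1)] node(2)[OF j0(1)] by (simp add: W_def algebra_simps)
  have W_ge: "\<theta> t - \<theta> s \<le> W" "0 \<le> W" using mesh_pos \<theta>_less[OF s] by (auto simp: W_def)
  have \<delta>0: "0 \<le> \<delta>" using \<delta> norm_ge_zero order_trans by blast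
  \<comment> \<open>The extra mesh in \<open>E\<close> makes the inequality strict, so that a point
    of the set within distance \<open>E\<close> of \<open>y\<close> can be picked.\<close>
  have E: "W + K * W + \<delta> < E" "0 \<le> E" using K_pos W_ge \<delta>0 mesh_pos by (auto simp: E_def algebra_simps)
  let ?P = "P (path n n)"
  define \<psi> where "\<psi> = 2 * E + (norm (y - c) + 2 * E)\<^sup>2 / (2 * r)"
  have \<psi>: "0 \<le> \<psi>" using E r by (simp add: \<psi>_def)
  \<comment> \<open>\<open>f (Suc i) - f i\<close> is the discrete normal of step \<open>i\<close>,
    so the sum of the normals telescopes.\<close>
  define f where "f i = ?P (node n i) - X n i" for i
  have X_c: "norm (X n i - c) \<le> K * W + \<delta>" if "i0 \<le> i" "i \<le> j0" for i
  proof -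
    have "norm (X n i - X n i0) \<le> (real i - real i0) * (K * mesh n)"
      using X_diff_bound'[OF that(1)] that j0(1) by (simp add: of_nat_diff)
    also have "\<dots> \<le> (real j0 - real i0) * (K * mesh n)"
      using that K_pos mesh_pos by (intro mult_right_mono) auto
    also have "\<dots> = K * ((real j0 - real i0) * mesh n)" by simp
    also have "\<dots> \<le> K * W" using W K_pos by (intro mult_left_mono) auto
    finally show ?thesis
      using norm_triangle_ineq[of "X n i - X n i0" "X n i0 - c"] \<delta> i0(3) by simp
  qed
  have summand: "inner (f (Suc i) - f i) (y - c) \<le> K * mesh n * \<psi>" if i: "i \<in> {i0..<j0}" for i
  proof -
    have i': "i0 \<le> i" "i < j0" "i < n" using i j0 by auto
    let ?t = "node n (Suc i)"
    let ?S = "C ?t (X n i)"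
    let ?n = "target n i - X n (Suc i)"
    have tT: "?t \<in> {0..T}" using node(1) i' by auto
    have "s < ?t" using i0(4) node_le_iff[of "Suc i0" "Suc i"] i' by auto
    moreover have "?t \<le> t" using node_le_iff[of "Suc i" j0] i' j0 by auto
    ultimately have th: "\<bar>\<theta> ?t - \<theta> s\<bar> \<le> W"
      using \<theta>_le[of s ?t] \<theta>_le[of ?t t] s W_ge by auto
    have "infdist y ?S \<le> \<bar>\<theta> ?t - \<theta> s\<bar> + L * norm (c - X n i)"
      by (rule C_near[OF sT(1) tT y])
    also have "L * norm (c - X n i) \<le> 1 * norm (c - X n i)"
      using L by (intro mult_right_mono) auto
    also have "\<bar>\<theta> ?t - \<theta> s\<bar> + 1 * norm (c - X n i) < E"
      using th X_c[of i] i' E by (simp add: norm_minus_commute)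
    finally have "infdist y ?S < E" by simp
    then obtain z where z: "z \<in> ?S" "dist y z < E"
      by (rule infdist_less_obtain[OF C_nonempty[OF tT]])
    have cone: "?n \<in> proximal_normal_cone ?S (X n (Suc i))"
      unfolding X_Suc by (rule proximal_normal_cone_projection) (rule proj[OF tT])+
    have Xc: "norm (X n (Suc i) - c) \<le> E"
      using X_c[of "Suc i"] i' E W_ge by auto
    have zX: "norm (z - X n (Suc i)) \<le> norm (y - c) + 2 * E"
      using norm_triangle_ineq[of "(y - c) - (y - z)" "c - X n (Suc i)"] norm_triangle_ineq4[of "y - c" "y - z"] z(2) Xc
      by (simp add: dist_norm norm_minus_commute)
    have "?n = f (Suc i) - f i"
      unfolding target_eq[OF i'(3)] f_def by (simp del: path.simps(2))
    \<comment> \<open>The test vector splits into a part based at the projected point, controlled by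
      prox-regularity, and two displacements of total size at most \<open>2 * E\<close>, controlled
      by Cauchy-Schwarz.\<close>
    then have eq: "inner (f (Suc i) - f i) (y - c) = inner ?n (z - X n (Suc i)) + inner ?n ((y - z) + (X n (Suc i) - c))"
      by (simp flip: inner_add_right del: path.simps(2))
    have "inner ?n (z - X n (Suc i)) \<le> norm ?n / (2 * r) * (norm (z - X n (Suc i)))\<^sup>2"
      by (rule C_normal[OF tT cone z(1)])
    moreover have "norm ?n / (2 * r) * (norm (z - X n (Suc i)))\<^sup>2 \<le> norm ?n / (2 * r) * (norm (y - c) + 2 * E)\<^sup>2"
      by (rule mult_left_mono[OF power_mono[OF zX]]) (use r in auto)
    moreover have "inner ?n ((y - z) + (X n (Suc i) - c)) \<le> norm ?n * norm ((y - z) + (X n (Suc i) - c))"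
      by (rule norm_cauchy_schwarz)
    moreover have "norm ((y - z) + (X n (Suc i) - c)) \<le> 2 * E"
      using norm_triangle_ineq[of "y - z" "X n (Suc i) - c"] z(2) Xc unfolding dist_norm by linarith
    then have "norm ?n * norm ((y - z) + (X n (Suc i) - c)) \<le> norm ?n * (2 * E)"
      by (rule mult_left_mono) simp
    moreover have "norm ?n * \<psi> = norm ?n / (2 * r) * (norm (y - c) + 2 * E)\<^sup>2 + norm ?n * (2 * E)"
      by (simp add: \<psi>_def distrib_left)
    moreover have "norm ?n * \<psi> \<le> K * mesh n * \<psi>"
      by (rule mult_right_mono[OF normal_bound[OF i'(3)] \<psi>])
    ultimately show ?thesis unfolding eq by linarith
  qed
  have "inner (f j0 - f i0) (y - c) = (\<Sum>i = i0..<j0. inner (f (Suc i) - f i) (y - c))"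
    using sum_Suc_diff'[OF ij, of f] by (simp only: flip: inner_sum_left)
  also have "\<dots> \<le> real (card {i0..<j0}) * (K * mesh n * \<psi>)"
    by (rule sum_bounded_above) (rule summand)
  also have "\<dots> = K * ((real j0 - real i0) * mesh n) * \<psi>"
    using ij by (simp add: of_nat_diff)
  also have "\<dots> \<le> K * W * \<psi>"
    using W K_pos \<psi> by (intro mult_right_mono mult_left_mono) auto
  finally have main: "inner (f j0 - f i0) (y - c) \<le> K * W * \<psi>" .
  \<comment> \<open>The sum runs between nodes, whereas \<open>P\<close> is evaluated at
    \<open>s\<close> and \<open>t\<close>; each end contributes a correction of order
    \<open>mesh n\<close>.\<close>
  have P_node: "norm (?P u - ?P (node n i)) \<le> (1 + M) * mesh n"
    if "u \<le> T" "i \<le> n" "node n i \<le> u" "\<theta> u - mesh n \<le> \<theta> (node n i)" for u i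
  proof -
    have "norm (?P u - ?P (node n i)) \<le> (1 + M) * (\<theta> u - \<theta> (node n i))"
      using that node(1)[of i] path_bound by (intro P_growth admissible_path_path) auto
    also have "\<dots> \<le> (1 + M) * mesh n" using that M_ge_1 by (intro mult_left_mono) auto
    finally show ?thesis .
  qed
  have eq: "path n n s - path n n t + (?P t - ?P s) = (f j0 - f i0) + ((?P t - ?P (node n j0)) - (?P s - ?P (node n i0)))"
    by (simp add: f_def i0(3) j0(3))
  have "inner ((?P t - ?P (node n j0)) - (?P s - ?P (node n i0))) (y - c)
      \<le> norm ((?P t - ?P (node n j0)) - (?P s - ?P (node n i0))) * norm (y - c)"
    by (rule norm_cauchy_schwarz)
  also have "\<dots> \<le> (2 * (1 + M) * mesh n) * norm (y - c)"
  proof (rule mult_right_mono)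
    have "norm (?P t - ?P (node n j0)) \<le> (1 + M) * mesh n" "norm (?P s - ?P (node n i0)) \<le> (1 + M) * mesh n"
      using P_node[of t j0] P_node[of s i0] i0 j0 s by auto
    moreover have "2 * (1 + M) * mesh n = (1 + M) * mesh n + (1 + M) * mesh n" by simp
    ultimately show "norm ((?P t - ?P (node n j0)) - (?P s - ?P (node n i0))) \<le> 2 * (1 + M) * mesh n"
      using norm_triangle_ineq4[of "?P t - ?P (node n j0)" "?P s - ?P (node n i0)"] by linarith
  qed simp
  finally show ?thesis
    using main unfolding eq inner_add_left \<psi>_def by linarith
qed

end

section \<open>Compactness and passage to the limit\<close>

lemma mesh_Suc_tendsto: "(\<lambda>n. mesh (Suc n)) \<longlonglongrightarrow> 0"
  unfolding mesh_def by (rule LIMSEQ_Suc[OF lim_const_over_n])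

text \<open>\<open>w\<close> is the state at the preceding node: the current value lies in the set
  frozen at \<open>w\<close>, at a time within one mesh of \<open>t\<close>. This serves both the
  compactness of the values and the constraint on the limit.\<close>

lemma near_value:
  assumes n: "0 < n" and t: "t \<in> {0..T}"
  obtains w where "norm w \<le> M" "norm (path n n t - w) \<le> K * mesh n"
    "\<And>z. infdist (path n n t) (C t z) \<le> mesh n + L * norm (w - z)"
proof -
  obtain j where j: "j \<le> n" "path n n t = X n j" "\<theta> (node n j) \<le> \<theta> t" "\<theta> t - mesh n \<le> \<theta> (node n j)"
    using index[OF n t] by metis
  show ?thesis
  proof
    show "norm (X n (j - 1)) \<le> M" using X_bound[OF n] j(1) by simp
    show "norm (path n n t - X n (j - 1)) \<le> K * mesh n"
      unfolding j(2) using X_diff_bound[OF n, of "j - 1"] j(1) K_pos mesh_pos[OF n] by (cases j) auto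
    fix z
    have "infdist (path n n t) (C t z) \<le> \<bar>\<theta> t - \<theta> (node n j)\<bar> + L * norm (X n (j - 1) - z)"
      unfolding j(2) by (rule C_near[OF node(1)[OF n j(1)] t X_in[OF n j(1)]])
    then show "infdist (path n n t) (C t z) \<le> mesh n + L * norm (X n (j - 1) - z)"
      using j(3,4) by simp
  qed
qed

text \<open>The values at time \<open>t\<close> belong to sets of slightly different times. Each is
  replaced by a point of \<open>C t w\<close> with bounded \<open>w\<close>, which lies in one
  compact set, and the replacement error vanishes with the mesh.\<close>

lemma pointwise_precompact:
  assumes t: "t \<in> {0..T}" and s: "strict_mono (s :: nat \<Rightarrow> nat)"
  shows "\<exists>\<rho>. strict_mono (\<rho> :: nat \<Rightarrow> nat) \<and> convergent (\<lambda>k. path (Suc (s (\<rho> k))) (Suc (s (\<rho> k))) t)"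
proof -
  let ?F = "\<lambda>n. path (Suc n) (Suc n) t"
  have "\<exists>w z. norm w \<le> M \<and> z \<in> C t w \<and> dist (?F n) z < 2 * mesh (Suc n)" for n
  proof -
    obtain w where w: "norm w \<le> M" "\<And>z. infdist (?F n) (C t z) \<le> mesh (Suc n) + L * norm (w - z)"
      using near_value[OF _ t, of "Suc n"] by auto
    \<comment> \<open>The distance is at most one mesh; doubling makes the bound strict, so that
      some point of the set attains it.\<close>
    have "infdist (?F n) (C t w) < 2 * mesh (Suc n)"
      using w(2)[of w] mesh_pos[of "Suc n"] by simp
    then obtain z where "z \<in> C t w" "dist (?F n) z < 2 * mesh (Suc n)"
      by (rule infdist_less_obtain[OF C_nonempty[OF t]])
    then show ?thesis using w(1) by blast
  qed
  then obtain w z where wz: "\<And>n. norm (w n) \<le> M" "\<And>n. z n \<in> C t (w n)" "\<And>n. dist (?F n) (z n) < 2 * mesh (Suc n)"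
    by metis
  \<comment> \<open>The replacement points lie within two meshes of the \<open>M\<close>-ball, and
    no mesh exceeds \<open>\<theta> T\<close>.\<close>
  define R where "R = M + 2 * \<theta> T"
  let ?K = "closure ((\<Union>a\<in>cball 0 R. C t a) \<inter> cball 0 R)"
  have "z n \<in> ?K" for n
  proof -
    have "norm (z n) \<le> norm (?F n) + dist (?F n) (z n)"
      using norm_triangle_sub[of "z n" "?F n"] by (simp add: dist_norm norm_minus_commute)
    moreover have "mesh (Suc n) \<le> \<theta> T" using \<theta>_T by (simp add: mesh_def field_simps)
    ultimately have "norm (z n) \<le> R"
      using wz(3)[of n] path_bound[of "Suc n" t] by (simp add: R_def del: path.simps(2))
    moreover have "norm (w n) \<le> R" using wz(1)[of n] \<theta>_T by (simp add: R_def)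
    ultimately have "z n \<in> (\<Union>a\<in>cball 0 R. C t a) \<inter> cball 0 R" using wz(2)[of n] by auto
    then show ?thesis by (rule subsetD[OF closure_subset])
  qed
  then have "\<forall>n. (z \<circ> s) n \<in> ?K" by simp
  then obtain l \<rho> where \<rho>: "strict_mono (\<rho> :: nat \<Rightarrow> nat)" "((z \<circ> s) \<circ> \<rho>) \<longlonglongrightarrow> l"
    using C_compact[OF t, of R] unfolding compact_def by blast
  have "strict_mono (s \<circ> \<rho>)" using s \<rho>(1) by (rule strict_mono_o)
  then have "(\<lambda>k. mesh (Suc ((s \<circ> \<rho>) k))) \<longlonglongrightarrow> 0"
    using LIMSEQ_subseq_LIMSEQ[OF mesh_Suc_tendsto] by (simp add: comp_def)
  then have "(\<lambda>k. 2 * mesh (Suc ((s \<circ> \<rho>) k))) \<longlonglongrightarrow> 0"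
    using tendsto_mult_left_zero by (metis mult_zero_right tendsto_mult_left)
  then have "(\<lambda>k. dist (?F ((s \<circ> \<rho>) k)) (z ((s \<circ> \<rho>) k))) \<longlonglongrightarrow> 0"
    by (rule Lim_null_comparison[rotated]) (use wz(3) in \<open>auto intro!: always_eventually less_imp_le simp del: path.simps(2)\<close>)
  then have "(\<lambda>k. ?F ((s \<circ> \<rho>) k) - z ((s \<circ> \<rho>) k)) \<longlonglongrightarrow> 0"
    unfolding dist_norm by (rule tendsto_norm_zero_cancel)
  from tendsto_add[OF this \<rho>(2)] have "(\<lambda>k. ?F ((s \<circ> \<rho>) k)) \<longlonglongrightarrow> l"
    by (simp add: comp_def del: path.simps(2))
  then show ?thesis
    using \<rho>(1) by (auto simp: convergent_def comp_def simp del: path.simps(2))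
qed

lemma Icc_subset_closure_Rats:
  assumes "0 < (T::real)" shows "{0..T} \<subseteq> closure (\<rat> \<inter> {0..T})"
proof
  fix t assume t: "t \<in> {0..T}"
  show "t \<in> closure (\<rat> \<inter> {0..T})"
    unfolding closure_approachable
  proof (intro allI impI)
    fix e :: real assume "0 < e"
    then have "max 0 (t - e) < min T (t + e)" using t assms by auto
    then obtain u where "u \<in> \<rat>" "max 0 (t - e) < u" "u < min T (t + e)"
      using Rats_dense_in_real by blast
    then show "\<exists>y\<in>\<rat> \<inter> {0..T}. dist y t < e"
      by (intro bexI[of _ u]) (auto simp: dist_real_def)
  qed
qed

text \<open>A diagonal subsequence converges at the rationals of the interval, and the common
  \<theta>-modulus upgrades this to uniform convergence. Lipschitz dependence carries the
  convergence over to \<open>P\<close>, so the discrete inequality passes to the limit term by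
  term.\<close>

theorem limit_path:
  obtains x where "admissible_path x" "x 0 = x0"
    "\<And>s t. s \<in> {0..T} \<Longrightarrow> t \<in> {0..T} \<Longrightarrow> norm (x t - x s) \<le> K * \<bar>\<theta> t - \<theta> s\<bar>"
    "\<And>t. t \<in> {0..T} \<Longrightarrow> x t \<in> C t (x t)"
    "\<And>s t y. 0 \<le> s \<Longrightarrow> s < t \<Longrightarrow> t \<le> T \<Longrightarrow> y \<in> C s (x s) \<Longrightarrow>
       inner (x s - x t + (P x t - P x s)) (y - x s) \<le> K * (\<theta> t - \<theta> s) *
         (2 * ((1 + K) * (\<theta> t - \<theta> s)) + (norm (y - x s) + 2 * ((1 + K) * (\<theta> t - \<theta> s)))\<^sup>2 / (2 * r))"
proof -
  define F where "F n = path (Suc n) (Suc n)" for n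
  define D where "D = \<rat> \<inter> {0..T}"
  have "countable D" unfolding D_def using countable_rat by blast
  then obtain \<rho> where \<rho>: "strict_mono (\<rho> :: nat \<Rightarrow> nat)" "\<And>t. t \<in> D \<Longrightarrow> convergent (\<lambda>k. F (\<rho> k) t)"
    using diagonal_convergent_subsequence[of D F] pointwise_precompact unfolding F_def D_def by blast
  define a where "a k = mesh (Suc (\<rho> k))" for k
  have a: "a \<longlonglongrightarrow> 0"
    using LIMSEQ_subseq_LIMSEQ[OF mesh_Suc_tendsto \<rho>(1)] by (simp add: a_def[abs_def] comp_def)
  define G where "G k = F (\<rho> k)" for k
  have G_lip: "norm (G k t - G k s) \<le> K * (\<bar>\<theta> t - \<theta> s\<bar> + a k)" if "s \<in> {0..T}" "t \<in> {0..T}" for k s t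
    using path_Lipschitz[of "Suc (\<rho> k)"] that by (simp add: G_def F_def a_def del: path.simps(2))
  obtain x' where x': "uniform_limit {0..T} G x' sequentially"
  proof (rule asymptotically_equicontinuous_uniform_limit[OF \<theta>_cont less_imp_le[OF K_pos] G_lip a])
    show "D \<subseteq> {0..T}" "{0..T} \<subseteq> closure D" by (auto simp: D_def Icc_subset_closure_Rats[OF T])
    show "convergent (\<lambda>n. G n t)" if "t \<in> D" for t using \<rho>(2)[OF that] by (simp add: G_def)
  qed auto
  \<comment> \<open>Clamping the time extends the limit continuously to the whole line, as
    admissibility demands.\<close>
  define x where "x t = x' (max 0 (min T t))" for t
  have x_eq: "x t = x' t" if "t \<in> {0..T}" for t using that by (auto simp: x_def max_def min_def)
  have lim: "(\<lambda>k. G k t) \<longlonglongrightarrow> x t" if "t \<in> {0..T}" for t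
    using tendsto_uniform_limitI[OF x' that] x_eq[OF that] by simp
  have x_lip: "norm (x t - x s) \<le> K * \<bar>\<theta> t - \<theta> s\<bar>" if st: "s \<in> {0..T}" "t \<in> {0..T}" for s t
  proof (rule LIMSEQ_le[of "\<lambda>k. norm (G k t - G k s)" _ "\<lambda>k. K * (\<bar>\<theta> t - \<theta> s\<bar> + a k)"])
    show "(\<lambda>k. norm (G k t - G k s)) \<longlonglongrightarrow> norm (x t - x s)"
      by (intro tendsto_intros lim st)
    have "(\<lambda>k. K * (\<bar>\<theta> t - \<theta> s\<bar> + a k)) \<longlonglongrightarrow> K * (\<bar>\<theta> t - \<theta> s\<bar> + 0)"
      by (intro tendsto_intros a)
    then show "(\<lambda>k. K * (\<bar>\<theta> t - \<theta> s\<bar> + a k)) \<longlonglongrightarrow> K * \<bar>\<theta> t - \<theta> s\<bar>" by simp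
  qed (use G_lip st in blast)
  have G_le: "norm (G k t) \<le> M" for k t
    using path_bound[of "Suc (\<rho> k)"] by (simp add: G_def F_def del: path.simps(2))
  have x_le: "norm (x t) \<le> M" if "t \<in> {0..T}" for t
    by (rule tendsto_upperbound[OF tendsto_norm[OF lim[OF that]]]) (auto simp: G_le)
  have "continuous_on {0..T} x"
    unfolding continuous_on_iff
  proof (intro ballI allI impI)
    fix s e assume s: "s \<in> {0..T}" and "0 < (e::real)"
    then have "0 < e / K" using K_pos by simp
    then obtain d where d: "0 < d" "\<And>t. t \<in> {0..T} \<Longrightarrow> dist t s < d \<Longrightarrow> dist (\<theta> t) (\<theta> s) < e / K"
      using \<theta>_cont s unfolding continuous_on_iff by blast
    show "\<exists>d>0. \<forall>t\<in>{0..T}. dist t s < d \<longrightarrow> dist (x t) (x s) < e"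
    proof (intro exI[of _ d] conjI ballI impI)
      fix t assume t: "t \<in> {0..T}" "dist t s < d"
      then have "K * \<bar>\<theta> t - \<theta> s\<bar> < e"
        using d(2)[OF t] K_pos by (simp add: dist_real_def field_simps)
      then show "dist (x t) (x s) < e" using x_lip[OF s t(1)] by (simp add: dist_norm)
    qed (rule d)
  qed
  then have "continuous_on UNIV (\<lambda>t. x (max 0 (min T t)))"
    by (rule continuous_on_compose2) (use T in \<open>auto intro!: continuous_intros\<close>)
  moreover have "x (max 0 (min T t)) = x t" for t
    by (simp add: x_def max_def min_def)
  ultimately have "continuous_on UNIV x" by simp
  moreover have "bounded (range x)"
    unfolding bounded_iff
  proof (intro exI ballI)
    fix p assume "p \<in> range x"
    then obtain t where "p = x t" by auto
    then have "p = x (max 0 (min T t))" by (simp add: x_def max_def min_def)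
    then show "norm p \<le> M" using x_le[of "max 0 (min T t)"] T by auto
  qed
  ultimately have adm: "admissible_path x" by (rule admissible_path_continuous)
  have PG: "(\<lambda>k. P (G k) t) \<longlonglongrightarrow> P x t" if t: "t \<in> {0..T}" for t
  proof -
    obtain \<kappa> where \<kappa>: "0 \<le> \<kappa>" "\<And>y z \<epsilon>. admissible_path y \<Longrightarrow> admissible_path z \<Longrightarrow>
          (\<And>s. s \<in> {0..T} \<Longrightarrow> norm (y s) \<le> M \<and> norm (z s) \<le> M \<and> norm (y s - z s) \<le> \<epsilon>) \<Longrightarrow>
          norm (P y t - P z t) \<le> \<kappa> * \<epsilon>"
      using P_Lipschitz[of M] t by metis
    show ?thesis
    proof (rule metric_LIMSEQ_I)
      fix e :: real assume "0 < e"
      \<comment> \<open>The summand 1 keeps the quotient meaningful for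
        \<open>\<kappa> = 0\<close>.\<close>
      define \<epsilon> where "\<epsilon> = e / (\<kappa> + 1)"
      have \<epsilon>: "0 < \<epsilon>" "\<kappa> * \<epsilon> < e" using \<open>0 < e\<close> \<kappa>(1) by (simp_all add: \<epsilon>_def field_simps)
      obtain N where N: "\<And>k s. N \<le> k \<Longrightarrow> s \<in> {0..T} \<Longrightarrow> dist (G k s) (x' s) < \<epsilon>"
        using uniform_limitD[OF x' \<epsilon>(1)] unfolding eventually_sequentially by blast
      show "\<exists>N. \<forall>k\<ge>N. dist (P (G k) t) (P x t) < e"
      proof (intro exI allI impI)
        fix k assume "N \<le> k"
        have "norm (P (G k) t - P x t) \<le> \<kappa> * \<epsilon>"
        proof (rule \<kappa>(2))
          show "admissible_path (G k)" by (simp add: G_def F_def admissible_path_path del: path.simps(2))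
          show "norm (G k s) \<le> M \<and> norm (x s) \<le> M \<and> norm (G k s - x s) \<le> \<epsilon>" if "s \<in> {0..T}" for s
            using G_le x_le[OF that] N[OF \<open>N \<le> k\<close> that] x_eq[OF that] by (simp add: dist_norm)
        qed (rule adm)
        with \<epsilon>(2) show "dist (P (G k) t) (P x t) < e" by (simp add: dist_norm)
      qed
    qed
  qed
  show ?thesis
  proof (rule that[OF adm _ x_lip])
    have "G k 0 = x0" for k
    proof -
      have "path (Suc (\<rho> k)) (Suc (\<rho> k)) 0 = path (Suc (\<rho> k)) 0 0"
        using node_less_iff[of "Suc (\<rho> k)" 0 1] node_0[of "Suc (\<rho> k)"] by (intro path_eq) auto
      then show ?thesis by (simp add: G_def F_def del: path.simps(2))
    qed
    then have "(\<lambda>k. G k 0) \<longlonglongrightarrow> x0" by simp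
    moreover have "(\<lambda>k. G k 0) \<longlonglongrightarrow> x 0" by (rule lim) (use T in simp)
    ultimately show "x 0 = x0" by (rule LIMSEQ_unique[symmetric])
  next
    fix t assume t: "t \<in> {0..T}"
    \<comment> \<open>The distance bound is used for the fixed state \<open>x t\<close>. The
      preceding states \<open>w k\<close> have the same limit as \<open>G k t\<close>, so the term
      with \<open>L\<close> disappears.\<close>
    have "\<exists>w. norm (G k t - w) \<le> K * a k \<and> infdist (G k t) (C t (x t)) \<le> a k + L * norm (w - x t)" for k
      unfolding G_def F_def a_def by (rule near_value[OF zero_less_Suc t, of "\<rho> k"]) blast
    then obtain w where w: "\<And>k. norm (G k t - w k) \<le> K * a k" "\<And>k. infdist (G k t) (C t (x t)) \<le> a k + L * norm (w k - x t)"
      by metis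
    have "(\<lambda>k. K * a k) \<longlonglongrightarrow> K * 0" by (intro tendsto_intros a)
    then have "(\<lambda>k. G k t - w k) \<longlonglongrightarrow> 0"
      by (intro Lim_null_comparison[of "\<lambda>k. G k t - w k" "\<lambda>k. K * a k"]) (use w(1) in auto)
    from tendsto_diff[OF lim[OF t] this] have "w \<longlonglongrightarrow> x t" by simp
    then have "(\<lambda>k. a k + L * norm (w k - x t)) \<longlonglongrightarrow> 0 + L * norm (x t - x t)"
      by (intro tendsto_intros a)
    moreover have "(\<lambda>k. infdist (G k t) (C t (x t))) \<longlonglongrightarrow> infdist (x t) (C t (x t))"
      by (intro tendsto_infdist lim t)
    ultimately have "infdist (x t) (C t (x t)) \<le> 0 + L * norm (x t - x t)"
      using w(2) by (intro LIMSEQ_le) auto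
    then have "infdist (x t) (C t (x t)) = 0" using infdist_nonneg[of "x t" "C t (x t)"] by simp
    then show "x t \<in> C t (x t)" using in_closed_iff_infdist_zero[OF C_closed[OF t] C_nonempty[OF t]] by simp
  next
    fix s t y assume st: "0 \<le> s" "s < t" "t \<le> T" and y: "y \<in> C s (x s)"
    \<comment> \<open>The discrete inequality is used with \<open>c = x s\<close> and
      \<open>\<delta> = norm (G k s - x s)\<close>, which tends to 0.\<close>
    define W where "W k = \<theta> t - \<theta> s + a k" for k
    define E where "E k = (1 + K) * W k + norm (G k s - x s) + a k" for k
    have sT: "s \<in> {0..T}" "t \<in> {0..T}" using st by auto
    have W: "W \<longlonglongrightarrow> \<theta> t - \<theta> s + 0" unfolding W_def by (intro tendsto_intros a)
    have "E \<longlonglongrightarrow> (1 + K) * (\<theta> t - \<theta> s + 0) + norm (x s - x s) + 0"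
      unfolding E_def by (intro tendsto_intros a W lim sT)
    then have E: "E \<longlonglongrightarrow> (1 + K) * (\<theta> t - \<theta> s)" by simp
    have r1: "(\<lambda>k. K * W k * (2 * E k + (norm (y - x s) + 2 * E k)\<^sup>2 / (2 * r)) + 2 * (1 + M) * a k * norm (y - x s))
       \<longlonglongrightarrow> K * (\<theta> t - \<theta> s + 0) * (2 * ((1 + K) * (\<theta> t - \<theta> s)) + (norm (y - x s) + 2 * ((1 + K) * (\<theta> t - \<theta> s)))\<^sup>2 / (2 * r))
           + 2 * (1 + M) * 0 * norm (y - x s)"
      using r by (intro tendsto_intros a W E) auto
    have r2: "(\<lambda>k. inner (G k s - G k t + (P (G k) t - P (G k) s)) (y - x s))
       \<longlonglongrightarrow> inner (x s - x t + (P x t - P x s)) (y - x s)"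
      by (intro tendsto_intros lim PG sT)
    have r3: "inner (G k s - G k t + (P (G k) t - P (G k) s)) (y - x s)
      \<le> K * W k * (2 * E k + (norm (y - x s) + 2 * E k)\<^sup>2 / (2 * r)) + 2 * (1 + M) * a k * norm (y - x s)" for k
      using discrete_variational_inequality[of "Suc (\<rho> k)" s t y "x s", OF _ st y order_refl]
      by (simp add: G_def F_def W_def E_def a_def del: path.simps(2))
    show "inner (x s - x t + (P x t - P x s)) (y - x s) \<le> K * (\<theta> t - \<theta> s) *
         (2 * ((1 + K) * (\<theta> t - \<theta> s)) + (norm (y - x s) + 2 * ((1 + K) * (\<theta> t - \<theta> s)))\<^sup>2 / (2 * r))"
      using LIMSEQ_le[OF r2 r1] r3 by (simp only: mult_zero_right mult_zero_left add_0_right) blast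
  qed
qed

end

section \<open>Densities of Lipschitz curves\<close>

text \<open>The lower bound 1 on the density makes \<theta> strictly increasing, hence usable as a
  clock, and later turns weighted summability into plain summability.\<close>

locale time_change =
  fixes T :: real and m :: "real \<Rightarrow> real"
  assumes T: "0 < T" and m_int: "integrable (lebesgue_on {0..T}) m"
    and m_ge: "\<And>t. t \<in> {0..T} \<Longrightarrow> 1 \<le> m t"
begin

definition \<theta> :: "real \<Rightarrow> real" where
  "\<theta> t = integral {0..t} m"

lemma m_integrable: "0 \<le> s \<Longrightarrow> t \<le> T \<Longrightarrow> m integrable_on {s..t}"
  by (rule integrable_on_subinterval[OF integrable_on_lebesgue_on[OF m_int]]) auto

lemma integral_m:
  assumes "0 \<le> s" "s \<le> t" "t \<le> T" shows "integral {s..t} m = \<theta> t - \<theta> s"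
  unfolding \<theta>_def by (rule integral_diff_Icc[OF m_integrable[OF order_refl order_refl] assms, symmetric])

lemma \<theta>_0 [simp]: "\<theta> 0 = 0"
  unfolding \<theta>_def by simp

lemma \<theta>_continuous: "continuous_on {0..T} \<theta>"
  unfolding \<theta>_def by (rule indefinite_integral_continuous_1[OF m_integrable[OF order_refl order_refl]])

lemma \<theta>_diff_ge:
  assumes "0 \<le> s" "s \<le> t" "t \<le> T" shows "t - s \<le> \<theta> t - \<theta> s"
proof -
  have "integral {s..t} (\<lambda>_. 1) \<le> integral {s..t} m"
  proof (rule integral_le)
    show "m integrable_on {s..t}" by (rule m_integrable[OF assms(1,3)])
    show "1 \<le> m r" if "r \<in> {s..t}" for r by (rule m_ge) (use that assms in auto)
  qed (rule integrable_const_ivl)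
  then show ?thesis using assms by (simp add: integral_m)
qed

lemma \<theta>_less: "0 \<le> s \<Longrightarrow> s < t \<Longrightarrow> t \<le> T \<Longrightarrow> \<theta> s < \<theta> t"
  using \<theta>_diff_ge[of s t] by simp

lemma \<theta>_le: "0 \<le> s \<Longrightarrow> s \<le> t \<Longrightarrow> t \<le> T \<Longrightarrow> \<theta> s \<le> \<theta> t"
  using \<theta>_diff_ge[of s t] by simp

lemma \<theta>_le_iff: "s \<in> {0..T} \<Longrightarrow> t \<in> {0..T} \<Longrightarrow> \<theta> s \<le> \<theta> t \<longleftrightarrow> s \<le> t"
  using \<theta>_less[of t s] \<theta>_le[of s t] by (cases "s \<le> t") auto

lemma m_times_integrable:
  assumes "u \<in> borel_measurable (lebesgue_on {0..T})" "\<And>t. t \<in> {0..T} \<Longrightarrow> \<bar>u t\<bar> \<le> B"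
  shows "integrable (lebesgue_on {0..T}) (\<lambda>t. m t * u t)"
proof (rule Bochner_Integration.integrable_bound)
  show "integrable (lebesgue_on {0..T}) (\<lambda>t. B * m t)" by (rule Bochner_Integration.integrable_mult_right[OF m_int])
  show "AE t in lebesgue_on {0..T}. norm (m t * u t) \<le> norm (B * m t)"
  proof (rule AE_I2)
    fix t assume "t \<in> space (lebesgue_on {0..T})"
    then have t: "t \<in> {0..T}" by simp
    have "\<bar>m t\<bar> * \<bar>u t\<bar> \<le> \<bar>m t\<bar> * \<bar>B\<bar>" using assms(2)[OF t] by (intro mult_left_mono) auto
    then show "norm (m t * u t) \<le> norm (B * m t)" by (simp add: abs_mult mult.commute)
  qed
  show "(\<lambda>t. m t * u t) \<in> borel_measurable (lebesgue_on {0..T})"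
    using assms(1) m_int by (intro borel_measurable_times) auto
qed

end

locale time_change_Lipschitz = time_change +
  fixes z :: "real \<Rightarrow> 'a::{real_inner, banach}" and K :: real
  assumes K: "0 \<le> K"
    and z: "\<And>s t. s \<in> {0..T} \<Longrightarrow> t \<in> {0..T} \<Longrightarrow> norm (z t - z s) \<le> K * \<bar>\<theta> t - \<theta> s\<bar>"
begin

section \<open>Dyadic cells of the clock and difference quotients\<close>

definition cell :: "nat \<Rightarrow> real" where
  "cell n = \<theta> T / 2 ^ n"

definition \<tau> :: "nat \<Rightarrow> nat \<Rightarrow> real" where
  "\<tau> n i = (SOME t. t \<in> {0..T} \<and> \<theta> t = real i * cell n)"

text \<open>On \<open>{0..T}\<close> the default 0 occurs only at \<open>t = T\<close>, where the
  cell index is \<open>2 ^ n\<close>.\<close>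

definition slope :: "nat \<Rightarrow> nat \<Rightarrow> 'a" where
  "slope n i = (if i < 2 ^ n then (1 / cell n) *\<^sub>R (z (\<tau> n (Suc i)) - z (\<tau> n i)) else 0)"

definition idx :: "nat \<Rightarrow> real \<Rightarrow> nat" where
  "idx n t = nat \<lfloor>\<theta> t / cell n\<rfloor>"

text \<open>The conditional expectation of the density of \<open>z\<close> with respect to \<theta>,
  given the cells of level \<open>n\<close>.\<close>

definition sl :: "nat \<Rightarrow> real \<Rightarrow> 'a" where
  "sl n t = slope n (idx n t)"

lemma cell_pos: "0 < cell n"
  using \<theta>_less[of 0 T] T by (simp add: cell_def)

lemma cell_tendsto: "cell \<longlonglongrightarrow> 0"
  unfolding cell_def[abs_def] using LIMSEQ_divide_realpow_zero[of 2 "\<theta> T"] by simp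

lemma \<tau>:
  assumes "i \<le> 2 ^ n" shows "\<tau> n i \<in> {0..T}" "\<theta> (\<tau> n i) = real i * cell n"
proof -
  have "real i * cell n \<le> 2 ^ n * cell n"
  proof (rule mult_right_mono)
    have "real i \<le> real (2 ^ n)" using assms by (simp only: of_nat_le_iff)
    then show "real i \<le> 2 ^ n" by simp
  qed (use cell_pos[of n] in simp)
  also have "\<dots> = \<theta> T" by (simp add: cell_def)
  finally have "\<exists>t. 0 \<le> t \<and> t \<le> T \<and> \<theta> t = real i * cell n"
    using cell_pos[of n] T by (intro IVT') (auto simp: \<theta>_continuous)
  then have "\<exists>t. t \<in> {0..T} \<and> \<theta> t = real i * cell n" by auto
  from someI_ex[OF this] show "\<tau> n i \<in> {0..T}" "\<theta> (\<tau> n i) = real i * cell n"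
    by (auto simp: \<tau>_def)
qed

lemma \<tau>_eqI: "i \<le> 2 ^ n \<Longrightarrow> t \<in> {0..T} \<Longrightarrow> \<theta> t = real i * cell n \<Longrightarrow> \<tau> n i = t"
  using \<tau>[of i n] \<theta>_le_iff[of t "\<tau> n i"] \<theta>_le_iff[of "\<tau> n i" t] by auto

lemma \<tau>_0: "\<tau> n 0 = 0"
  by (rule \<tau>_eqI) (use T in auto)

lemma \<tau>_last: "\<tau> n (2 ^ n) = T"
  by (rule \<tau>_eqI) (use T in \<open>auto simp: cell_def\<close>)

lemma \<tau>_le: "i \<le> j \<Longrightarrow> j \<le> 2 ^ n \<Longrightarrow> \<tau> n i \<le> \<tau> n j"
  using \<theta>_le_iff[OF \<tau>(1) \<tau>(1), of i n j n] \<tau>(2)[of i n] \<tau>(2)[of j n] cell_pos[of n] by simp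

lemma \<tau>_refine: "n \<le> N \<Longrightarrow> i \<le> 2 ^ n \<Longrightarrow> \<tau> N (i * 2 ^ (N - n)) = \<tau> n i"
proof (rule \<tau>_eqI)
  assume n: "n \<le> N" and i: "i \<le> 2 ^ n"
  have 2: "(2::nat) ^ N = 2 ^ n * 2 ^ (N - n)" "(2::real) ^ N = 2 ^ n * 2 ^ (N - n)"
    using n by (simp_all flip: power_add)
  show "i * 2 ^ (N - n) \<le> 2 ^ N" using i 2(1) by simp
  show "\<tau> n i \<in> {0..T}" by (rule \<tau>(1)[OF i])
  show "\<theta> (\<tau> n i) = real (i * 2 ^ (N - n)) * cell N"
    unfolding \<tau>(2)[OF i] by (simp add: cell_def 2(2))
qed

lemma idx_bounds:
  assumes t: "t \<in> {0..T}"
  shows "real (idx n t) * cell n \<le> \<theta> t" "\<theta> t < (real (idx n t) + 1) * cell n" "idx n t \<le> 2 ^ n"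
proof -
  have "0 \<le> \<theta> t" using \<theta>_le[of 0 t] t by simp
  then have "real (idx n t) = of_int \<lfloor>\<theta> t / cell n\<rfloor>" using cell_pos[of n] by (simp add: idx_def)
  then have "real (idx n t) \<le> \<theta> t / cell n" "\<theta> t / cell n < real (idx n t) + 1"
    using floor_correct[of "\<theta> t / cell n"] by auto
  then show j: "real (idx n t) * cell n \<le> \<theta> t" "\<theta> t < (real (idx n t) + 1) * cell n"
    using cell_pos[of n] by (simp_all only: pos_le_divide_eq pos_divide_less_eq)
  have "\<theta> t \<le> \<theta> T" using \<theta>_le[of t T] t by simp
  also have "\<dots> = 2 ^ n * cell n" by (simp add: cell_def)
  finally have "real (idx n t) * cell n \<le> real (2 ^ n) * cell n" using j(1) by simp
  then show "idx n t \<le> 2 ^ n" using cell_pos[of n] by (simp only: mult_le_cancel_right_pos of_nat_le_iff)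
qed

lemma sl_cell:
  assumes i: "i < 2 ^ n" and t: "\<tau> n i \<le> t" "t < \<tau> n (Suc i)"
  shows "sl n t = slope n i"
proof -
  have tT: "t \<in> {0..T}" using \<tau>(1)[of i n] \<tau>(1)[of "Suc i" n] i t by auto
  have "real i * cell n \<le> \<theta> t"
    using \<theta>_le_iff[OF \<tau>(1) tT, of i n] \<tau>(2)[of i n] i t by simp
  moreover have "\<theta> t < (real i + 1) * cell n"
    using \<theta>_less[of t "\<tau> n (Suc i)"] \<tau>[of "Suc i" n] i t tT by (simp add: algebra_simps)
  ultimately have "real i * cell n < (real (idx n t) + 1) * cell n" "real (idx n t) * cell n < (real i + 1) * cell n"
    using idx_bounds(1,2)[OF tT, of n] by linarith+
  then have "real i < real (idx n t) + 1" "real (idx n t) < real i + 1"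
    using cell_pos[of n] by (simp_all only: mult_less_cancel_right_pos)
  then have "idx n t = i" by linarith
  then show ?thesis by (simp add: sl_def)
qed

lemma slope_bound: "norm (slope n i) \<le> K"
proof (cases "i < 2 ^ n")
  case True
  then have "norm (z (\<tau> n (Suc i)) - z (\<tau> n i)) \<le> K * cell n"
    using z[OF \<tau>(1) \<tau>(1), of i n "Suc i" n] \<tau>(2)[of i n] \<tau>(2)[of "Suc i" n] cell_pos[of n] by (simp add: algebra_simps)
  moreover have "norm (slope n i) = norm (z (\<tau> n (Suc i)) - z (\<tau> n i)) / cell n"
    using True cell_pos[of n] by (simp only: slope_def if_True norm_scaleR) simp
  ultimately show ?thesis using cell_pos[of n] by (simp only: pos_divide_le_eq)
qed (simp add: slope_def K)

lemma sl_bound: "norm (sl n t) \<le> K"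
  by (simp add: sl_def slope_bound)

lemma sl_simple: "simple_function (lebesgue_on {0..T}) (sl n)"
proof -
  have "simple_function (lebesgue_on {0..T}) (idx n)"
    unfolding simple_function_eq_measurable
  proof
    have "idx n ` space (lebesgue_on {0..T}) \<subseteq> {..2 ^ n}" using idx_bounds(3) by auto
    then show "finite (idx n ` space (lebesgue_on {0..T}))" by (rule finite_subset) simp
    have "\<theta> \<in> borel_measurable (lebesgue_on {0..T})"
      by (rule continuous_imp_measurable_on_sets_lebesgue[OF \<theta>_continuous]) simp
    then have [measurable]: "(\<lambda>t. \<theta> t / cell n) \<in> borel_measurable (lebesgue_on {0..T})" by measurable
    show "idx n \<in> lebesgue_on {0..T} \<rightarrow>\<^sub>M count_space UNIV"
      unfolding idx_def[abs_def] by measurable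
  qed
  then show ?thesis unfolding sl_def[abs_def] by (rule simple_function_compose1)
qed

lemma sl_measurable: "separably_measurable (lebesgue_on {0..T}) (sl n)"
  by (rule separably_measurable_simple_function[OF sl_simple])

lemma inner_sl_sl_integrable:
  assumes "0 \<le> s" "t \<le> T"
  shows "(\<lambda>t. m t * (sl n t \<bullet> sl k t)) integrable_on {s..t}"
proof -
  have "simple_function (lebesgue_on {0..T}) (\<lambda>t. sl n t \<bullet> sl k t)"
    by (rule simple_function_compose2[OF sl_simple sl_simple])
  then have "integrable (lebesgue_on {0..T}) (\<lambda>t. m t * (sl n t \<bullet> sl k t))"
  proof (intro m_times_integrable[of _ "K * K"] borel_measurable_simple_function)
    show "\<bar>sl n t \<bullet> sl k t\<bar> \<le> K * K" for t
      using Cauchy_Schwarz_ineq2[of "sl n t" "sl k t"] mult_mono[OF sl_bound[of n t] sl_bound[of k t]] K by auto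
  qed
  from integrable_on_lebesgue_on[OF this] show ?thesis
    by (rule integrable_on_subinterval) (use assms in auto)
qed

lemma inner_sl_integrable:
  assumes "0 \<le> s" "t \<le> T"
  shows "(\<lambda>t. m t * (sl n t \<bullet> e)) integrable_on {s..t}"
proof -
  have "simple_function (lebesgue_on {0..T}) (\<lambda>t. sl n t \<bullet> e)"
    by (rule simple_function_compose1[OF sl_simple])
  then have "integrable (lebesgue_on {0..T}) (\<lambda>t. m t * (sl n t \<bullet> e))"
  proof (intro m_times_integrable[of _ "K * norm e"] borel_measurable_simple_function)
    show "\<bar>sl n t \<bullet> e\<bar> \<le> K * norm e" for t
      using Cauchy_Schwarz_ineq2[of "sl n t" "e"] mult_right_mono[OF sl_bound[of n t], of "norm e"] by auto
  qed
  from integrable_on_lebesgue_on[OF this] show ?thesis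
    by (rule integrable_on_subinterval) (use assms in auto)
qed

lemma integral_cell:
  assumes i: "i < 2 ^ n" and eq: "\<And>t. \<tau> n i \<le> t \<Longrightarrow> t < \<tau> n (Suc i) \<Longrightarrow> u t = m t * c"
  shows "integral {\<tau> n i..\<tau> n (Suc i)} u = cell n * c"
proof -
  have "integral {\<tau> n i..\<tau> n (Suc i)} u = integral {\<tau> n i..\<tau> n (Suc i)} (\<lambda>t. m t * c)"
    by (rule integral_spike[of "{\<tau> n (Suc i)}"]) (use eq in auto)
  also have "\<dots> = (\<theta> (\<tau> n (Suc i)) - \<theta> (\<tau> n i)) * c"
    using integral_m[of "\<tau> n i" "\<tau> n (Suc i)"] \<tau>(1)[of i n] \<tau>(1)[of "Suc i" n] \<tau>_le[of i "Suc i" n] i by simp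
  also have "\<dots> = cell n * c"
    using i by (simp add: \<tau>(2) algebra_simps)
  finally show ?thesis .
qed

lemma integral_Suc:
  assumes u: "u integrable_on {0..T}" and i: "i < 2 ^ n"
  shows "integral {0..\<tau> n (Suc i)} u = integral {0..\<tau> n i} u + integral {\<tau> n i..\<tau> n (Suc i)} (u :: real \<Rightarrow> real)"
  using integral_diff_Icc[OF u, of "\<tau> n i" "\<tau> n (Suc i)"] \<tau>(1)[of i n] \<tau>(1)[of "Suc i" n] \<tau>_le[of i "Suc i" n] i by simp

lemma integral_sl_inner:
  assumes "i \<le> 2 ^ n"
  shows "integral {0..\<tau> n i} (\<lambda>t. m t * (sl n t \<bullet> e)) = (z (\<tau> n i) - z 0) \<bullet> e"
  using assms
proof (induction i)
  case 0 then show ?case by (simp add: \<tau>_0)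
next
  case (Suc i)
  then have i: "i < 2 ^ n" by simp
  have "integral {\<tau> n i..\<tau> n (Suc i)} (\<lambda>t. m t * (sl n t \<bullet> e)) = cell n * (slope n i \<bullet> e)"
    by (rule integral_cell[OF i]) (simp add: sl_cell[OF i])
  also have "\<dots> = (z (\<tau> n (Suc i)) - z (\<tau> n i)) \<bullet> e"
    using i cell_pos[of n] by (simp add: slope_def)
  finally show ?case
    using Suc integral_Suc[OF inner_sl_integrable i] by (simp add: inner_diff_left)
qed

text \<open>The martingale property: on a coarse cell the finer slopes telescope to the increment of
  \<open>z\<close>, whatever the finer level is.\<close>

lemma integral_sl_inner_refine:
  assumes "n \<le> N" "i < 2 ^ n"
  shows "integral {\<tau> n i..\<tau> n (Suc i)} (\<lambda>t. m t * (sl N t \<bullet> e)) = (z (\<tau> n (Suc i)) - z (\<tau> n i)) \<bullet> e"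
proof -
  have *: "integral {0..\<tau> n k} (\<lambda>t. m t * (sl N t \<bullet> e)) = (z (\<tau> n k) - z 0) \<bullet> e" if "k \<le> 2 ^ n" for k
  proof -
    have "k * 2 ^ (N - n) \<le> 2 ^ n * 2 ^ (N - n)" using that by simp
    also have "\<dots> = (2::nat) ^ N" using assms(1) by (simp flip: power_add)
    finally show ?thesis
      using integral_sl_inner[of "k * 2 ^ (N - n)" N e] \<tau>_refine[OF assms(1) that] by simp
  qed
  show ?thesis
    using integral_Suc[OF inner_sl_integrable assms(2), of N e] *[of i] *[of "Suc i"] assms(2)
    by (simp add: inner_diff_left)
qed

text \<open>Averages over the cells of level \<open>n\<close> form a martingale in \<open>L\<^sup>2(m dt)\<close>: the increments are
  orthogonal to the past.\<close>

lemma sl_orthogonal: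
  assumes "n \<le> N"
  shows "integral {0..T} (\<lambda>t. m t * (sl N t \<bullet> sl n t)) = integral {0..T} (\<lambda>t. m t * (sl n t \<bullet> sl n t))"
proof -
  have "integral {0..\<tau> n i} (\<lambda>t. m t * (sl N t \<bullet> sl n t)) = integral {0..\<tau> n i} (\<lambda>t. m t * (sl n t \<bullet> sl n t))"
    if "i \<le> 2 ^ n" for i
    using that
  proof (induction i)
    case 0 then show ?case by (simp add: \<tau>_0)
  next
    case (Suc i)
    then have i: "i < 2 ^ n" by simp
    have "integral {\<tau> n i..\<tau> n (Suc i)} (\<lambda>t. m t * (sl N t \<bullet> sl n t)) = integral {\<tau> n i..\<tau> n (Suc i)} (\<lambda>t. m t * (sl N t \<bullet> slope n i))"
      by (rule integral_spike[of "{\<tau> n (Suc i)}"]) (auto simp: sl_cell[OF i])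
    also have "\<dots> = (z (\<tau> n (Suc i)) - z (\<tau> n i)) \<bullet> slope n i"
      by (rule integral_sl_inner_refine[OF assms i])
    also have "\<dots> = cell n * (slope n i \<bullet> slope n i)"
      using i cell_pos[of n] by (simp add: slope_def)
    also have "\<dots> = integral {\<tau> n i..\<tau> n (Suc i)} (\<lambda>t. m t * (sl n t \<bullet> sl n t))"
      by (rule integral_cell[OF i, symmetric]) (simp add: sl_cell[OF i])
    finally show ?case
      using Suc integral_Suc[OF inner_sl_sl_integrable i] by simp
  qed
  from this[of "2 ^ n"] show ?thesis by (simp add: \<tau>_last)
qed

section \<open>Mean square convergence of the slopes\<close>

definition energy :: "nat \<Rightarrow> real" where
  "energy n = integral {0..T} (\<lambda>t. m t * (sl n t \<bullet> sl n t))"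

text \<open>Pythagoras for the orthogonal decomposition of the finer slopes. Since the energies
  increase and stay bounded, the slopes are Cauchy in mean square.\<close>

lemma energy_diff:
  assumes "n \<le> N"
  shows "((\<lambda>t. m t * (norm (sl N t - sl n t))\<^sup>2) has_integral (energy N - energy n)) {0..T}"
proof -
  have 1: "((\<lambda>t. m t * (sl k t \<bullet> sl k t)) has_integral energy k) {0..T}" for k
    unfolding energy_def by (rule integrable_integral[OF inner_sl_sl_integrable[OF order_refl order_refl]])
  have 2: "((\<lambda>t. m t * (sl N t \<bullet> sl n t)) has_integral energy n) {0..T}"
    unfolding energy_def sl_orthogonal[OF assms, symmetric]
    by (rule integrable_integral[OF inner_sl_sl_integrable[OF order_refl order_refl]])
  have "((\<lambda>t. m t * (sl N t \<bullet> sl N t) - 2 * (m t * (sl N t \<bullet> sl n t)) + m t * (sl n t \<bullet> sl n t))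
      has_integral (energy N - 2 * energy n + energy n)) {0..T}"
    by (rule has_integral_add[OF has_integral_diff[OF 1 has_integral_mult_right[OF 2]] 1])
  moreover have "m t * (sl N t \<bullet> sl N t) - 2 * (m t * (sl N t \<bullet> sl n t)) + m t * (sl n t \<bullet> sl n t)
      = m t * (norm (sl N t - sl n t))\<^sup>2" for t
    unfolding power2_norm_eq_inner
    by (simp add: inner_diff_left inner_diff_right inner_commute algebra_simps)
  ultimately show ?thesis by simp
qed

lemma m_nonneg: "t \<in> {0..T} \<Longrightarrow> 0 \<le> m t"
  using m_ge[of t] by simp

lemma energy_mono:
  assumes "n \<le> N" shows "energy n \<le> energy N"
proof -
  have "0 \<le> energy N - energy n"
    by (rule has_integral_nonneg[OF energy_diff[OF assms]]) (simp add: m_nonneg)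
  then show ?thesis by simp
qed

lemma energy_le: "energy n \<le> K\<^sup>2 * \<theta> T"
proof -
  have "energy n \<le> integral {0..T} (\<lambda>t. m t * K\<^sup>2)"
    unfolding energy_def
  proof (rule integral_le)
    show "m t * (sl n t \<bullet> sl n t) \<le> m t * K\<^sup>2" if "t \<in> {0..T}" for t
    proof -
    from that have "0 \<le> m t" by (rule m_nonneg)
    then show ?thesis
      using power_mono[OF sl_bound[of n t], of 2] by (intro mult_left_mono) (auto simp: power2_norm_eq_inner)
    qed
    show "(\<lambda>t. m t * (sl n t \<bullet> sl n t)) integrable_on {0..T}"
      by (rule inner_sl_sl_integrable[OF order_refl order_refl])
    show "(\<lambda>t. m t * K\<^sup>2) integrable_on {0..T}"
      by (rule integrable_on_mult_left[OF m_integrable[OF order_refl order_refl]])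
  qed
  then show ?thesis by (simp add: \<theta>_def mult.commute)
qed

lemma energy_convergent: obtains E where "\<And>n. energy n \<le> E" "energy \<longlonglongrightarrow> E"
proof -
  have "incseq energy" unfolding incseq_def using energy_mono by blast
  then obtain E where "energy \<longlonglongrightarrow> E" "\<forall>n. energy n \<le> E"
    by (rule incseq_convergent[of energy "K\<^sup>2 * \<theta> T"]) (auto simp: energy_le)
  then show ?thesis using that by blast
qed

lemma fast_subsequence:
  obtains r :: "nat \<Rightarrow> nat" where "mono r" "filterlim r sequentially sequentially"
    "\<And>j. energy (r (Suc j)) - energy (r j) \<le> (1 / 4) ^ j"
proof -
  obtain E where E: "\<And>n. energy n \<le> E" "energy \<longlonglongrightarrow> E" by (rule energy_convergent) blast
  have "\<exists>N. \<forall>n\<ge>N. E - energy n \<le> (1 / 4) ^ j" for j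
  proof -
    have "\<forall>\<^sub>F n in sequentially. E - (1 / 4) ^ j < energy n"
      by (rule order_tendstoD(1)[OF E(2)]) simp
    then obtain N where "\<And>n. N \<le> n \<Longrightarrow> E - (1 / 4) ^ j < energy n"
      unfolding eventually_sequentially by blast
    then show ?thesis by (intro exI[of _ N]) (auto simp: algebra_simps less_imp_le)
  qed
  then obtain N where N: "\<And>j n. N j \<le> n \<Longrightarrow> E - energy n \<le> (1 / 4) ^ j" by metis
  \<comment> \<open>The partial sums make \<open>r\<close> monotone and at least \<open>N j\<close>;
    the summand \<open>j\<close> forces it to infinity.\<close>
  define r where "r j = (\<Sum>i\<le>j. N i) + j" for j
  have rS: "r (Suc j) = r j + N (Suc j) + 1" for j by (simp add: r_def)
  show ?thesis
  proof
    show "mono r" unfolding mono_iff_le_Suc rS by simp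
    show "filterlim r sequentially sequentially"
      by (rule filterlim_at_top_mono[OF filterlim_ident]) (auto simp: r_def)
    show "energy (r (Suc j)) - energy (r j) \<le> (1 / 4) ^ j" for j
    proof -
      have "N j \<le> (\<Sum>i\<le>j. N i)" by (rule member_le_sum) auto
      then have "N j \<le> r j" by (simp add: r_def)
      from N[OF this] E(1)[of "r (Suc j)"] show ?thesis by linarith
    qed
  qed
qed

text \<open>The fast energy decay makes the integrals of the weighted increments summable, so almost
  everywhere the increments themselves are absolutely summable.\<close>

lemma AE_convergent_subsequence:
  fixes r :: "nat \<Rightarrow> nat"
  assumes r: "mono r" "\<And>j. energy (r (Suc j)) - energy (r j) \<le> (1 / 4) ^ j"
  shows "AE t in lebesgue_on {0..T}. convergent (\<lambda>j. sl (r j) t)"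
proof -
  let ?L = "lebesgue_on {0..T}"
  define d where "d j t = norm (sl (r (Suc j)) t - sl (r j) t)" for j t
  have dm [measurable]: "d j \<in> borel_measurable ?L" for j
    unfolding d_def[abs_def]
    by (rule borel_measurable_simple_function[OF simple_function_compose2[OF sl_simple sl_simple]])
  have mm [measurable]: "m \<in> borel_measurable ?L"
    using m_int by (rule borel_measurable_integrable)
  have bound: "(\<integral>\<^sup>+ t. ennreal (m t * d j t) \<partial>?L) \<le> ennreal ((\<theta> T + 1) * (1 / 2) ^ j)" for j
  proof -
    have d2: "((\<lambda>t. m t * (d j t)\<^sup>2) has_integral (energy (r (Suc j)) - energy (r j))) {0..T}"
      unfolding d_def by (rule energy_diff) (use r(1) in \<open>simp add: mono_def\<close>)
    have int: "((\<lambda>t. (1 / 2) ^ j * m t + 2 ^ j * (m t * (d j t)\<^sup>2)) has_integral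
         ((1 / 2) ^ j * \<theta> T + 2 ^ j * (energy (r (Suc j)) - energy (r j)))) {0..T}"
      unfolding \<theta>_def
      by (rule has_integral_add[OF has_integral_mult_right[OF integrable_integral[OF m_integrable[OF order_refl order_refl]]]
            has_integral_mult_right[OF d2]])
    have le: "m t * d j t \<le> (1 / 2) ^ j * m t + 2 ^ j * (m t * (d j t)\<^sup>2)" if "t \<in> {0..T}" for t
    proof -
      have pw: "(2::real) ^ j * (1 / 2) ^ j = 1" by (simp flip: power_mult_distrib)
      \<comment> \<open>A weighted arithmetic-geometric inequality in place of Hoelder: the weights
        \<open>(1 / 2) ^ j\<close> and \<open>2 ^ j\<close> turn the energy decay
        \<open>(1 / 4) ^ j\<close> into integrals of order \<open>(1 / 2) ^ j\<close>.\<close>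
      have "0 \<le> (1 / 2) ^ j * (1 - 2 ^ j * d j t)\<^sup>2 + d j t" by (simp add: d_def)
      also have "\<dots> = (1 / 2) ^ j - 2 * (2 ^ j * (1 / 2) ^ j) * d j t + 2 ^ j * (2 ^ j * (1 / 2) ^ j) * (d j t)\<^sup>2 + d j t"
        by (simp add: power2_eq_square algebra_simps)
      also have "\<dots> = (1 / 2) ^ j + 2 ^ j * (d j t)\<^sup>2 - d j t"
        by (simp add: pw)
      finally have "m t * d j t \<le> m t * ((1 / 2) ^ j + 2 ^ j * (d j t)\<^sup>2)"
        using m_nonneg[OF that] by (intro mult_left_mono) auto
      then show ?thesis by (simp add: algebra_simps)
    qed
    have "(\<integral>\<^sup>+ t. ennreal (m t * d j t) \<partial>?L) \<le> (\<integral>\<^sup>+ t. ennreal ((1 / 2) ^ j * m t + 2 ^ j * (m t * (d j t)\<^sup>2)) \<partial>?L)"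
      using le by (intro nn_integral_mono ennreal_leI) simp
    also have "\<dots> = ennreal ((1 / 2) ^ j * \<theta> T + 2 ^ j * (energy (r (Suc j)) - energy (r j)))"
    proof -
      have "d j t \<le> 2 * K" for t
        using norm_triangle_ineq4[of "sl (r (Suc j)) t" "sl (r j) t"] sl_bound[of "r (Suc j)" t] sl_bound[of "r j" t]
        by (simp add: d_def)
      then have "(d j t)\<^sup>2 \<le> (2 * K)\<^sup>2" for t by (intro power_mono) (auto simp: d_def)
      then have "integrable ?L (\<lambda>t. m t * (d j t)\<^sup>2)"
        by (intro m_times_integrable[of _ "(2 * K)\<^sup>2"]) auto
      then have int': "integrable ?L (\<lambda>t. (1 / 2) ^ j * m t + 2 ^ j * (m t * (d j t)\<^sup>2))"
        by (intro Bochner_Integration.integrable_add Bochner_Integration.integrable_mult_right m_int)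
      have "(\<integral>\<^sup>+ t. ennreal ((1 / 2) ^ j * m t + 2 ^ j * (m t * (d j t)\<^sup>2)) \<partial>?L)
          = ennreal (\<integral>t. (1 / 2) ^ j * m t + 2 ^ j * (m t * (d j t)\<^sup>2) \<partial>?L)"
        by (rule nn_integral_eq_integral[OF int']) (auto intro!: AE_I2 simp: m_nonneg)
      also have "\<dots> = ennreal (integral {0..T} (\<lambda>t. (1 / 2) ^ j * m t + 2 ^ j * (m t * (d j t)\<^sup>2)))"
        by (subst lebesgue_integral_eq_integral[OF int']) auto
      finally show ?thesis by (simp only: integral_unique[OF int])
    qed
    also have "\<dots> \<le> ennreal ((\<theta> T + 1) * (1 / 2) ^ j)"
    proof (rule ennreal_leI)
      have "2 ^ j * (energy (r (Suc j)) - energy (r j)) \<le> 2 ^ j * (1 / 4) ^ j"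
        by (rule mult_left_mono[OF r(2)]) simp
      also have "\<dots> = (1 / 2) ^ j" by (simp flip: power_mult_distrib)
      finally show "(1 / 2) ^ j * \<theta> T + 2 ^ j * (energy (r (Suc j)) - energy (r j)) \<le> (\<theta> T + 1) * (1 / 2) ^ j"
        by (simp add: algebra_simps)
    qed
    finally show ?thesis .
  qed
  have "(\<integral>\<^sup>+ t. (\<Sum>j. ennreal (m t * d j t)) \<partial>?L) = (\<Sum>j. \<integral>\<^sup>+ t. ennreal (m t * d j t) \<partial>?L)"
    by (rule nn_integral_suminf) measurable
  also have "\<dots> \<le> (\<Sum>j. ennreal ((\<theta> T + 1) * (1 / 2) ^ j))"
    by (rule suminf_le[OF bound]) auto
  also have "\<dots> = ennreal (\<Sum>j. (\<theta> T + 1) * (1 / 2) ^ j)"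
    using \<theta>_le[of 0 T] T by (intro suminf_ennreal2 summable_mult summable_geometric) auto
  finally have "(\<integral>\<^sup>+ t. (\<Sum>j. ennreal (m t * d j t)) \<partial>?L) \<noteq> \<infinity>"
    by (auto simp: top_unique)
  then have "AE t in ?L. (\<Sum>j. ennreal (m t * d j t)) \<noteq> \<infinity>"
    by (rule nn_integral_PInf_AE[rotated]) measurable
  then show ?thesis
    using AE_space
  proof eventually_elim
    case (elim t)
    then have t: "t \<in> {0..T}" by simp
    have "summable (\<lambda>j. m t * d j t)"
      using elim(1) m_nonneg[OF t] by (intro summable_suminf_not_top) (auto simp: d_def)
    \<comment> \<open>The weight is removed by \<open>1 \<le> m t\<close>.\<close>
    then have "summable (\<lambda>j. d j t)"
    proof (rule summable_comparison_test'[of _ 0])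
      fix j show "norm (d j t) \<le> m t * d j t"
        using mult_right_mono[OF m_ge[OF t], of "d j t"] by (simp add: d_def)
    qed
    then have "summable (\<lambda>j. sl (r (Suc j)) t - sl (r j) t)"
      unfolding d_def by (rule summable_norm_cancel)
    then have "(\<lambda>n. \<Sum>j<n. sl (r (Suc j)) t - sl (r j) t) \<longlonglongrightarrow> (\<Sum>j. sl (r (Suc j)) t - sl (r j) t)"
      by (rule summable_LIMSEQ)
    moreover have "(\<Sum>j<n. sl (r (Suc j)) t - sl (r j) t) = sl (r n) t - sl (r 0) t" for n
      by (rule sum_lessThan_telescope[of "\<lambda>j. sl (r j) t"])
    ultimately have "(\<lambda>n. sl (r n) t - sl (r 0) t) \<longlonglongrightarrow> (\<Sum>j. sl (r (Suc j)) t - sl (r j) t)"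
      by simp
    from tendsto_add[OF this tendsto_const[of "sl (r 0) t"]] show ?case
      by (auto simp: convergent_def)
  qed
qed

text \<open>At the endpoints of cells the integral reproduces the increment of \<open>z\<close>
  exactly. The remaining piece lies in one cell and costs at most \<open>K * norm e * cell n\<close>
  in the integral and as much in \<open>z\<close>.\<close>

lemma integral_sl_inner_tendsto:
  assumes t: "t \<in> {0..T}"
  shows "(\<lambda>n. integral {0..t} (\<lambda>s. m s * (sl n s \<bullet> e))) \<longlonglongrightarrow> (z t - z 0) \<bullet> e"
proof -
  have bound: "norm (integral {0..t} (\<lambda>s. m s * (sl n s \<bullet> e)) - (z t - z 0) \<bullet> e) \<le> 2 * (K * norm e) * cell n" for n
  proof -
    let ?i = "idx n t" and ?u = "\<lambda>s. m s * (sl n s \<bullet> e)"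
    note i = idx_bounds[OF t, of n]
    have \<tau>T: "\<tau> n ?i \<in> {0..T}" "\<theta> (\<tau> n ?i) = real ?i * cell n" using \<tau>[OF i(3)] by auto
    have le: "\<tau> n ?i \<le> t" using \<theta>_le_iff[OF \<tau>T(1) t] \<tau>T(2) i(1) by simp
    have d: "\<theta> t - \<theta> (\<tau> n ?i) \<le> cell n" using i(2) \<tau>T(2) by (simp add: algebra_simps)
    have "integral {0..t} ?u - (z t - z 0) \<bullet> e = integral {\<tau> n ?i..t} ?u - (z t - z (\<tau> n ?i)) \<bullet> e"
      using integral_diff_Icc[OF inner_sl_integrable[OF order_refl order_refl, of n e], of "\<tau> n ?i" t] \<tau>T(1) t le
        integral_sl_inner[OF i(3), of e] by (simp add: inner_diff_left)
    moreover have "\<bar>integral {\<tau> n ?i..t} ?u\<bar> \<le> (K * norm e) * cell n"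
    proof -
      have "norm (integral {\<tau> n ?i..t} ?u) \<le> integral {\<tau> n ?i..t} (\<lambda>s. m s * (K * norm e))"
      proof (rule integral_norm_bound_integral)
        show "?u integrable_on {\<tau> n ?i..t}" by (rule inner_sl_integrable) (use \<tau>T t in auto)
        show "(\<lambda>s. m s * (K * norm e)) integrable_on {\<tau> n ?i..t}"
          by (rule integrable_on_mult_left[OF m_integrable]) (use \<tau>T t in auto)
        fix s assume "s \<in> {\<tau> n ?i..t}"
        then have "0 \<le> m s" by (intro m_nonneg) (use \<tau>T t in auto)
        moreover have "\<bar>sl n s \<bullet> e\<bar> \<le> K * norm e"
          using Cauchy_Schwarz_ineq2[of "sl n s" e] mult_right_mono[OF sl_bound[of n s], of "norm e"] by simp
        ultimately show "norm (?u s) \<le> m s * (K * norm e)" by (simp add: abs_mult mult_left_mono)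
      qed
      also have "\<dots> = (K * norm e) * (\<theta> t - \<theta> (\<tau> n ?i))"
        using integral_m[OF _ le] \<tau>T t by simp
      also have "\<dots> \<le> (K * norm e) * cell n" using d K by (intro mult_left_mono) auto
      finally show ?thesis by simp
    qed
    moreover have "\<bar>(z t - z (\<tau> n ?i)) \<bullet> e\<bar> \<le> (K * norm e) * cell n"
    proof -
      have "\<bar>(z t - z (\<tau> n ?i)) \<bullet> e\<bar> \<le> norm (z t - z (\<tau> n ?i)) * norm e" by (rule Cauchy_Schwarz_ineq2)
      also have "\<dots> \<le> (K * cell n) * norm e"
      proof (rule mult_right_mono)
        have "\<bar>\<theta> t - \<theta> (\<tau> n ?i)\<bar> \<le> cell n" using d \<theta>_le[OF _ le] \<tau>T t by simp
        then show "norm (z t - z (\<tau> n ?i)) \<le> K * cell n"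
          using z[OF \<tau>T(1) t] mult_left_mono[OF _ K] by (meson order_trans)
      qed simp
      finally show ?thesis by (simp add: mult_ac)
    qed
    ultimately show ?thesis by simp
  qed
  have "(\<lambda>n. 2 * (K * norm e) * cell n) \<longlonglongrightarrow> 0"
    using tendsto_mult[OF tendsto_const cell_tendsto, of "2 * (K * norm e)"] by simp
  then have "(\<lambda>n. integral {0..t} (\<lambda>s. m s * (sl n s \<bullet> e)) - (z t - z 0) \<bullet> e) \<longlonglongrightarrow> 0"
    by (rule Lim_null_comparison[OF always_eventually, rotated]) (use bound in blast)
  then show ?thesis by (rule LIM_zero_cancel)
qed

text \<open>Almost everywhere convergence along a subsequence gives the candidate. It is identified
  by testing with each \<open>e\<close>, where the uniform bound \<open>K\<close> on the slopes
  permits dominated convergence.\<close>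

theorem density:
  obtains h where "bochner_dominated T h (\<lambda>t. K * m t)"
    "\<And>t. t \<in> {0..T} \<Longrightarrow> z t = z 0 + bochner_integral (lebesgue_on {0..t}) h"
proof -
  obtain r :: "nat \<Rightarrow> nat" where r: "mono r" "filterlim r sequentially sequentially"
    "\<And>j. energy (r (Suc j)) - energy (r j) \<le> (1 / 4) ^ j" by (rule fast_subsequence) blast
  let ?L = "lebesgue_on {0..T}"
  \<comment> \<open>\<open>lim\<close> is unspecified where the slopes diverge, which happens only
    on a null set. \<open>p\<close> is the density with respect to \<theta>, and the factor
    \<open>m\<close> converts it to Lebesgue measure.\<close>
  define p where "p t = lim (\<lambda>j. sl (r j) t)" for t
  define h where "h t = m t *\<^sub>R p t" for t
  have p: "AE t in ?L. (\<lambda>j. sl (r j) t) \<longlonglongrightarrow> p t"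
    using AE_convergent_subsequence[OF r(1,3)] by eventually_elim (simp add: p_def convergent_LIMSEQ_iff)
  have comp: "complete_measure ?L" by (rule complete_measure_lebesgue_on) simp
  have p_meas: "separably_measurable ?L p"
    by (rule separably_measurable_AE_LIMSEQ[OF comp sl_measurable p])
  have m_meas: "m \<in> borel_measurable ?L" using m_int by (rule borel_measurable_integrable)
  have h_meas: "separably_measurable ?L h"
    unfolding h_def
    by (rule separably_measurable_compose2[OF comp _ p_meas])
       (auto simp: separably_measurable_second_countable m_meas intro!: continuous_intros)
  have p_bound: "AE t in ?L. norm (p t) \<le> K"
    using p
  proof eventually_elim
    case (elim t)
    show ?case by (rule tendsto_upperbound[OF tendsto_norm[OF elim]]) (auto simp: sl_bound)
  qed
  have dom: "bochner_dominated T h (\<lambda>t. K * m t)"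
  proof
    show "integrable ?L (\<lambda>t. K * m t)" by (rule Bochner_Integration.integrable_mult_right[OF m_int])
    show "AE t in ?L. norm (h t) \<le> K * m t"
      using p_bound AE_space
    proof eventually_elim
      case (elim t)
      then have "0 \<le> m t" by (intro m_nonneg) simp
      then have "norm (h t) = norm (p t) * m t" by (simp add: h_def)
      then show ?case using elim(1) \<open>0 \<le> m t\<close> by (simp only: mult_right_mono)
    qed
  qed (use T h_meas in auto)
  interpret bochner_dominated T h "\<lambda>t. K * m t" by (rule dom)
  show ?thesis
  proof (rule that[OF dom])
    fix t assume t: "t \<in> {0..T}"
    let ?Lt = "lebesgue_on {0..t}"
    have "(z t - z 0) \<bullet> e = H t \<bullet> e" for e
    proof -
      have sub: "AE s in ?Lt. s \<in> {0..T} \<and> norm (p s) \<le> K \<and> (\<lambda>j. sl (r j) s) \<longlonglongrightarrow> p s"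
        by (rule AE_lebesgue_on_subset[where A = "{0..T}"]) (use p p_bound t in \<open>auto intro: AE_I2\<close>)
      have sl_int: "integrable ?Lt (\<lambda>s. m s * (sl n s \<bullet> e))" for n
      proof -
        have "integrable ?L (\<lambda>t. m t * (sl n t \<bullet> e))"
          using Cauchy_Schwarz_ineq2[of "sl n _" "e"] mult_right_mono[OF sl_bound[of n], of "norm e"]
          by (intro m_times_integrable[of _ "K * norm e"] borel_measurable_simple_function
              simple_function_compose1[OF sl_simple]) (meson norm_ge_zero order_trans)
        then show ?thesis by (rule integrable_lebesgue_on_subset) (use t in auto)
      qed
      have "(\<lambda>j. \<integral>s. m s * (sl (r j) s \<bullet> e) \<partial>?Lt) \<longlonglongrightarrow> (\<integral>s. h s \<bullet> e \<partial>?Lt)"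
      proof (rule integral_dominated_convergence[where w = "\<lambda>s. K * norm e * m s"])
        show "(\<lambda>s. h s \<bullet> e) \<in> borel_measurable ?Lt"
          using bochner_integral_inner(1)[OF bochner_integrable, of t e] t by auto
        show "(\<lambda>s. m s * (sl (r j) s \<bullet> e)) \<in> borel_measurable ?Lt" for j
          using sl_int by (rule borel_measurable_integrable)
        show "integrable ?Lt (\<lambda>s. K * norm e * m s)"
          by (rule integrable_lebesgue_on_subset[OF Bochner_Integration.integrable_mult_right[OF m_int]]) (use t in auto)
        show "AE s in ?Lt. (\<lambda>j. m s * (sl (r j) s \<bullet> e)) \<longlonglongrightarrow> h s \<bullet> e"
          using sub by eventually_elim (auto simp: h_def intro!: tendsto_intros)
        show "AE s in ?Lt. norm (m s * (sl (r j) s \<bullet> e)) \<le> K * norm e * m s" for j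
          using sub
        proof eventually_elim
          case (elim s)
          then have "0 \<le> m s" by (intro m_nonneg) auto
          moreover have "\<bar>sl (r j) s \<bullet> e\<bar> \<le> K * norm e"
            using Cauchy_Schwarz_ineq2[of "sl (r j) s" e] mult_right_mono[OF sl_bound[of "r j" s], of "norm e"] by simp
          ultimately show ?case by (simp add: abs_mult mult_left_mono mult.commute)
        qed
      qed
      moreover have "(\<integral>s. m s * (sl n s \<bullet> e) \<partial>?Lt) = integral {0..t} (\<lambda>s. m s * (sl n s \<bullet> e))" for n
        by (rule lebesgue_integral_eq_integral[OF sl_int]) simp
      ultimately have "(\<lambda>j. integral {0..t} (\<lambda>s. m s * (sl (r j) s \<bullet> e))) \<longlonglongrightarrow> H t \<bullet> e"
        using bochner_integral_inner(2)[OF bochner_integrable, of t e] t by simp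
      moreover have "(\<lambda>j. integral {0..t} (\<lambda>s. m s * (sl (r j) s \<bullet> e))) \<longlonglongrightarrow> (z t - z 0) \<bullet> e"
        by (rule filterlim_compose[OF integral_sl_inner_tendsto[OF t] r(2)])
      ultimately show ?thesis using LIMSEQ_unique by blast
    qed
    then have "z t - z 0 = H t" by (metis inner_commute vector_eq_rdot)
    then show "z t = z 0 + bochner_integral (lebesgue_on {0..t}) h" by (simp add: algebra_simps)
  qed
qed

end

section \<open>Composition and slices of strongly measurable maps\<close>

text \<open>A simple substitution glues finitely many maps with fixed second argument, so countable
  sets for these can be united.\<close>

lemma separably_measurable_simple_substitution:
  fixes \<phi> :: "'w \<Rightarrow> 'b \<Rightarrow> 'c::metric_space"
  assumes \<phi>: "\<And>x. separably_measurable M (\<lambda>\<omega>. \<phi> \<omega> x)" and s: "simple_function M s"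
  shows "separably_measurable M (\<lambda>\<omega>. \<phi> \<omega> (s \<omega>))"
proof -
  let ?I = "s ` space M"
  have fin: "finite ?I" using s by (simp add: simple_function_def)
  have "\<forall>x. \<exists>Q. countable Q \<and> (AE \<omega> in M. \<phi> \<omega> x \<in> closure Q)"
    using \<phi> by (auto simp: separably_measurable_def)
  then obtain Q where Q: "\<And>x. countable (Q x)" "\<And>x. AE \<omega> in M. \<phi> \<omega> x \<in> closure (Q x)" by metis
  have Q': "AE \<omega> in M. \<forall>x\<in>?I. \<phi> \<omega> x \<in> closure (Q x)"
    using fin Q(2) by (subst AE_finite_all) auto
  have "AE \<omega> in M. \<phi> \<omega> (s \<omega>) \<in> closure (\<Union>x\<in>?I. Q x)"
    using Q' AE_space
  proof eventually_elim
    case (elim \<omega>)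
    then have "\<phi> \<omega> (s \<omega>) \<in> closure (Q (s \<omega>))" "Q (s \<omega>) \<subseteq> (\<Union>x\<in>?I. Q x)" by auto
    then show ?case using closure_mono by blast
  qed
  moreover have "countable (\<Union>x\<in>?I. Q x)" by (rule countable_UN[OF countable_finite[OF fin] Q(1)])
  moreover have "(\<lambda>\<omega>. \<phi> \<omega> (s \<omega>)) \<in> borel_measurable M"
  proof (rule measurable_compose_countable'[of ?I "\<lambda>x \<omega>. \<phi> \<omega> x" M borel s])
    show "(\<lambda>\<omega>. \<phi> \<omega> x) \<in> borel_measurable M" for x using \<phi> by (simp add: separably_measurable_def)
    show "s \<in> measurable M (count_space ?I)"
      using s by (auto simp: measurable_count_space_eq2 simple_function_def)
    show "countable ?I" using fin by (rule countable_finite)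
  qed
  ultimately show ?thesis unfolding separably_measurable_def by blast
qed

text \<open>The simple approximants of \<open>y\<close> may be twice as large as \<open>y\<close>,
  which is why continuity is asked on the ball of radius \<open>2 * R\<close>.\<close>

lemma separably_measurable_Caratheodory:
  fixes \<phi> :: "'w \<Rightarrow> 'b::real_normed_vector \<Rightarrow> 'c::metric_space"
  assumes M: "complete_measure M" and \<phi>: "\<And>x. separably_measurable M (\<lambda>\<omega>. \<phi> \<omega> x)"
    and y: "separably_measurable M y" and bound: "\<And>\<omega>. \<omega> \<in> space M \<Longrightarrow> norm (y \<omega>) \<le> R"
    and cont: "\<And>\<omega>. \<omega> \<in> space M \<Longrightarrow> continuous_on (cball 0 (2 * R)) (\<phi> \<omega>)"
  shows "separably_measurable M (\<lambda>\<omega>. \<phi> \<omega> (y \<omega>))"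
proof -
  obtain s where s: "\<And>i::nat. simple_function M (s i)" "AE x in M. (\<lambda>i. s i x) \<longlonglongrightarrow> y x"
    and bnd: "\<And>i x. norm (s i x) \<le> 2 * norm (y x)"
    using separably_measurable_obtain_simple[OF y, of 0] unfolding dist_0_norm dist_commute[of _ 0] by blast
  show ?thesis
  proof (rule separably_measurable_AE_LIMSEQ[OF M, of "\<lambda>i \<omega>. \<phi> \<omega> (s i \<omega>)"])
    show "separably_measurable M (\<lambda>\<omega>. \<phi> \<omega> (s i \<omega>))" for i
      by (rule separably_measurable_simple_substitution[OF \<phi> s(1)])
    show "AE \<omega> in M. (\<lambda>i. \<phi> \<omega> (s i \<omega>)) \<longlonglongrightarrow> \<phi> \<omega> (y \<omega>)"
      using s(2) AE_space
    proof eventually_elim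
      case (elim \<omega>)
      have "0 \<le> R" using bound[OF elim(2)] norm_ge_zero order_trans by blast
      have s_in: "s i \<omega> \<in> cball 0 (2 * R)" for i
        using bnd[of i \<omega>] bound[OF elim(2)] by simp
      show ?case
        by (rule continuous_on_tendsto_compose[OF cont[OF elim(2)] elim(1)])
           (use s_in bound[OF elim(2)] \<open>0 \<le> R\<close> in \<open>auto intro!: always_eventually\<close>)
    qed
  qed
qed

lemma separably_measurable_zero_extension:
  fixes f :: "'a::euclidean_space \<Rightarrow> 'b::real_normed_vector"
  assumes f: "separably_measurable (lebesgue_on S) f" and S: "S \<in> sets lebesgue"
  shows "separably_measurable lebesgue (\<lambda>x. if x \<in> S then f x else 0)"
proof -
  obtain Q where Q: "countable Q" "AE x in lebesgue_on S. f x \<in> closure Q" and fm: "f \<in> borel_measurable (lebesgue_on S)"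
    using f by (auto simp: separably_measurable_def)
  have "AE x in lebesgue. x \<in> S \<longrightarrow> f x \<in> closure Q"
    using Q(2) S by (simp add: AE_restrict_space_iff)
  then have "AE x in lebesgue. (if x \<in> S then f x else 0) \<in> closure (insert 0 Q)"
  proof eventually_elim
    case (elim x)
    then show ?case using closure_mono[of Q "insert 0 Q"] closure_subset[of "insert 0 Q"] by auto
  qed
  moreover have "(\<lambda>x. if x \<in> S then f x else 0) \<in> borel_measurable lebesgue"
    using fm S by (subst (asm) measurable_restrict_space_iff[where c = 0]) auto
  moreover have "countable (insert 0 Q)" using Q(1) by simp
  ultimately show ?thesis unfolding separably_measurable_def by blast
qed

lemma separably_measurable_cong:
  assumes "\<And>x. x \<in> space M \<Longrightarrow> f x = g x"
  shows "separably_measurable M f \<longleftrightarrow> separably_measurable M g"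
proof -
  have "f \<in> borel_measurable M \<longleftrightarrow> g \<in> borel_measurable M" by (rule measurable_cong[OF assms])
  moreover have "(AE x in M. f x \<in> closure Q) \<longleftrightarrow> (AE x in M. g x \<in> closure Q)" for Q
    by (rule AE_cong) (simp add: assms)
  ultimately show ?thesis unfolding separably_measurable_def by simp
qed

lemma separably_measurable_sum:
  fixes f :: "'i \<Rightarrow> 'a \<Rightarrow> 'b::real_normed_vector"
  assumes "complete_measure M" "finite I" "\<And>i. i \<in> I \<Longrightarrow> separably_measurable M (f i)"
  shows "separably_measurable M (\<lambda>x. \<Sum>i\<in>I. f i x)"
  using assms(2,3)
proof (induction I rule: finite_induct)
  case (insert i I)
  have "separably_measurable M (\<lambda>x. f i x + (\<Sum>i\<in>I. f i x))"
    by (rule separably_measurable_compose2[OF assms(1)]) (use insert in \<open>auto intro!: continuous_intros\<close>)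
  then show ?case using insert by simp
qed simp

section \<open>Sections of functions on the plane\<close>

lemma complete_measure_lebesgue: "complete_measure lebesgue"
  by (rule completion.complete_measure_axioms)

lemma norm_le_of_inner_le:
  fixes x :: "'a::real_inner"
  assumes "\<And>e. x \<bullet> e \<le> B * norm e" "0 \<le> B"
  shows "norm x \<le> B"
proof (cases "x = 0")
  case False
  have "norm x * norm x \<le> B * norm x"
    using assms(1)[of x] by (simp add: power2_norm_eq_inner flip: power2_eq_square)
  then show ?thesis using False by simp
qed (use assms in simp)

text \<open>Plane Lebesgue measure is the completion of the product of the Borel ones, and
  completion does not change almost everywhere statements; so Fubini is applied before
  completing.\<close>

lemma AE_lebesgue_pairD:
  fixes P :: "real \<times> real \<Rightarrow> bool"
  assumes "AE p in lebesgue. P p"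
  shows "AE t in lebesgue. AE s in lebesgue. P (t, s)"
proof -
  have "AE p in lborel. P p"
    using assms by (simp only: AE_completion_iff)
  then have "AE p in lborel \<Otimes>\<^sub>M lborel. P p"
    by (subst lborel_prod)
  then have "AE t in lborel. AE s in lborel. P (t, s)"
    by (rule lborel_pair.AE_pair)
  then show ?thesis by (simp add: AE_completion_iff)
qed

text \<open>Sections of a Lebesgue measurable function are measurable only for almost every
  \<open>t\<close>. A Borel representative has good sections everywhere, and \<gamma> is its section
  integral.\<close>

lemma integrable_lebesgue_slices:
  fixes \<sigma> :: "real \<times> real \<Rightarrow> real"
  assumes \<sigma>: "integrable lebesgue \<sigma>"
  obtains \<gamma> where "integrable lebesgue \<gamma>"
    "AE t in lebesgue. integrable lebesgue (\<lambda>s. \<sigma> (t, s)) \<and> (\<integral>s. \<sigma> (t, s) \<partial>lebesgue) = \<gamma> t"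
proof -
  obtain \<sigma>' where \<sigma>': "\<sigma>' \<in> borel_measurable lborel" "AE p in lborel. \<sigma> p = \<sigma>' p"
    using completion_ex_borel_measurable_real[OF borel_measurable_integrable[OF \<sigma>]] by blast
  then have ae: "AE p in lebesgue. \<sigma> p = \<sigma>' p" by (simp add: AE_completion_iff)
  have "\<sigma>' \<in> borel_measurable lebesgue" using \<sigma>'(1) by (rule measurable_completion)
  then have "integrable lebesgue \<sigma>'"
    by (rule integrable_cong_AE_imp[OF \<sigma>]) (use ae in \<open>eventually_elim, simp\<close>)
  then have int': "integrable (lborel \<Otimes>\<^sub>M lborel) \<sigma>'"
    using \<sigma>'(1) by (simp add: integrable_completion lborel_prod)
  define \<gamma> where "\<gamma> t = (\<integral>s. \<sigma>' (t, s) \<partial>lborel)" for t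
  show ?thesis
  proof
    have "integrable lborel \<gamma>" unfolding \<gamma>_def by (rule lborel_pair.integrable_fst'[OF int'])
    then show "integrable lebesgue \<gamma>" by (simp add: integrable_completion borel_measurable_integrable)
    have "AE t in lborel. integrable lborel (\<lambda>s. \<sigma>' (t, s))" by (rule lborel_pair.AE_integrable_fst'[OF int'])
    then have "AE t in lebesgue. integrable lborel (\<lambda>s. \<sigma>' (t, s))" by (rule AE_completion)
    then show "AE t in lebesgue. integrable lebesgue (\<lambda>s. \<sigma> (t, s)) \<and> (\<integral>s. \<sigma> (t, s) \<partial>lebesgue) = \<gamma> t"
      using AE_lebesgue_pairD[OF ae]
    proof eventually_elim
      case (elim t)
      have b: "(\<lambda>s. \<sigma>' (t, s)) \<in> borel_measurable lborel" using elim(1) by (rule borel_measurable_integrable)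
      have i: "integrable lebesgue (\<lambda>s. \<sigma>' (t, s))" using elim(1) b by (simp add: integrable_completion)
      have m: "(\<lambda>s. \<sigma> (t, s)) \<in> borel_measurable lebesgue"
        by (rule borel_measurable_AE_LIMSEQ_metric[OF complete_measure_lebesgue, of "\<lambda>_ s. \<sigma>' (t, s)"])
           (use elim(2) i in \<open>auto elim!: eventually_mono\<close>)
      have "integrable lebesgue (\<lambda>s. \<sigma> (t, s)) = integrable lebesgue (\<lambda>s. \<sigma>' (t, s))"
        by (rule integrable_cong_AE[OF m borel_measurable_integrable[OF i] elim(2)])
      moreover have "(\<integral>s. \<sigma> (t, s) \<partial>lebesgue) = (\<integral>s. \<sigma>' (t, s) \<partial>lebesgue)"
        by (rule integral_cong_AE[OF m borel_measurable_integrable[OF i] elim(2)])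
      moreover have "(\<integral>s. \<sigma>' (t, s) \<partial>lebesgue) = \<gamma> t"
        unfolding \<gamma>_def by (rule integral_completion[OF b])
      ultimately show ?case using i by simp
    qed
  qed
qed

lemma simple_function_level_set_pair:
  fixes S :: "real \<times> real \<Rightarrow> 'a"
  assumes S: "simple_function lborel S"
  shows "S -` {c} \<in> sets (lborel \<Otimes>\<^sub>M lborel)"
proof -
  have "S -` {c} \<in> sets lborel" using simple_functionD(2)[OF S, of "{c}"] by simp
  then show ?thesis by (subst lborel_prod)
qed

lemma simple_function_slice:
  fixes S :: "real \<times> real \<Rightarrow> 'a"
  assumes S: "simple_function lborel S"
  shows "simple_function lebesgue (\<lambda>s. S (t, s))"
  unfolding simple_function_def
proof (intro conjI ballI)
  have "(\<lambda>s. S (t, s)) ` space lebesgue \<subseteq> S ` space lborel" by auto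
  then show "finite ((\<lambda>s. S (t, s)) ` space lebesgue)"
    using S finite_subset by (auto simp: simple_function_def)
  fix c
  have "Pair t -` (S -` {c}) \<in> sets lborel"
    by (rule sets_Pair1[OF simple_function_level_set_pair[OF S]])
  moreover have "Pair t -` (S -` {c}) = (\<lambda>s. S (t, s)) -` {c} \<inter> space lebesgue" by auto
  ultimately show "(\<lambda>s. S (t, s)) -` {c} \<inter> space lebesgue \<in> sets lebesgue" by simp
qed

text \<open>The section integral is a finite combination of vectors whose coefficients are measures
  of sections of Borel sets, and these depend measurably on \<open>t\<close>.\<close>

lemma separably_measurable_slice_simple_integral:
  fixes S :: "real \<times> real \<Rightarrow> 'a::real_normed_vector"
  assumes S: "simple_function lborel S"
  shows "separably_measurable lebesgue (\<lambda>t. Bochner_Integration.simple_bochner_integral lebesgue (\<lambda>s. S (t, s)))"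
proof -
  have fin: "finite (range S)" using S by (simp add: simple_function_def)
  \<comment> \<open>The sum runs over the full range of \<open>S\<close>, so that the index set does
    not vary with \<open>t\<close>; a value missing on the section has an empty level set.\<close>
  have eq: "Bochner_Integration.simple_bochner_integral lebesgue (\<lambda>s. S (t, s))
      = (\<Sum>c\<in>range S. measure lborel (Pair t -` (S -` {c})) *\<^sub>R c)" for t
  proof -
    have A: "Pair t -` (S -` {c}) \<in> sets lborel" for c
      by (rule sets_Pair1[OF simple_function_level_set_pair[OF S]])
    have "Bochner_Integration.simple_bochner_integral lebesgue (\<lambda>s. S (t, s))
      = (\<Sum>c\<in>range (\<lambda>s. S (t, s)). measure lborel (Pair t -` (S -` {c})) *\<^sub>R c)"
      unfolding simple_bochner_integral_def
    proof (rule sum.cong)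
      fix c
      have "{s \<in> space lebesgue. S (t, s) = c} = Pair t -` (S -` {c})" by auto
      then show "measure lebesgue {s \<in> space lebesgue. S (t, s) = c} *\<^sub>R c = measure lborel (Pair t -` (S -` {c})) *\<^sub>R c"
        using A by (simp add: measure_completion)
    qed simp
    also have "\<dots> = (\<Sum>c\<in>range S. measure lborel (Pair t -` (S -` {c})) *\<^sub>R c)"
    proof (rule sum.mono_neutral_left[OF fin])
      show "\<forall>c\<in>range S - range (\<lambda>s. S (t, s)). measure lborel (Pair t -` (S -` {c})) *\<^sub>R c = 0"
      proof
        fix c assume "c \<in> range S - range (\<lambda>s. S (t, s))"
        then have "S (t, s) \<noteq> c" for s by blast
        then have "Pair t -` (S -` {c}) = {}" by auto
        then show "measure lborel (Pair t -` (S -` {c})) *\<^sub>R c = 0" by simp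
      qed
    qed auto
    finally show ?thesis .
  qed
  show ?thesis
    unfolding eq
  proof (rule separably_measurable_sum[OF complete_measure_lebesgue fin])
    fix c
    have "(\<lambda>t. emeasure lborel (Pair t -` (S -` {c}))) \<in> borel_measurable lborel"
      by (rule lborel.measurable_emeasure_Pair[OF simple_function_level_set_pair[OF S]])
    then have "(\<lambda>t. measure lborel (Pair t -` (S -` {c}))) \<in> borel_measurable lborel"
      unfolding measure_def by measurable
    then have "(\<lambda>t. measure lborel (Pair t -` (S -` {c}))) \<in> borel_measurable lebesgue"
      by (rule measurable_completion)
    then have "separably_measurable lebesgue (\<lambda>t. measure lborel (Pair t -` (S -` {c})))"
      by (simp only: separably_measurable_second_countable)
    then show "separably_measurable lebesgue (\<lambda>t. measure lborel (Pair t -` (S -` {c})) *\<^sub>R c)"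
      by (rule separably_measurable_compose[OF complete_measure_lebesgue, where h = "\<lambda>a. a *\<^sub>R c"])
         (intro continuous_intros)
  qed
qed

text \<open>Fubini for Bochner integrals: dominated simple approximants on the plane have simple
  sections, whose integrals depend measurably on \<open>t\<close> and converge for almost every
  \<open>t\<close>.\<close>

lemma separably_measurable_slices:
  fixes G :: "real \<times> real \<Rightarrow> 'a::{real_inner, banach}"
  assumes G: "separably_measurable lebesgue G" and \<sigma>: "integrable lebesgue \<sigma>"
    and le: "\<And>p. norm (G p) \<le> \<sigma> p"
  shows "AE t in lebesgue. separably_measurable lebesgue (\<lambda>s. G (t, s)) \<and> bochner_integrable lebesgue (\<lambda>s. G (t, s))"
    and "separably_measurable lebesgue (\<lambda>t. bochner_integral lebesgue (\<lambda>s. G (t, s)))"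
proof -
  obtain S0 where S0: "\<And>i::nat. simple_function lebesgue (S0 i)" "AE p in lebesgue. (\<lambda>i. S0 i p) \<longlonglongrightarrow> G p"
    and bnd: "\<And>i p. norm (S0 i p) \<le> 2 * norm (G p)"
    using separably_measurable_obtain_simple[OF G, of 0] unfolding dist_0_norm dist_commute[of _ 0] by blast
  \<comment> \<open>Passing to Borel simple functions makes every section simple, at the price of a
    null set.\<close>
  have "\<exists>S. simple_function lborel S \<and> (AE p in lborel. S0 i p = S p)" for i
    using completion_ex_simple_function[OF S0(1)] by blast
  then obtain S where S: "\<And>i. simple_function lborel (S i)" "\<And>i. AE p in lborel. S0 i p = S i p" by metis
  have "AE p in lebesgue. \<forall>i. S0 i p = S i p"
    using S(2) by (subst AE_all_countable) (simp add: AE_completion_iff)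
  with S0(2) have "AE p in lebesgue. (\<lambda>i. S i p) \<longlonglongrightarrow> G p \<and> (\<forall>i. norm (S i p) \<le> 2 * norm (G p))"
    by eventually_elim (metis (no_types, lifting) bnd ext)
  from AE_lebesgue_pairD[OF this]
  have lim: "AE t in lebesgue. AE s in lebesgue. (\<lambda>i. S i (t, s)) \<longlonglongrightarrow> G (t, s) \<and> (\<forall>i. norm (S i (t, s)) \<le> 2 * norm (G (t, s)))" .
  obtain \<gamma> where "AE t in lebesgue. integrable lebesgue (\<lambda>s. \<sigma> (t, s)) \<and> (\<integral>s. \<sigma> (t, s) \<partial>lebesgue) = \<gamma> t"
    using integrable_lebesgue_slices[OF \<sigma>] by blast
  then have int: "AE t in lebesgue. integrable lebesgue (\<lambda>s. \<sigma> (t, s))" by eventually_elim simp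
  have fin: "(\<integral>\<^sup>+ s. ennreal (\<sigma> (t, s)) \<partial>lebesgue) < \<infinity>" if "integrable lebesgue (\<lambda>s. \<sigma> (t, s))" for t
  proof -
    have "0 \<le> \<sigma> p" for p using le norm_ge_zero order_trans by blast
    then show ?thesis using that by (simp add: integrable_iff_bounded)
  qed
  have meas: "separably_measurable lebesgue (\<lambda>s. G (t, s))"
    if "AE s in lebesgue. (\<lambda>i. S i (t, s)) \<longlonglongrightarrow> G (t, s) \<and> (\<forall>i. norm (S i (t, s)) \<le> 2 * norm (G (t, s)))" for t
  proof (rule separably_measurable_AE_LIMSEQ[OF complete_measure_lebesgue])
    show "separably_measurable lebesgue (\<lambda>s. S i (t, s))" for i
      by (rule separably_measurable_simple_function[OF simple_function_slice[OF S(1)]])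
    show "AE s in lebesgue. (\<lambda>i. S i (t, s)) \<longlonglongrightarrow> G (t, s)" using that by eventually_elim simp
  qed
  have bint: "bochner_integrable lebesgue (\<lambda>s. G (t, s))"
    if "separably_measurable lebesgue (\<lambda>s. G (t, s))" "integrable lebesgue (\<lambda>s. \<sigma> (t, s))" for t
  proof (rule bochner_integrableI_bounded[OF complete_measure_lebesgue that(1)])
    have "(\<integral>\<^sup>+ s. ennreal (norm (G (t, s))) \<partial>lebesgue) \<le> (\<integral>\<^sup>+ s. ennreal (\<sigma> (t, s)) \<partial>lebesgue)"
      by (intro nn_integral_mono ennreal_leI le)
    with fin[OF that(2)] show "(\<integral>\<^sup>+ s. ennreal (norm (G (t, s))) \<partial>lebesgue) < \<infinity>" by (rule order.strict_trans1[rotated])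
  qed
  show "AE t in lebesgue. separably_measurable lebesgue (\<lambda>s. G (t, s)) \<and> bochner_integrable lebesgue (\<lambda>s. G (t, s))"
    using lim int by eventually_elim (use meas bint in blast)
  have conv: "(\<lambda>i. Bochner_Integration.simple_bochner_integral lebesgue (\<lambda>s. S i (t, s)))
        \<longlonglongrightarrow> bochner_integral lebesgue (\<lambda>s. G (t, s))"
    if lim_t: "AE s in lebesgue. (\<lambda>i. S i (t, s)) \<longlonglongrightarrow> G (t, s) \<and> (\<forall>i. norm (S i (t, s)) \<le> 2 * norm (G (t, s)))"
      and int_t: "integrable lebesgue (\<lambda>s. \<sigma> (t, s))" for t
  proof -
    let ?F = "\<lambda>i. Bochner_Integration.simple_bochner_integral lebesgue (\<lambda>s. S i (t, s))"
    let ?I = "bochner_integral lebesgue (\<lambda>s. G (t, s))"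
    have Gm: "separably_measurable lebesgue (\<lambda>s. G (t, s))" by (rule meas[OF lim_t])
    have Gi: "bochner_integrable lebesgue (\<lambda>s. G (t, s))" by (rule bint[OF Gm int_t])
    have Sle: "AE s in lebesgue. norm (S i (t, s)) \<le> 2 * \<sigma> (t, s)" for i
      using lim_t
    proof eventually_elim
      case (elim s)
      then show ?case using le[of "(t, s)"] by (metis mult_left_mono order_trans zero_le_numeral)
    qed
    have Si: "Bochner_Integration.simple_bochner_integrable lebesgue (\<lambda>s. S i (t, s))" for i
    proof (rule simple_bochner_integrableI_bounded[OF simple_function_slice[OF S(1)]])
      have "(\<integral>\<^sup>+ s. ennreal (norm (S i (t, s))) \<partial>lebesgue) \<le> (\<integral>\<^sup>+ s. ennreal (2 * \<sigma> (t, s)) \<partial>lebesgue)"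
      proof (rule nn_integral_mono_AE)
        show "AE s in lebesgue. ennreal (norm (S i (t, s))) \<le> ennreal (2 * \<sigma> (t, s))"
          using Sle[of i] by eventually_elim (rule ennreal_leI)
      qed
      also have "\<dots> < \<infinity>"
      proof -
        have nn: "0 \<le> \<sigma> (t, s)" for s using le norm_ge_zero order_trans by blast
        have "integrable lebesgue (\<lambda>s. 2 * \<sigma> (t, s))" using int_t by (rule Bochner_Integration.integrable_mult_right)
        then have "(\<integral>\<^sup>+ s. ennreal (norm (2 * \<sigma> (t, s))) \<partial>lebesgue) < \<infinity>"
          unfolding integrable_iff_bounded by blast
        moreover have "norm (2 * \<sigma> (t, s)) = 2 * \<sigma> (t, s)" for s using nn by simp
        ultimately show ?thesis by (simp only:)
      qed
      finally show "(\<integral>\<^sup>+ s. ennreal (norm (S i (t, s))) \<partial>lebesgue) < \<infinity>" .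
    qed
    \<comment> \<open>A simple function is its own approximating sequence.\<close>
    have F: "has_bochner_integral_gen lebesgue (\<lambda>s. S i (t, s)) (?F i)" for i
      unfolding has_bochner_integral_gen_def
    proof (intro conjI exI[of _ "\<lambda>_ s. S i (t, s)"] allI)
      show "(\<lambda>s. S i (t, s)) \<in> borel_measurable lebesgue"
        by (rule borel_measurable_simple_function[OF simple_function_slice[OF S(1)]])
      show "(\<lambda>_ :: nat. \<integral>\<^sup>+ s. ennreal (norm (S i (t, s) - S i (t, s))) \<partial>lebesgue) \<longlonglongrightarrow> 0"
        by simp
    qed (rule Si tendsto_const)+
    have dm: "(\<lambda>s. norm (S i (t, s) - G (t, s))) \<in> borel_measurable lebesgue" for i
      using borel_measurable_dist_simple_function[OF _ simple_function_slice[OF S(1), of i t], of "\<lambda>s. G (t, s)"] Gm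
      by (simp add: separably_measurable_def dist_norm norm_minus_commute)
    have dle: "AE s in lebesgue. norm (norm (S i (t, s) - G (t, s))) \<le> 3 * \<sigma> (t, s)" for i
      using Sle[of i]
    proof eventually_elim
      case (elim s)
      then show ?case using norm_triangle_ineq4[of "S i (t, s)" "G (t, s)"] le[of "(t, s)"] by simp
    qed
    have i3: "integrable lebesgue (\<lambda>s. 3 * \<sigma> (t, s))" using int_t by (rule Bochner_Integration.integrable_mult_right)
    have di: "integrable lebesgue (\<lambda>s. norm (S i (t, s) - G (t, s)))" for i
      using dle[of i] by (intro Bochner_Integration.integrable_bound[OF i3 dm]) (auto elim!: eventually_mono)
    \<comment> \<open>The bound by the mean distance is obtained by testing with \<open>e\<close>,
      so that scalar linearity of the integral suffices.\<close>
    have bound: "norm (?F i - ?I) \<le> (\<integral>s. norm (S i (t, s) - G (t, s)) \<partial>lebesgue)" for i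
    proof (rule norm_le_of_inner_le)
      fix e
      have 1: "has_bochner_integral lebesgue (\<lambda>s. S i (t, s) \<bullet> e) (?F i \<bullet> e)"
        by (rule has_bochner_integral_gen_inner[OF F])
      have "(?F i - ?I) \<bullet> e = (\<integral>s. S i (t, s) \<bullet> e \<partial>lebesgue) - (\<integral>s. G (t, s) \<bullet> e \<partial>lebesgue)"
        using bochner_integral_inner(2)[OF Gi] has_bochner_integral_integral_eq[OF 1] by (simp add: inner_diff_left)
      also have "\<dots> = (\<integral>s. S i (t, s) \<bullet> e - G (t, s) \<bullet> e \<partial>lebesgue)"
        using integrable.intros[OF 1] bochner_integral_inner(1)[OF Gi] by simp
      also have "\<dots> \<le> (\<integral>s. norm (S i (t, s) - G (t, s)) * norm e \<partial>lebesgue)"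
      proof (rule integral_mono)
        show "integrable lebesgue (\<lambda>s. S i (t, s) \<bullet> e - G (t, s) \<bullet> e)"
          using integrable.intros[OF 1] bochner_integral_inner(1)[OF Gi] by simp
        show "integrable lebesgue (\<lambda>s. norm (S i (t, s) - G (t, s)) * norm e)"
          by (rule Bochner_Integration.integrable_mult_left[OF di])
        show "S i (t, s) \<bullet> e - G (t, s) \<bullet> e \<le> norm (S i (t, s) - G (t, s)) * norm e" for s
          using norm_cauchy_schwarz[of "S i (t, s) - G (t, s)" e] by (simp add: inner_diff_left)
      qed
      finally show "(?F i - ?I) \<bullet> e \<le> (\<integral>s. norm (S i (t, s) - G (t, s)) \<partial>lebesgue) * norm e" by simp
    qed simp
    have "(\<lambda>i. \<integral>s. norm (S i (t, s) - G (t, s)) \<partial>lebesgue) \<longlonglongrightarrow> (\<integral>s. 0 \<partial>(lebesgue :: real measure))"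
    proof (rule integral_dominated_convergence[OF _ dm i3 _ dle])
      show "AE s in lebesgue. (\<lambda>i. norm (S i (t, s) - G (t, s))) \<longlonglongrightarrow> 0"
        using lim_t
      proof eventually_elim
        case (elim s)
        then have "(\<lambda>i. S i (t, s) - G (t, s)) \<longlonglongrightarrow> 0" by (simp add: LIM_zero)
        then show ?case by (rule tendsto_norm_zero)
      qed
    qed simp
    then have "(\<lambda>i. \<integral>s. norm (S i (t, s) - G (t, s)) \<partial>lebesgue) \<longlonglongrightarrow> 0" by simp
    then have "(\<lambda>i. ?F i - ?I) \<longlonglongrightarrow> 0"
      by (rule Lim_null_comparison[OF always_eventually, rotated]) (use bound in blast)
    then show ?thesis by (rule LIM_zero_cancel)
  qed
  have "AE t in lebesgue. (\<lambda>i. Bochner_Integration.simple_bochner_integral lebesgue (\<lambda>s. S i (t, s)))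
        \<longlonglongrightarrow> bochner_integral lebesgue (\<lambda>s. G (t, s))"
    using lim int by eventually_elim (rule conv)
  then show "separably_measurable lebesgue (\<lambda>t. bochner_integral lebesgue (\<lambda>s. G (t, s)))"
    by (rule separably_measurable_AE_LIMSEQ[OF complete_measure_lebesgue separably_measurable_slice_simple_integral[OF S(1)]])
qed

section \<open>The perturbation\<close>

locale integro_perturbation =
  fixes T :: real and f :: "real \<Rightarrow> 'a::{real_inner, banach} \<Rightarrow> 'a" and g :: "real \<Rightarrow> real \<Rightarrow> 'a \<Rightarrow> 'a"
    and \<alpha> \<beta> w :: "real \<Rightarrow> real" and D :: "(real \<times> real) set" and \<sigma> :: "real \<times> real \<Rightarrow> real"
  assumes T: "0 < T"
    and D: "D = {(t, s). t \<in> {0..T} \<and> s \<in> {0..T} \<and> s \<le> t}"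
    and f_measurable: "\<And>x. strongly_measurable (lebesgue_on {0..T}) (\<lambda>t. f t x)"
    and f_growth_int: "integrable (lebesgue_on {0..T}) \<alpha>" "integrable (lebesgue_on {0..T}) \<beta>"
    and w_int: "integrable (lebesgue_on {0..T}) w"
    and f_growth_nonneg: "\<And>t. t \<in> {0..T} \<Longrightarrow> 0 \<le> \<alpha> t \<and> 0 \<le> \<beta> t"
    and f_growth: "\<And>t x. t \<in> {0..T} \<Longrightarrow> norm (f t x) \<le> \<alpha> t * norm x + \<beta> t"
    and f_Lipschitz: "\<And>r. 0 < r \<Longrightarrow>
          \<exists>\<kappa>\<ge>0. \<forall>t\<in>{0..T}. \<forall>x\<in>cball 0 r. \<forall>y\<in>cball 0 r.
            norm (f t x - f t y) \<le> \<kappa> * norm (x - y)"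
    and g_measurable: "\<And>x. strongly_measurable (lebesgue_on ({0..T} \<times> {0..T})) (\<lambda>(t, s). g t s x)"
    and g_Lipschitz: "\<And>r. 0 < r \<Longrightarrow>
          \<exists>\<mu>. integrable (lebesgue_on {0..T}) \<mu> \<and> (\<forall>t\<in>{0..T}. 0 \<le> \<mu> t) \<and>
            (\<forall>(t, s)\<in>D. \<forall>x\<in>cball 0 r. \<forall>y\<in>cball 0 r.
              norm (g t s x - g t s y) \<le> \<mu> t * norm (x - y))"
    and g_growth_int: "integrable (lebesgue_on D) \<sigma>"
    and g_growth_nonneg: "\<And>t s. (t, s) \<in> D \<Longrightarrow> 0 \<le> \<sigma> (t, s)"
    and g_growth: "\<And>t s x. (t, s) \<in> D \<Longrightarrow> norm (g t s x) \<le> \<sigma> (t, s) * (1 + norm x)"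
begin

lemma D_closed: "closed D"
proof -
  have "D = ({0..T} \<times> {0..T}) \<inter> {p. snd p \<le> fst p}" by (auto simp: D)
  moreover have "closed \<dots>"
    by (intro closed_Int closed_Times closed_Collect_le continuous_intros)
  ultimately show ?thesis by simp
qed

lemma D_iff: "(t, s) \<in> D \<longleftrightarrow> t \<in> {0..T} \<and> s \<in> {0..T} \<and> s \<le> t"
  by (simp add: D)

lemma D_sets [simp]: "D \<in> sets lebesgue"
  using D_closed by (simp add: borel_closed)

definition \<sigma>D :: "real \<times> real \<Rightarrow> real" where
  "\<sigma>D p = (if p \<in> D then \<sigma> p else 0)"

text \<open>Extension by zero turns the integral over \<open>[0,t]\<close> into a full section
  integral of one function on the plane.\<close>

definition kernel :: "(real \<Rightarrow> 'a) \<Rightarrow> real \<times> real \<Rightarrow> 'a" where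
  "kernel y p = (if p \<in> D then g (fst p) (snd p) (y (snd p)) else 0)"

definition perturbation :: "(real \<Rightarrow> 'a) \<Rightarrow> real \<Rightarrow> 'a" where
  "perturbation y t = f t (y t) + bochner_integral lebesgue (\<lambda>s. kernel y (t, s))"

definition primitive :: "(real \<Rightarrow> 'a) \<Rightarrow> real \<Rightarrow> 'a" where
  "primitive y t = bochner_integral (lebesgue_on {0..t}) (perturbation y)"

lemma \<sigma>D_integrable: "integrable lebesgue \<sigma>D"
proof -
  have "integrable lebesgue (\<lambda>p. indicator D p *\<^sub>R \<sigma> p)"
    using g_growth_int by (subst (asm) integrable_restrict_space) auto
  moreover have "(\<lambda>p. indicator D p *\<^sub>R \<sigma> p) = \<sigma>D" by (auto simp: \<sigma>D_def indicator_def)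
  ultimately show ?thesis by simp
qed

lemma \<sigma>D_nonneg: "0 \<le> \<sigma>D p"
  using g_growth_nonneg by (cases p) (simp add: \<sigma>D_def)

text \<open>Fixes one integrable version of the section integrals of the growth function, so that
  the weight \<open>m\<close> can be chosen before any path is known.\<close>

definition \<gamma> :: "real \<Rightarrow> real" where
  "\<gamma> = (SOME \<gamma>. integrable lebesgue \<gamma> \<and>
    (AE t in lebesgue. integrable lebesgue (\<lambda>s. \<sigma>D (t, s)) \<and> (\<integral>s. \<sigma>D (t, s) \<partial>lebesgue) = \<gamma> t))"

lemma \<gamma>: "integrable lebesgue \<gamma>"
  "AE t in lebesgue. integrable lebesgue (\<lambda>s. \<sigma>D (t, s)) \<and> (\<integral>s. \<sigma>D (t, s) \<partial>lebesgue) = \<gamma> t"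
proof -
  have "\<exists>\<gamma>. integrable lebesgue \<gamma> \<and>
    (AE t in lebesgue. integrable lebesgue (\<lambda>s. \<sigma>D (t, s)) \<and> (\<integral>s. \<sigma>D (t, s) \<partial>lebesgue) = \<gamma> t)"
    by (rule integrable_lebesgue_slices[OF \<sigma>D_integrable]) blast
  from someI_ex[OF this] show "integrable lebesgue \<gamma>"
    "AE t in lebesgue. integrable lebesgue (\<lambda>s. \<sigma>D (t, s)) \<and> (\<integral>s. \<sigma>D (t, s) \<partial>lebesgue) = \<gamma> t"
    unfolding \<gamma>_def by blast+
qed

text \<open>One weight for all sources of motion: \<open>\<bar>w t\<bar>\<close> dominates the
  moving set, \<alpha> and \<beta> dominate \<open>f\<close>, \<open>\<bar>\<gamma> t\<bar>\<close>
  dominates the integral term, and 1 keeps the clock strictly increasing.\<close>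

definition m :: "real \<Rightarrow> real" where
  "m t = 1 + \<bar>w t\<bar> + \<alpha> t + \<beta> t + \<bar>\<gamma> t\<bar>"

sublocale time_change T m
proof
  show "0 < T" by (rule T)
  have "integrable (lebesgue_on {0..T}) \<gamma>"
    by (rule integrable_lebesgue_on_subset[of UNIV]) (use \<gamma>(1) in \<open>auto simp: lebesgue_on_UNIV_eq\<close>)
  moreover have "integrable (lebesgue_on {0..T}) (\<lambda>_. 1::real)"
    by (rule finite_measure.integrable_const[OF finite_measure_lebesgue_on]) simp
  ultimately show "integrable (lebesgue_on {0..T}) m"
    unfolding m_def[abs_def] using f_growth_int w_int
    by (intro Bochner_Integration.integrable_add integrable_abs)
  show "1 \<le> m t" if "t \<in> {0..T}" for t using f_growth_nonneg[OF that] by (simp add: m_def)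
qed

lemma admissible_separably_measurable:
  assumes y: "admissible_path y"
  shows "separably_measurable lebesgue y" "separably_measurable lebesgue (\<lambda>p :: real \<times> real. y (snd p))"
proof -
  obtain Q where Q: "countable Q" "range y \<subseteq> closure Q" and ym: "y \<in> borel_measurable borel"
    using y by (auto simp: admissible_path_def)
  have "y \<in> borel_measurable lebesgue"
    by (rule measurable_completion) (use ym in simp)
  moreover have "AE x in lebesgue. y x \<in> closure Q" using Q(2) by (intro AE_I2) auto
  ultimately show "separably_measurable lebesgue y" using Q(1) unfolding separably_measurable_def by blast
  \<comment> \<open>Here Borel measurability of the path on the whole line is used: composition with
    the Borel projection remains Borel.\<close>
  have "(\<lambda>p :: real \<times> real. y (snd p)) \<in> borel_measurable lborel"
    using measurable_compose[OF _ ym, of snd borel] by (simp add: borel_measurable_continuous_onI continuous_on_snd)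
  then have "(\<lambda>p :: real \<times> real. y (snd p)) \<in> borel_measurable lebesgue" by (rule measurable_completion)
  moreover have "AE p :: real \<times> real in lebesgue. y (snd p) \<in> closure Q" using Q(2) by (intro AE_I2) auto
  ultimately show "separably_measurable lebesgue (\<lambda>p :: real \<times> real. y (snd p))"
    using Q(1) unfolding separably_measurable_def by blast
qed

lemma admissible_bound:
  assumes "admissible_path y" obtains B where "0 < B" "\<And>t. norm (y t) \<le> B"
proof -
  obtain B where "\<And>t. norm (y t) \<le> B" using assms by (auto simp: admissible_path_def bounded_iff)
  then show ?thesis using that[of "max 1 B"] by (metis less_max_iff_disj max.coboundedI2 zero_less_one)
qed

lemma continuous_on_of_Lipschitz_bound:
  fixes \<phi> :: "'b::real_normed_vector \<Rightarrow> 'c::real_normed_vector"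
  assumes "\<And>x y. x \<in> S \<Longrightarrow> y \<in> S \<Longrightarrow> norm (\<phi> x - \<phi> y) \<le> k * norm (x - y)"
  shows "continuous_on S \<phi>"
proof -
  have "(max k 0)-lipschitz_on S \<phi>"
  proof (rule lipschitz_onI)
    fix x y assume "x \<in> S" "y \<in> S"
    then show "dist (\<phi> x) (\<phi> y) \<le> max k 0 * dist x y"
      using assms[of x y] mult_right_mono[of k "max k 0" "norm (x - y)"] by (simp add: dist_norm)
  qed simp
  then show ?thesis by (rule lipschitz_on_continuous_on)
qed

lemma f_path_measurable:
  assumes y: "admissible_path y"
  shows "separably_measurable (lebesgue_on {0..T}) (\<lambda>t. f t (y t))"
proof -
  obtain B where B: "0 < B" "\<And>t. norm (y t) \<le> B" by (rule admissible_bound[OF y]) blast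
  obtain \<kappa> where \<kappa>: "\<forall>t\<in>{0..T}. \<forall>x\<in>cball 0 (2 * B). \<forall>y\<in>cball 0 (2 * B). norm (f t x - f t y) \<le> \<kappa> * norm (x - y)"
    using f_Lipschitz[of "2 * B"] B(1) by auto
  have comp: "complete_measure (lebesgue_on {0..T})" by (rule complete_measure_lebesgue_on) simp
  show ?thesis
  proof (rule separably_measurable_Caratheodory[OF comp, of f y B])
    show "separably_measurable (lebesgue_on {0..T}) (\<lambda>t. f t x)" for x
      using f_measurable separably_measurable_iff_strongly_measurable[OF comp] by blast
    show "separably_measurable (lebesgue_on {0..T}) y"
      by (rule separably_measurable_lebesgue_on_subset[of UNIV])
         (use admissible_separably_measurable(1)[OF y] in \<open>auto simp: lebesgue_on_UNIV_eq\<close>)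
    show "continuous_on (cball 0 (2 * B)) (f t)" if "t \<in> space (lebesgue_on {0..T})" for t
      by (rule continuous_on_of_Lipschitz_bound[of _ _ \<kappa>]) (use \<kappa> that in auto)
  qed (rule B(2))
qed

lemma kernel_measurable:
  assumes y: "admissible_path y"
  shows "separably_measurable lebesgue (kernel y)"
proof -
  obtain B where B: "0 < B" "\<And>t. norm (y t) \<le> B" by (rule admissible_bound[OF y]) blast
  obtain \<mu> where \<mu>: "\<forall>(t, s)\<in>D. \<forall>x\<in>cball 0 (2 * B). \<forall>y\<in>cball 0 (2 * B). norm (g t s x - g t s y) \<le> \<mu> t * norm (x - y)"
    using g_Lipschitz[of "2 * B"] B(1) by auto
  have S: "{0..T} \<times> {0..T} \<in> sets (lebesgue :: (real \<times> real) measure)"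
    by (simp add: borel_closed closed_Times)
  have comp: "complete_measure (lebesgue_on ({0..T} \<times> {0..T}))" by (rule complete_measure_lebesgue_on[OF S])
  show ?thesis
    unfolding kernel_def[abs_def]
  proof (rule separably_measurable_Caratheodory[OF complete_measure_lebesgue, of "\<lambda>p x. if p \<in> D then g (fst p) (snd p) x else 0" "\<lambda>p. y (snd p)" B])
    show "separably_measurable lebesgue (\<lambda>p. if p \<in> D then g (fst p) (snd p) x else 0)" for x
    proof (rule separably_measurable_zero_extension)
      have "separably_measurable (lebesgue_on ({0..T} \<times> {0..T})) (\<lambda>p. g (fst p) (snd p) x)"
        using g_measurable[of x] by (simp add: separably_measurable_iff_strongly_measurable[OF comp] case_prod_unfold)
      then show "separably_measurable (lebesgue_on D) (\<lambda>p. g (fst p) (snd p) x)"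
        by (rule separably_measurable_lebesgue_on_subset) (use S in \<open>auto simp: D_iff\<close>)
    qed simp
    show "separably_measurable lebesgue (\<lambda>p :: real \<times> real. y (snd p))"
      by (rule admissible_separably_measurable(2)[OF y])
    show "continuous_on (cball 0 (2 * B)) (\<lambda>x. if p \<in> D then g (fst p) (snd p) x else 0)" for p
    proof (cases "p \<in> D")
      case True
      have "continuous_on (cball 0 (2 * B)) (g (fst p) (snd p))"
        by (rule continuous_on_of_Lipschitz_bound[of _ _ "\<mu> (fst p)"]) (use \<mu> True in \<open>auto simp: case_prod_unfold\<close>)
      then show ?thesis using True by simp
    qed simp
  qed (rule B(2))
qed

lemma kernel_le:
  assumes "\<And>s. 0 \<le> s \<Longrightarrow> s \<le> t \<Longrightarrow> norm (y s) \<le> B"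
  shows "norm (kernel y (t, s)) \<le> (1 + B) * \<sigma>D (t, s)"
proof (cases "(t, s) \<in> D")
  case True
  then have "norm (g t s (y s)) \<le> \<sigma> (t, s) * (1 + norm (y s))" by (rule g_growth)
  also have "\<dots> \<le> \<sigma> (t, s) * (1 + B)"
    using True assms[of s] g_growth_nonneg[OF True] by (intro mult_left_mono) (auto simp: D_iff)
  finally show ?thesis using True by (simp add: kernel_def \<sigma>D_def mult.commute)
qed (simp add: kernel_def \<sigma>D_def)

text \<open>The times at which the section integral for the path \<open>y\<close> exists and its
  growth bound is the fixed \<gamma>. The exceptional null set depends on \<open>y\<close>.\<close>

definition slice_regular :: "(real \<Rightarrow> 'a) \<Rightarrow> real \<Rightarrow> bool" where
  "slice_regular y t \<longleftrightarrow> bochner_integrable lebesgue (\<lambda>s. kernel y (t, s)) \<and> separably_measurable lebesgue (\<lambda>s. kernel y (t, s))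
     \<and> integrable lebesgue (\<lambda>s. \<sigma>D (t, s)) \<and> (\<integral>s. \<sigma>D (t, s) \<partial>lebesgue) = \<gamma> t"

lemma kernel_slices:
  assumes y: "admissible_path y"
  shows "AE t in lebesgue. slice_regular y t"
    and "separably_measurable lebesgue (\<lambda>t. bochner_integral lebesgue (\<lambda>s. kernel y (t, s)))"
proof -
  obtain B where B: "0 < B" "\<And>t. norm (y t) \<le> B" by (rule admissible_bound[OF y]) blast
  have i: "integrable lebesgue (\<lambda>p. (1 + B) * \<sigma>D p)"
    by (rule Bochner_Integration.integrable_mult_right[OF \<sigma>D_integrable])
  have le: "norm (kernel y p) \<le> (1 + B) * \<sigma>D p" for p
    using kernel_le[of "fst p" y B "snd p"] B(2) by simp
  note sl = separably_measurable_slices[OF kernel_measurable[OF y] i le]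
  show "AE t in lebesgue. slice_regular y t"
    using sl(1) \<gamma>(2) by eventually_elim (simp add: slice_regular_def)
  show "separably_measurable lebesgue (\<lambda>t. bochner_integral lebesgue (\<lambda>s. kernel y (t, s)))" by (rule sl(2))
qed

lemma AE_slice_regular:
  assumes "admissible_path y" "S \<in> sets lebesgue"
  shows "AE t in lebesgue_on S. slice_regular y t"
proof (rule AE_lebesgue_on_subset)
  show "AE t in lebesgue_on UNIV. slice_regular y t"
    unfolding lebesgue_on_UNIV_eq by (rule kernel_slices(1)[OF assms(1)])
qed (use assms(2) in auto)

lemma perturbation_measurable:
  assumes y: "admissible_path y"
  shows "separably_measurable (lebesgue_on {0..T}) (perturbation y)"
  unfolding perturbation_def[abs_def]
proof (rule separably_measurable_compose2[OF complete_measure_lebesgue_on f_path_measurable[OF y], where h = "(+)"])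
  show "separably_measurable (lebesgue_on {0..T}) (\<lambda>t. bochner_integral lebesgue (\<lambda>s. kernel y (t, s)))"
    by (rule separably_measurable_lebesgue_on_subset[of UNIV])
       (use kernel_slices(2)[OF y] in \<open>auto simp: lebesgue_on_UNIV_eq\<close>)
qed (auto intro!: continuous_intros)

text \<open>Only values of \<open>y\<close> up to time \<open>t\<close> enter, since the kernel
  vanishes off the triangle; the growth condition of the scheme needs this form.\<close>

lemma perturbation_le:
  assumes t: "t \<in> {0..T}" and slice_regular: "slice_regular y t" and B: "\<And>s. 0 \<le> s \<Longrightarrow> s \<le> t \<Longrightarrow> norm (y s) \<le> B"
  shows "norm (perturbation y t) \<le> (1 + B) * m t"
proof -
  have "norm (y 0) \<le> B" using B[of 0] t by simp
  then have B0: "0 \<le> B" using norm_ge_zero order_trans by blast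
  have "norm (bochner_integral lebesgue (\<lambda>s. kernel y (t, s))) \<le> (\<integral>s. (1 + B) * \<sigma>D (t, s) \<partial>lebesgue)"
    using slice_regular kernel_le[of t y B, OF B] by (intro bochner_integral_norm_bound) (auto simp: slice_regular_def)
  also have "\<dots> = (1 + B) * \<gamma> t" using slice_regular by (simp add: slice_regular_def)
  also have "\<dots> \<le> (1 + B) * \<bar>\<gamma> t\<bar>" using B0 by (intro mult_left_mono) auto
  finally have 1: "norm (bochner_integral lebesgue (\<lambda>s. kernel y (t, s))) \<le> (1 + B) * \<bar>\<gamma> t\<bar>" .
  have "norm (f t (y t)) \<le> \<alpha> t * norm (y t) + \<beta> t" by (rule f_growth[OF t])
  also have "\<dots> \<le> \<alpha> t * (1 + B) + \<beta> t * (1 + B)"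
    using f_growth_nonneg[OF t] B[of t] t B0 by (intro add_mono mult_left_mono) (auto simp: mult_le_cancel_left1)
  also have "\<dots> \<le> (1 + B) * (1 + \<bar>w t\<bar> + \<alpha> t + \<beta> t)"
    using B0 by (simp add: algebra_simps)
  finally have "norm (f t (y t)) \<le> (1 + B) * (1 + \<bar>w t\<bar> + \<alpha> t + \<beta> t)" .
  with 1 show ?thesis
    using norm_triangle_ineq[of "f t (y t)" "bochner_integral lebesgue (\<lambda>s. kernel y (t, s))"]
    by (simp add: perturbation_def m_def algebra_simps)
qed

lemma perturbation_dominated:
  assumes y: "admissible_path y" and B: "\<And>t. norm (y t) \<le> B"
  shows "bochner_dominated T (perturbation y) (\<lambda>t. (1 + B) * m t)"
proof
  show "AE t in lebesgue_on {0..T}. norm (perturbation y t) \<le> (1 + B) * m t"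
    using AE_slice_regular[OF y, of "{0..T}", simplified] AE_space
    by eventually_elim (use perturbation_le B in auto)
qed (use T perturbation_measurable[OF y] m_int in auto)

section \<open>Causality, growth and Lipschitz dependence of the primitive\<close>

lemma perturbation_cong:
  assumes "\<And>s. 0 \<le> s \<Longrightarrow> s \<le> t \<Longrightarrow> y s = z s" "0 \<le> t"
  shows "perturbation y t = perturbation z t"
proof -
  have "kernel y (t, s) = kernel z (t, s)" for s
    using assms(1)[of s] by (auto simp: kernel_def D_iff)
  then show ?thesis using assms by (simp add: perturbation_def)
qed

lemma primitive_causal:
  assumes y: "admissible_path y" and z: "admissible_path z" and t: "t \<in> {0..T}"
    and eq: "\<And>s. 0 \<le> s \<Longrightarrow> s < t \<Longrightarrow> y s = z s"
  shows "primitive y t = primitive z t"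
proof -
  obtain B where B: "\<And>t. norm (y t) \<le> B" by (rule admissible_bound[OF y]) blast
  obtain B' where B': "\<And>t. norm (z t) \<le> B'" by (rule admissible_bound[OF z]) blast
  interpret Y: bochner_dominated T "perturbation y" "\<lambda>t. (1 + B) * m t" by (rule perturbation_dominated[OF y B])
  interpret Z: bochner_dominated T "perturbation z" "\<lambda>t. (1 + B') * m t" by (rule perturbation_dominated[OF z B'])
  have "primitive y t \<bullet> e = primitive z t \<bullet> e" for e
  proof -
    have "primitive y t \<bullet> e = integral {0..t} (\<lambda>r. perturbation y r \<bullet> e)"
      unfolding primitive_def by (rule Y.H_inner) (use t in auto)
    also have "\<dots> = integral {0..t} (\<lambda>r. perturbation z r \<bullet> e)"
    proof (rule integral_spike[of "{t}"])
      fix r assume "r \<in> {0..t} - {t}"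
      then show "perturbation z r \<bullet> e = perturbation y r \<bullet> e"
        using perturbation_cong[of r y z] eq by auto
    qed simp
    also have "\<dots> = primitive z t \<bullet> e"
      unfolding primitive_def by (rule Z.H_inner[symmetric]) (use t in auto)
    finally show ?thesis .
  qed
  then show ?thesis by (metis inner_commute vector_eq_rdot)
qed

lemma primitive_growth:
  assumes y: "admissible_path y" and st: "0 \<le> s" "s \<le> t" "t \<le> T"
    and B: "\<And>u. 0 \<le> u \<Longrightarrow> u < t \<Longrightarrow> norm (y u) \<le> B"
  shows "norm (primitive y t - primitive y s) \<le> (1 + B) * (\<theta> t - \<theta> s)"
proof -
  obtain B' where B': "\<And>t. norm (y t) \<le> B'" by (rule admissible_bound[OF y]) blast
  interpret Y: bochner_dominated T "perturbation y" "\<lambda>t. (1 + B') * m t" by (rule perturbation_dominated[OF y B'])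
  \<comment> \<open>The bound on \<open>y\<close> is available strictly before \<open>t\<close>, so
    the endpoint is discarded as a null set.\<close>
  have "AE r in lebesgue_on {s..t}. r \<noteq> t"
    by (subst AE_lebesgue_on_iff_negligible) (auto intro: negligible_subset[of "{t}"])
  then have "AE r in lebesgue_on {s..t}. norm (perturbation y r - 0) \<le> (1 + B) * m r"
    using AE_slice_regular[OF y, of "{s..t}", simplified] AE_space
  proof eventually_elim
    case (elim r)
    then show ?case using perturbation_le[of r y B] B st by auto
  qed
  from Y.norm_diff_sub_le[OF st _ this]
  have "norm (primitive y t - primitive y s) \<le> integral {s..t} (\<lambda>r. (1 + B) * m r)"
    using integrable_on_mult_right[OF m_integrable[OF st(1,3)], of "1 + B"] by (simp add: primitive_def)
  also have "\<dots> = (1 + B) * (\<theta> t - \<theta> s)" using integral_m[OF st] by simp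
  finally show ?thesis .
qed

text \<open>The two kernels differ only on a section of the triangle, which lies in
  \<open>{0..T}\<close>; this is the origin of the factor \<open>T\<close> beside \<mu>.\<close>

lemma perturbation_diff_le:
  assumes y: "slice_regular y t" and z: "slice_regular z t" and t: "t \<in> {0..T}" and \<epsilon>: "0 \<le> \<epsilon>" and \<kappa>: "0 \<le> \<kappa>" and \<mu>: "0 \<le> \<mu>"
    and close: "\<And>s. s \<in> {0..T} \<Longrightarrow> norm (y s) \<le> R \<and> norm (z s) \<le> R \<and> norm (y s - z s) \<le> \<epsilon>"
    and f: "\<And>x y. x \<in> cball 0 R \<Longrightarrow> y \<in> cball 0 R \<Longrightarrow> norm (f t x - f t y) \<le> \<kappa> * norm (x - y)"
    and g: "\<And>s x y. (t, s) \<in> D \<Longrightarrow> x \<in> cball 0 R \<Longrightarrow> y \<in> cball 0 R \<Longrightarrow> norm (g t s x - g t s y) \<le> \<mu> * norm (x - y)"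
  shows "norm (perturbation y t - perturbation z t) \<le> (\<kappa> + T * \<mu>) * \<epsilon>"
proof -
  let ?I = "\<lambda>y. bochner_integral lebesgue (\<lambda>s. kernel y (t, s))"
  have ind: "integrable lebesgue (\<lambda>s. indicator {0..T} s * c)" for c :: real
    using T by (intro Bochner_Integration.integrable_mult_left integrable_real_indicator) (auto simp: emeasure_lborel_Icc_eq)
  have "norm (?I y - ?I z) \<le> T * (\<mu> * \<epsilon>)"
  proof (rule norm_le_of_inner_le)
    fix e
    have iy: "integrable lebesgue (\<lambda>s. kernel y (t, s) \<bullet> e)" and iz: "integrable lebesgue (\<lambda>s. kernel z (t, s) \<bullet> e)"
      using y z by (auto simp: slice_regular_def intro: bochner_integral_inner(1))
    have "(?I y - ?I z) \<bullet> e = (\<integral>s. kernel y (t, s) \<bullet> e - kernel z (t, s) \<bullet> e \<partial>lebesgue)"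
      using y z iy iz by (simp add: slice_regular_def inner_diff_left bochner_integral_inner(2))
    also have "\<dots> \<le> (\<integral>s. indicator {0..T} s * (\<mu> * \<epsilon> * norm e) \<partial>lebesgue)"
    proof (rule integral_mono)
      fix s
      show "kernel y (t, s) \<bullet> e - kernel z (t, s) \<bullet> e \<le> indicator {0..T} s * (\<mu> * \<epsilon> * norm e)"
      proof (cases "(t, s) \<in> D")
        case True
        then have s: "s \<in> {0..T}" by (auto simp: D_iff)
        have "kernel y (t, s) \<bullet> e - kernel z (t, s) \<bullet> e = (g t s (y s) - g t s (z s)) \<bullet> e"
          using True by (simp add: kernel_def inner_diff_left)
        also have "\<dots> \<le> norm (g t s (y s) - g t s (z s)) * norm e" by (rule norm_cauchy_schwarz)
        also have "\<dots> \<le> (\<mu> * norm (y s - z s)) * norm e"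
          using close[OF s] by (intro mult_right_mono g[OF True]) auto
        also have "\<dots> \<le> (\<mu> * \<epsilon>) * norm e"
          using close[OF s] \<mu> by (intro mult_right_mono mult_left_mono) auto
        finally show ?thesis using s by simp
      qed (use \<mu> \<epsilon> in \<open>simp add: kernel_def\<close>)
    qed (use iy iz ind in auto)
    also have "\<dots> = T * (\<mu> * \<epsilon>) * norm e" using T by (simp add: mult_ac)
    finally show "(?I y - ?I z) \<bullet> e \<le> T * (\<mu> * \<epsilon>) * norm e" .
  qed (use T \<mu> \<epsilon> in simp)
  moreover have "norm (f t (y t) - f t (z t)) \<le> \<kappa> * \<epsilon>"
  proof -
    have "norm (f t (y t) - f t (z t)) \<le> \<kappa> * norm (y t - z t)" using close[OF t] by (intro f) auto
    also have "\<dots> \<le> \<kappa> * \<epsilon>" using close[OF t] \<kappa> by (intro mult_left_mono) auto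
    finally show ?thesis .
  qed
  ultimately show ?thesis
    using norm_triangle_ineq[of "f t (y t) - f t (z t)" "?I y - ?I z"]
    by (simp add: perturbation_def algebra_simps)
qed

text \<open>The Lipschitz modulus of the integrand varies with time but is integrable, and its
  integral over the whole interval is the constant.\<close>

lemma primitive_Lipschitz:
  "\<exists>K\<ge>0. \<forall>y z \<epsilon>. admissible_path y \<longrightarrow> admissible_path z \<longrightarrow>
     (\<forall>s\<in>{0..T}. norm (y s) \<le> R \<and> norm (z s) \<le> R \<and> norm (y s - z s) \<le> \<epsilon>) \<longrightarrow>
     (\<forall>t\<in>{0..T}. norm (primitive y t - primitive z t) \<le> K * \<epsilon>)"
proof -
  \<comment> \<open>The Lipschitz conditions on \<open>f\<close> and \<open>g\<close> concern
    positive radii, whereas \<open>R\<close> is arbitrary.\<close>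
  let ?R = "max R 1"
  obtain \<kappa> where \<kappa>: "0 \<le> \<kappa>" "\<And>t x y. t \<in> {0..T} \<Longrightarrow> x \<in> cball 0 ?R \<Longrightarrow> y \<in> cball 0 ?R \<Longrightarrow> norm (f t x - f t y) \<le> \<kappa> * norm (x - y)"
    using f_Lipschitz[of ?R] by (meson less_max_iff_disj zero_less_one)
  obtain \<mu> where \<mu>: "integrable (lebesgue_on {0..T}) \<mu>" "\<And>t. t \<in> {0..T} \<Longrightarrow> 0 \<le> \<mu> t"
      "\<forall>(t, s)\<in>D. \<forall>x\<in>cball 0 ?R. \<forall>y\<in>cball 0 ?R. norm (g t s x - g t s y) \<le> \<mu> t * norm (x - y)"
    using g_Lipschitz[of ?R] by (auto simp: less_max_iff_disj)
  let ?k = "\<lambda>t. \<kappa> + T * \<mu> t"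
  have k_int: "?k integrable_on {0..T}"
    by (intro integrable_add integrable_const_ivl integrable_on_mult_right integrable_on_lebesgue_on[OF \<mu>(1)]) auto
  have k_nonneg: "0 \<le> ?k t" if "t \<in> {0..T}" for t using \<kappa>(1) \<mu>(2)[OF that] T by simp
  show ?thesis
  proof (intro exI conjI allI impI ballI)
    show K0: "0 \<le> integral {0..T} ?k" by (rule integral_nonneg[OF k_int k_nonneg])
    fix y z :: "real \<Rightarrow> 'a" and \<epsilon> t
    assume y: "admissible_path y" and z: "admissible_path z" and t: "t \<in> {0..T}"
      and close: "\<forall>s\<in>{0..T}. norm (y s) \<le> R \<and> norm (z s) \<le> R \<and> norm (y s - z s) \<le> \<epsilon>"
    have \<epsilon>: "0 \<le> \<epsilon>" using close t norm_ge_zero order_trans by blast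
    obtain B where B: "\<And>t. norm (y t) \<le> B" by (rule admissible_bound[OF y]) blast
    obtain B' where B': "\<And>t. norm (z t) \<le> B'" by (rule admissible_bound[OF z]) blast
    interpret Y: bochner_dominated T "perturbation y" "\<lambda>t. (1 + B) * m t" by (rule perturbation_dominated[OF y B])
    interpret Z: bochner_dominated T "perturbation z" "\<lambda>t. (1 + B') * m t" by (rule perturbation_dominated[OF z B'])
    have ae: "AE r in lebesgue_on {0..t}. norm (perturbation y r - perturbation z r) \<le> ?k r * \<epsilon>"
      using AE_slice_regular[OF y, of "{0..t}", simplified] AE_slice_regular[OF z, of "{0..t}", simplified] AE_space
    proof eventually_elim
      case (elim r)
      then have r: "r \<in> {0..T}" using t by auto
      show ?case
      proof (rule perturbation_diff_le[OF elim(1,2) r \<epsilon> \<kappa>(1) \<mu>(2)[OF r]])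
        show "norm (y s) \<le> ?R \<and> norm (z s) \<le> ?R \<and> norm (y s - z s) \<le> \<epsilon>" if "s \<in> {0..T}" for s
          using close that by fastforce
        show "norm (f r x - f r x') \<le> \<kappa> * norm (x - x')" if "x \<in> cball 0 ?R" "x' \<in> cball 0 ?R" for x x'
          using \<kappa>(2)[OF r that] .
        show "norm (g r s x - g r s x') \<le> \<mu> r * norm (x - x')" if "(r, s) \<in> D" "x \<in> cball 0 ?R" "x' \<in> cball 0 ?R" for s x x'
          using \<mu>(3) that by blast
      qed
    qed
    have kt_int: "?k integrable_on {0..t}" by (rule integrable_on_subinterval[OF k_int]) (use t in auto)
    show "norm (primitive y t - primitive z t) \<le> integral {0..T} ?k * \<epsilon>"
    proof (rule norm_le_of_inner_le)
      fix e
      have iy: "(\<lambda>r. perturbation y r \<bullet> e) integrable_on {0..t}" by (rule Y.inner_integrable) (use t in auto)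
      have iz: "(\<lambda>r. perturbation z r \<bullet> e) integrable_on {0..t}" by (rule Z.inner_integrable) (use t in auto)
      have "primitive y t \<bullet> e = integral {0..t} (\<lambda>r. perturbation y r \<bullet> e)"
        unfolding primitive_def by (rule Y.H_inner) (use t in auto)
      moreover have "primitive z t \<bullet> e = integral {0..t} (\<lambda>r. perturbation z r \<bullet> e)"
        unfolding primitive_def by (rule Z.H_inner) (use t in auto)
      ultimately have "(primitive y t - primitive z t) \<bullet> e = integral {0..t} (\<lambda>r. perturbation y r \<bullet> e - perturbation z r \<bullet> e)"
        using Henstock_Kurzweil_Integration.integral_diff[OF iy iz] by (simp add: inner_diff_left)
      also have "\<dots> \<le> integral {0..t} (\<lambda>r. ?k r * (\<epsilon> * norm e))"
      proof (rule integral_le_AE[OF integrable_diff[OF iy iz] integrable_on_mult_left[OF kt_int]])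
        show "AE r in lebesgue_on {0..t}. perturbation y r \<bullet> e - perturbation z r \<bullet> e \<le> ?k r * (\<epsilon> * norm e)"
          using ae
        proof eventually_elim
          case (elim r)
          then show ?case
            using norm_cauchy_schwarz[of "perturbation y r - perturbation z r" e] mult_right_mono[OF elim, of "norm e"]
            by (simp add: inner_diff_left mult.assoc)
        qed
      qed simp
      also have "\<dots> = integral {0..t} ?k * (\<epsilon> * norm e)" by simp
      also have "\<dots> \<le> integral {0..T} ?k * (\<epsilon> * norm e)"
      proof (rule mult_right_mono)
        show "integral {0..t} ?k \<le> integral {0..T} ?k"
          by (rule integral_subset_le[OF _ kt_int k_int]) (use t k_nonneg in auto)
      qed (use \<epsilon> in simp)
      finally show "(primitive y t - primitive z t) \<bullet> e \<le> integral {0..T} ?k * \<epsilon> * norm e" by (simp only: mult.assoc)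
    qed (use K0 \<epsilon> in simp)
  qed
qed

text \<open>Translates the section integral of the extended kernel back to the integral over
  \<open>[0,t]\<close> in the definition of a solution; the two vectors are compared through inner
  products.\<close>

lemma slice_integral:
  assumes y: "admissible_path y" and slice_regular: "slice_regular y t" and t: "t \<in> {0..T}"
  shows "bochner_integrable (lebesgue_on {0..t}) (\<lambda>s. g t s (y s))"
    and "bochner_integral (lebesgue_on {0..t}) (\<lambda>s. g t s (y s)) = bochner_integral lebesgue (\<lambda>s. kernel y (t, s))"
proof -
  have k: "kernel y (t, s) = (if s \<in> {0..t} then g t s (y s) else 0)" for s
    using t by (auto simp: kernel_def D_iff)
  have "separably_measurable (lebesgue_on {0..t}) (\<lambda>s. kernel y (t, s))"
    by (rule separably_measurable_lebesgue_on_subset[of UNIV]) (use slice_regular in \<open>auto simp: slice_regular_def lebesgue_on_UNIV_eq\<close>)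
  then have meas: "separably_measurable (lebesgue_on {0..t}) (\<lambda>s. g t s (y s))"
    by (subst separably_measurable_cong[where g = "\<lambda>s. kernel y (t, s)"]) (auto simp: k)
  show int: "bochner_integrable (lebesgue_on {0..t}) (\<lambda>s. g t s (y s))"
  proof (rule bochner_integrableI_bounded[OF complete_measure_lebesgue_on meas])
    obtain B where B: "0 < B" "\<And>t. norm (y t) \<le> B" by (rule admissible_bound[OF y]) blast
    have nn: "0 \<le> (1 + B) * \<sigma>D p" for p using B(1) \<sigma>D_nonneg by simp
    have "integrable lebesgue (\<lambda>s. (1 + B) * \<sigma>D (t, s))"
      using slice_regular by (intro Bochner_Integration.integrable_mult_right) (simp add: slice_regular_def)
    then have "(\<integral>\<^sup>+ s. ennreal (norm ((1 + B) * \<sigma>D (t, s))) \<partial>lebesgue) < \<infinity>"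
      unfolding integrable_iff_bounded by blast
    then have fin: "(\<integral>\<^sup>+ s. ennreal ((1 + B) * \<sigma>D (t, s)) \<partial>lebesgue) < \<infinity>"
      unfolding real_norm_def abs_of_nonneg[OF nn] .
    have "(\<integral>\<^sup>+ s. ennreal (norm (g t s (y s))) \<partial>lebesgue_on {0..t}) = (\<integral>\<^sup>+ s. ennreal (norm (kernel y (t, s))) \<partial>lebesgue)"
      by (subst nn_integral_restrict_space) (auto simp: k intro!: nn_integral_cong)
    also have "\<dots> \<le> (\<integral>\<^sup>+ s. ennreal ((1 + B) * \<sigma>D (t, s)) \<partial>lebesgue)"
      by (intro nn_integral_mono ennreal_leI kernel_le B(2))
    also note fin
    finally show "(\<integral>\<^sup>+ s. ennreal (norm (g t s (y s))) \<partial>lebesgue_on {0..t}) < \<infinity>" .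
  qed simp
  have "bochner_integral (lebesgue_on {0..t}) (\<lambda>s. g t s (y s)) \<bullet> e = bochner_integral lebesgue (\<lambda>s. kernel y (t, s)) \<bullet> e" for e
  proof -
    have "bochner_integral (lebesgue_on {0..t}) (\<lambda>s. g t s (y s)) \<bullet> e = (\<integral>s. g t s (y s) \<bullet> e \<partial>lebesgue_on {0..t})"
      by (rule bochner_integral_inner(2)[OF int])
    also have "\<dots> = (\<integral>s. indicator {0..t} s *\<^sub>R (g t s (y s) \<bullet> e) \<partial>lebesgue)"
      by (rule integral_restrict_space) simp
    also have "\<dots> = (\<integral>s. kernel y (t, s) \<bullet> e \<partial>lebesgue)"
      by (rule Bochner_Integration.integral_cong) (auto simp: k)
    also have "\<dots> = bochner_integral lebesgue (\<lambda>s. kernel y (t, s)) \<bullet> e"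
      using slice_regular by (simp add: slice_regular_def bochner_integral_inner(2))
    finally show ?thesis .
  qed
  then show "bochner_integral (lebesgue_on {0..t}) (\<lambda>s. g t s (y s)) = bochner_integral lebesgue (\<lambda>s. kernel y (t, s))"
    by (metis inner_commute vector_eq_rdot)
qed

end

section \<open>Existence of solutions\<close>

text \<open>The right side carries a factor \<open>\<theta> \<tau> - \<theta> t\<close>. After
  division by \<open>\<tau> - t\<close> this factor tends to \<open>m\<close>, while the
  \<theta>-increments inside the bracket vanish, leaving the normal inequality with constant
  \<open>K * m / (2 * r)\<close>. The quotients are taken to the right of \<open>t\<close>, hence
  \<open>t < T\<close>.\<close>

lemma derivative_in_proximal_normal_cone:
  fixes x p :: "real \<Rightarrow> 'a::real_inner" and \<theta> :: "real \<Rightarrow> real"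
  assumes t: "0 \<le> t" "t < T" and xS: "x t \<in> S" and K: "0 \<le> K" and r: "0 < r" and m: "0 \<le> m"
    and dx: "(x has_vector_derivative x') (at t within {0..T})"
    and dp: "(p has_vector_derivative p') (at t within {0..T})"
    and d\<theta>: "(\<theta> has_vector_derivative m) (at t within {0..T})"
    and ineq: "\<And>\<tau> y. t < \<tau> \<Longrightarrow> \<tau> \<le> T \<Longrightarrow> y \<in> S \<Longrightarrow> inner (x t - x \<tau> + (p \<tau> - p t)) (y - x t) \<le>
        K * (\<theta> \<tau> - \<theta> t) * (2 * (c * (\<theta> \<tau> - \<theta> t)) + (norm (y - x t) + 2 * (c * (\<theta> \<tau> - \<theta> t)))\<^sup>2 / (2 * r))"
  shows "p' - x' \<in> proximal_normal_cone S (x t)"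
proof -
  let ?F = "at t within {t<..<T}"
  have sub: "{t<..<T} \<subseteq> {0..T}" using t by auto
  have nontriv: "?F \<noteq> bot"
    using islimpt_greaterThanLessThan1[OF t(2)] by (simp add: trivial_limit_within)
  have quot: "((\<lambda>\<tau>. (u \<tau> - u t) / (\<tau> - t)) \<longlongrightarrow> u') ?F"
    if "(u has_vector_derivative u') (at t within {0..T})" for u :: "real \<Rightarrow> real" and u'
    using that tendsto_within_subset[OF _ sub]
    by (simp add: has_field_derivative_iff flip: has_real_derivative_iff_has_vector_derivative)
  have q\<theta>: "((\<lambda>\<tau>. (\<theta> \<tau> - \<theta> t) / (\<tau> - t)) \<longlongrightarrow> m) ?F" by (rule quot[OF d\<theta>])
  \<comment> \<open>Right continuity of \<theta> at \<open>t\<close> is read off from its difference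
    quotient.\<close>
  have "((\<lambda>\<tau>. (\<theta> \<tau> - \<theta> t) / (\<tau> - t) * (\<tau> - t)) \<longlongrightarrow> m * (t - t)) ?F"
    by (intro tendsto_mult q\<theta> tendsto_diff tendsto_ident_at tendsto_const)
  moreover have "\<forall>\<^sub>F \<tau> in ?F. (\<theta> \<tau> - \<theta> t) / (\<tau> - t) * (\<tau> - t) = \<theta> \<tau> - \<theta> t"
    by (auto simp: eventually_at_filter)
  ultimately have \<theta>0: "((\<lambda>\<tau>. \<theta> \<tau> - \<theta> t) \<longlongrightarrow> 0) ?F"
    by (simp add: tendsto_cong)
  have key: "inner (p' - x') (y - x t) \<le> K * m / (2 * r) * (norm (y - x t))\<^sup>2" if y: "y \<in> S" for y
  proof -
    let ?e = "y - x t"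
    have "((\<lambda>\<tau>. (p \<tau> - x \<tau>) \<bullet> ?e) has_vector_derivative ((p' - x') \<bullet> ?e)) (at t within {0..T})"
      by (rule bounded_linear.has_vector_derivative[OF bounded_linear_inner_left has_vector_derivative_diff[OF dp dx]])
    from quot[OF this] have l: "((\<lambda>\<tau>. ((p \<tau> - x \<tau>) \<bullet> ?e - (p t - x t) \<bullet> ?e) / (\<tau> - t)) \<longlongrightarrow> (p' - x') \<bullet> ?e) ?F" .
    have "((\<lambda>\<tau>. K * ((\<theta> \<tau> - \<theta> t) / (\<tau> - t)) * (2 * (c * (\<theta> \<tau> - \<theta> t)) + (norm ?e + 2 * (c * (\<theta> \<tau> - \<theta> t)))\<^sup>2 / (2 * r)))
        \<longlongrightarrow> K * m * (2 * (c * 0) + (norm ?e + 2 * (c * 0))\<^sup>2 / (2 * r))) ?F"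
      using r by (intro tendsto_intros q\<theta> \<theta>0) auto
    moreover have "\<forall>\<^sub>F \<tau> in ?F. ((p \<tau> - x \<tau>) \<bullet> ?e - (p t - x t) \<bullet> ?e) / (\<tau> - t)
        \<le> K * ((\<theta> \<tau> - \<theta> t) / (\<tau> - t)) * (2 * (c * (\<theta> \<tau> - \<theta> t)) + (norm ?e + 2 * (c * (\<theta> \<tau> - \<theta> t)))\<^sup>2 / (2 * r))"
      unfolding eventually_at_filter
    proof (intro always_eventually allI impI)
      fix \<tau> assume "\<tau> \<in> {t<..<T}"
      then have \<tau>: "t < \<tau>" "\<tau> \<le> T" by auto
      have "(p \<tau> - x \<tau>) \<bullet> ?e - (p t - x t) \<bullet> ?e = (x t - x \<tau> + (p \<tau> - p t)) \<bullet> ?e"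
        by (simp add: inner_diff_left inner_add_left)
      then show "((p \<tau> - x \<tau>) \<bullet> ?e - (p t - x t) \<bullet> ?e) / (\<tau> - t)
        \<le> K * ((\<theta> \<tau> - \<theta> t) / (\<tau> - t)) * (2 * (c * (\<theta> \<tau> - \<theta> t)) + (norm ?e + 2 * (c * (\<theta> \<tau> - \<theta> t)))\<^sup>2 / (2 * r))"
        using divide_right_mono[OF ineq[OF \<tau> y], of "\<tau> - t"] \<tau>(1) by (simp add: mult_ac)
    qed
    ultimately have "(p' - x') \<bullet> ?e \<le> K * m * (2 * (c * 0) + (norm ?e + 2 * (c * 0))\<^sup>2 / (2 * r))"
      by (intro tendsto_le[OF nontriv _ l])
    then show ?thesis by simp
  qed
  have "0 \<le> K * m / (2 * r)" using K m r by simp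
  with key xS show ?thesis unfolding proximal_normal_cone_def by blast
qed

text \<open>For the unit vector along \<open>n\<close>, the point \<open>x\<close> is nearest to its
  shift by \<open>r\<close>; comparing with \<open>y\<close> and expanding squares gives the
  inequality. Rescaling makes it linear in \<open>norm n\<close>, which lets the discrete errors be
  summed.\<close>

lemma uniformly_prox_regular_hypomonotone:
  fixes S :: "'a::real_inner set"
  assumes S: "uniformly_prox_regular \<rho> S" and r: "0 < r" "ereal r \<le> \<rho>"
    and n: "n \<in> proximal_normal_cone S x" and y: "y \<in> S"
  shows "inner n (y - x) \<le> norm n / (2 * r) * (norm (y - x))\<^sup>2"
proof (cases "n = 0")
  case False
  let ?u = "(1 / norm n) *\<^sub>R n"
  obtain \<sigma> where \<sigma>: "x \<in> S" "0 \<le> \<sigma>" "\<And>y. y \<in> S \<Longrightarrow> inner n (y - x) \<le> \<sigma> * (norm (y - x))\<^sup>2"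
    using n by (auto simp: proximal_normal_cone_def)
  have "inner ?u (y - x) \<le> (\<sigma> / norm n) * (norm (y - x))\<^sup>2" if "y \<in> S" for y
    using divide_right_mono[OF \<sigma>(3)[OF that], of "norm n"] by simp
  moreover have "0 \<le> \<sigma> / norm n" using \<sigma>(2) by simp
  ultimately have "?u \<in> proximal_normal_cone S x"
    using \<sigma>(1) unfolding proximal_normal_cone_def by blast
  moreover have nu: "norm ?u = 1" using False by simp
  ultimately have "?u \<in> proximal_normal_cone S x \<inter> cball 0 1" by (simp only: Int_iff mem_cball_0 order_refl simp_thms)
  then have "x \<in> Proj S (x + r *\<^sub>R ?u)"
    using S \<sigma>(1) less_imp_le[OF r(1)] r(2) unfolding uniformly_prox_regular_def by blast
  then have "dist (x + r *\<^sub>R ?u) x \<le> dist (x + r *\<^sub>R ?u) y"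
    using infdist_le[OF y, of "x + r *\<^sub>R ?u"] by (simp add: Proj_def)
  then have "(norm (r *\<^sub>R ?u))\<^sup>2 \<le> (norm (r *\<^sub>R ?u - (y - x)))\<^sup>2"
    by (intro power_mono) (auto simp: dist_norm algebra_simps)
  moreover have "2 * inner a b \<le> (norm b)\<^sup>2" if "(norm a)\<^sup>2 \<le> (norm (a - b))\<^sup>2" for a b :: 'a
    using that unfolding power2_norm_eq_inner by (simp add: inner_diff_left inner_diff_right inner_commute)
  ultimately have "2 * inner (r *\<^sub>R ?u) (y - x) \<le> (norm (y - x))\<^sup>2" by blast
  then have "2 * (r * inner ?u (y - x)) \<le> (norm (y - x))\<^sup>2" by (simp only: inner_scaleR_left[of r])
  then have "inner ?u (y - x) \<le> (norm (y - x))\<^sup>2 / (2 * r)"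
    using r(1) by (simp add: field_simps)
  then have "norm n * inner ?u (y - x) \<le> norm n * ((norm (y - x))\<^sup>2 / (2 * r))"
    by (rule mult_left_mono) simp
  then show ?thesis using False by simp
qed simp

lemma infdist_le_Haus:
  assumes "z \<in> A" "Haus A B \<le> ereal c" shows "infdist z B \<le> c"
proof -
  have "ereal (infdist z B) \<le> (SUP x\<in>A. ereal (infdist x B))" using assms(1) by (rule SUP_upper)
  also have "\<dots> \<le> Haus A B" by (simp add: Haus_def)
  also note assms(2)
  finally show ?thesis by simp
qed

theorem theorem6p2:
  fixes T L :: real and \<rho> :: ereal
    and C :: "real \<Rightarrow> 'a::{real_inner, banach} \<Rightarrow> 'a set"
    and v \<alpha> \<beta> :: "real \<Rightarrow> real"
    and f :: "real \<Rightarrow> 'a \<Rightarrow> 'a"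
    and g :: "real \<Rightarrow> real \<Rightarrow> 'a \<Rightarrow> 'a"
    and D :: "(real \<times> real) set" and \<sigma> :: "real \<times> real \<Rightarrow> real"
    and x\<^sub>0 :: 'a
  assumes T: "0 < T"
    and D: "D = {(t, s). t \<in> {0..T} \<and> s \<in> {0..T} \<and> s \<le> t}"
    and rho: "0 < \<rho>"
    and C_values: "\<And>t x. t \<in> {0..T} \<Longrightarrow>
          C t x \<noteq> {} \<and> closed (C t x) \<and> uniformly_prox_regular \<rho> (C t x)"
    and v: "abs_continuous_on_interval T v"
    and L: "0 \<le> L" "L < 1"
    and C_Haus: "\<And>t s x y. t \<in> {0..T} \<Longrightarrow> s \<in> {0..T} \<Longrightarrow>
          Haus (C t x) (C s y) \<le> ereal (\<bar>v t - v s\<bar> + L * norm (x - y))"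
    and C_compact: "\<And>t A B r. t \<in> {0..T} \<Longrightarrow> bounded A \<Longrightarrow> bounded B \<Longrightarrow> 0 < r \<Longrightarrow>
          compact (closure ((\<Union>a\<in>A. C t a) \<inter> B \<inter> cball 0 r))"
    and f_measurable: "\<And>x. strongly_measurable (lebesgue_on {0..T}) (\<lambda>t. f t x)"
    and f_growth_int: "integrable (lebesgue_on {0..T}) \<alpha>" "integrable (lebesgue_on {0..T}) \<beta>"
    and f_growth_nonneg: "\<And>t. t \<in> {0..T} \<Longrightarrow> 0 \<le> \<alpha> t \<and> 0 \<le> \<beta> t"
    and f_growth: "\<And>t x. t \<in> {0..T} \<Longrightarrow> norm (f t x) \<le> \<alpha> t * norm x + \<beta> t"
    and f_Lipschitz: "\<And>r. 0 < r \<Longrightarrow>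
          \<exists>\<kappa>\<ge>0. \<forall>t\<in>{0..T}. \<forall>x\<in>cball 0 r. \<forall>y\<in>cball 0 r.
            norm (f t x - f t y) \<le> \<kappa> * norm (x - y)"
    and g_measurable: "\<And>x. strongly_measurable (lebesgue_on ({0..T} \<times> {0..T})) (\<lambda>(t, s). g t s x)"
    and g_Lipschitz: "\<And>r. 0 < r \<Longrightarrow>
          \<exists>\<mu>. integrable (lebesgue_on {0..T}) \<mu> \<and> (\<forall>t\<in>{0..T}. 0 \<le> \<mu> t) \<and>
            (\<forall>(t, s)\<in>D. \<forall>x\<in>cball 0 r. \<forall>y\<in>cball 0 r.
              norm (g t s x - g t s y) \<le> \<mu> t * norm (x - y))"
    and g_growth_int: "integrable (lebesgue_on D) \<sigma>"
    and g_growth_nonneg: "\<And>t s. (t, s) \<in> D \<Longrightarrow> 0 \<le> \<sigma> (t, s)"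
    and g_growth: "\<And>t s x. (t, s) \<in> D \<Longrightarrow> norm (g t s x) \<le> \<sigma> (t, s) * (1 + norm x)"
    and x0: "x\<^sub>0 \<in> C 0 x\<^sub>0"
  shows "\<exists>x. sweeping_solution T C f g x\<^sub>0 x"
proof -
  obtain v0 w where w: "integrable (lebesgue_on {0..T}) w"
    and v_eq: "\<And>t. t \<in> {0..T} \<Longrightarrow> v t = v0 + (\<integral>s. w s \<partial>lebesgue_on {0..t})"
    using v unfolding abs_continuous_on_interval_def bochner_integrable_iff bochner_integral_eq by blast
  interpret A: integro_perturbation T f g \<alpha> \<beta> w D \<sigma>
    by unfold_locales
       (fact T D f_measurable f_growth_int w f_growth_nonneg f_growth f_Lipschitz g_measurable g_Lipschitz
          g_growth_int g_growth_nonneg g_growth)+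
  have v_le: "\<bar>v t - v s\<bar> \<le> \<bar>A.\<theta> t - A.\<theta> s\<bar>" if "s \<in> {0..T}" "t \<in> {0..T}" for s t
    using that
  proof (induction s t rule: linorder_wlog)
    case (le s t)
    have v_HK: "v r = v0 + integral {0..r} w" if "r \<in> {0..T}" for r
      using v_eq[OF that] lebesgue_integral_eq_integral[OF integrable_lebesgue_on_subset[OF w], of "{0..r}"] that by auto
    have w_HK: "w integrable_on {0..T}" by (rule integrable_on_lebesgue_on[OF w]) simp
    have "v t - v s = integral {s..t} w"
      using v_HK[OF le(2)] v_HK[OF le(3)] integral_diff_Icc[OF w_HK, of s t] le by simp
    moreover have "norm (integral {s..t} w) \<le> integral {s..t} A.m"
    proof (rule integral_norm_bound_integral)
      show "w integrable_on {s..t}" by (rule integrable_on_subinterval[OF w_HK]) (use le in auto)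
      show "A.m integrable_on {s..t}" by (rule A.m_integrable) (use le in auto)
      fix r assume "r \<in> {s..t}"
      then have "r \<in> {0..T}" using le by auto
      then show "norm (w r) \<le> A.m r" using f_growth_nonneg[of r] by (simp add: A.m_def)
    qed
    ultimately show ?case using A.integral_m[of s t] le by simp
  qed (simp add: abs_minus_commute)
  \<comment> \<open>\<rho> may be infinite, in which case the real radius 1 is taken.\<close>
  obtain r where r: "0 < r" "ereal r \<le> \<rho>"
    using rho by (cases \<rho>) (auto intro: that[of 1] that[of "real_of_ereal \<rho>"])
  interpret S: catching_up T L r C A.\<theta> A.primitive x\<^sub>0
  proof
    show "infdist z (C t y) \<le> \<bar>A.\<theta> t - A.\<theta> s\<bar> + L * norm (x - y)"
      if "s \<in> {0..T}" "t \<in> {0..T}" "z \<in> C s x" for s t x y z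
      using infdist_le_Haus[OF that(3) C_Haus[OF that(1,2)], of y] v_le[OF that(2,1)] by (simp add: abs_minus_commute)
    show "inner n (y - x) \<le> norm n / (2 * r) * (norm (y - x))\<^sup>2"
      if "t \<in> {0..T}" "n \<in> proximal_normal_cone (C t u) x" "y \<in> C t u" for t u x n y
      using uniformly_prox_regular_hypomonotone[of \<rho> "C t u", OF _ r that(2,3)] C_values[OF that(1)] by blast
    show "compact (closure ((\<Union>a\<in>cball 0 R. C t a) \<inter> cball 0 R))" if "t \<in> {0..T}" for t R
    proof -
      \<comment> \<open>The compactness hypothesis concerns positive radii; for arbitrary
        \<open>R\<close> the set is a closed part of the one for \<open>max R 1\<close>.\<close>
      let ?U = "\<lambda>R. (\<Union>a\<in>cball 0 R. C t a) \<inter> cball 0 R"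
      have "compact (closure (?U (max R 1)))"
        using C_compact[OF that bounded_cball bounded_cball, of "max R 1" 0 "max R 1" 0 "max R 1"] by (simp add: Int_assoc)
      moreover have "closure (?U R) \<subseteq> closure (?U (max R 1))"
        by (intro closure_mono Int_mono UN_mono) auto
      ultimately show ?thesis
        using compact_Int_closed[OF _ closed_closure, of "closure (?U (max R 1))" "?U R"] by (simp only: Int_absorb1)
    qed
    show "continuous_on {0..T} A.\<theta>" by (rule A.\<theta>_continuous)
    show "A.\<theta> s < A.\<theta> t" if "0 \<le> s" "s < t" "t \<le> T" for s t by (rule A.\<theta>_less[OF that])
    show "closed (C t x)" "C t x \<noteq> {}" if "t \<in> {0..T}" for t x using C_values[OF that] by blast+
    show "A.primitive y t = A.primitive z t"
      if "admissible_path y" "admissible_path z" "t \<in> {0..T}" "\<And>s. 0 \<le> s \<Longrightarrow> s < t \<Longrightarrow> y s = z s" for y z t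
      using that by (rule A.primitive_causal)
    show "norm (A.primitive y t - A.primitive y s) \<le> (1 + B) * (A.\<theta> t - A.\<theta> s)"
      if "admissible_path y" "0 \<le> s" "s \<le> t" "t \<le> T" "\<And>u. 0 \<le> u \<Longrightarrow> u < t \<Longrightarrow> norm (y u) \<le> B" for y s t B
      using that by (rule A.primitive_growth)
    show "\<exists>\<kappa>\<ge>0. \<forall>y z \<epsilon>. admissible_path y \<longrightarrow> admissible_path z \<longrightarrow>
          (\<forall>s\<in>{0..T}. norm (y s) \<le> R \<and> norm (z s) \<le> R \<and> norm (y s - z s) \<le> \<epsilon>) \<longrightarrow>
          (\<forall>t\<in>{0..T}. norm (A.primitive y t - A.primitive z t) \<le> \<kappa> * \<epsilon>)" for R
      by (rule A.primitive_Lipschitz)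
  qed (fact T L r x0 A.\<theta>_0)+
  obtain x where x: "admissible_path x" "x 0 = x\<^sub>0"
    and x_lip: "\<And>s t. s \<in> {0..T} \<Longrightarrow> t \<in> {0..T} \<Longrightarrow> norm (x t - x s) \<le> S.K * \<bar>A.\<theta> t - A.\<theta> s\<bar>"
    and x_in: "\<And>t. t \<in> {0..T} \<Longrightarrow> x t \<in> C t (x t)"
    and x_ineq: "\<And>s t y. 0 \<le> s \<Longrightarrow> s < t \<Longrightarrow> t \<le> T \<Longrightarrow> y \<in> C s (x s) \<Longrightarrow>
       inner (x s - x t + (A.primitive x t - A.primitive x s)) (y - x s) \<le> S.K * (A.\<theta> t - A.\<theta> s) *
         (2 * ((1 + S.K) * (A.\<theta> t - A.\<theta> s)) + (norm (y - x s) + 2 * ((1 + S.K) * (A.\<theta> t - A.\<theta> s)))\<^sup>2 / (2 * r))"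
    by (rule S.limit_path) blast
  interpret Z: time_change_Lipschitz T A.m x S.K
    by unfold_locales (use S.K_pos x_lip in auto)
  obtain h where dom: "bochner_dominated T h (\<lambda>t. S.K * A.m t)"
    and x_eq: "\<And>t. t \<in> {0..T} \<Longrightarrow> x t = x 0 + bochner_integral (lebesgue_on {0..t}) h"
    by (rule Z.density) blast
  interpret X: bochner_dominated T h "\<lambda>t. S.K * A.m t" by (rule dom)
  obtain B where B: "\<And>t. norm (x t) \<le> B" by (rule A.admissible_bound[OF x(1)]) blast
  interpret P: bochner_dominated T "A.perturbation x" "\<lambda>t. (1 + B) * A.m t"
    by (rule A.perturbation_dominated[OF x(1) B])
  \<comment> \<open>Viewing \<theta> as a Bochner primitive of \<open>m\<close> lets the same
    differentiation theorem provide its derivative.\<close>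
  interpret M: bochner_dominated T A.m A.m
  proof
    show "separably_measurable (lebesgue_on {0..T}) A.m"
      using borel_measurable_integrable[OF A.m_int] by (simp only: separably_measurable_second_countable)
    show "AE t in lebesgue_on {0..T}. norm (A.m t) \<le> A.m t"
      using AE_space by eventually_elim (use A.m_ge in force)
  qed (use T A.m_int in auto)
  have \<theta>_eq: "A.\<theta> t = bochner_integral (lebesgue_on {0..t}) A.m" if "t \<in> {0..T}" for t
    using M.H_inner[of t 1] that by (simp add: A.\<theta>_def)
  \<comment> \<open>The last time is excluded because forward difference quotients are used.\<close>
  have "AE t in lebesgue_on {0..T}. t \<noteq> T"
    by (subst AE_lebesgue_on_iff_negligible) (auto intro: negligible_subset[of "{T}"])
  then have "AE t in lebesgue_on {0..T}.
        bochner_integrable (lebesgue_on {0..t}) (\<lambda>s. g t s (x s)) \<and>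
        (\<exists>x'. (x has_vector_derivative x') (at t within {0..T}) \<and>
              x' \<in> {- n + f t (x t) + bochner_integral (lebesgue_on {0..t}) (\<lambda>s. g t s (x s)) | n.
                      n \<in> proximal_normal_cone (C t (x t)) (x t)})"
    using X.AE_has_vector_derivative P.AE_has_vector_derivative M.AE_has_vector_derivative
      A.AE_slice_regular[OF x(1), of "{0..T}", simplified] AE_space
  proof eventually_elim
    case (elim t)
    then have t: "t \<in> {0..T}" "0 \<le> t" "t < T" by auto
    note slice = A.slice_integral[OF x(1) elim(5) t(1)]
    have "((\<lambda>t. x 0 + X.H t) has_vector_derivative (0 + h t)) (at t within {0..T})"
      by (rule has_vector_derivative_add[OF has_vector_derivative_const elim(2)])
    then have dx: "(x has_vector_derivative h t) (at t within {0..T})"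
      using has_vector_derivative_transform[OF t(1) x_eq] by simp
    have d\<theta>: "(A.\<theta> has_vector_derivative A.m t) (at t within {0..T})"
      using has_vector_derivative_transform[OF t(1) \<theta>_eq elim(4)] .
    have dP: "(A.primitive x has_vector_derivative A.perturbation x t) (at t within {0..T})"
      unfolding A.primitive_def[abs_def] by (rule elim(3))
    have "A.perturbation x t - h t \<in> proximal_normal_cone (C t (x t)) (x t)"
      by (rule derivative_in_proximal_normal_cone[OF t(2,3) x_in[OF t(1)] less_imp_le[OF S.K_pos] r(1) order_trans[OF zero_le_one A.m_ge[OF t(1)]] dx dP d\<theta> x_ineq[OF t(2)]])
    \<comment> \<open>The normal vector of the inclusion is
      \<open>A.perturbation x t - h t\<close>.\<close>
    moreover have "h t = - (A.perturbation x t - h t) + f t (x t) + bochner_integral (lebesgue_on {0..t}) (\<lambda>s. g t s (x s))"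
      by (simp add: slice(2) A.perturbation_def)
    ultimately show ?case using slice(1) dx by blast
  qed
  moreover have "abs_continuous_on_interval T x"
    unfolding abs_continuous_on_interval_def using X.bochner_integrable[OF order_refl] x_eq by blast
  ultimately have "sweeping_solution T C f g x\<^sub>0 x"
    unfolding sweeping_solution_def using x(2) by blast
  then show ?thesis by blast
qed

end
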